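(* Let $G$ be a graph on $n$ vertices subject to edge insertions and deletions. Let $\eta>1280$, let $\gamma>0$ be a constant, and let $b$ be a positive integer with $\eta b^{-1}\le \frac{1}{100\log n\cdot\max\{\gamma^{-1},1\}}$. Let $G^b$ be the multigraph in which each edge of $G$ is duplicated $b$ times. There is a deterministic dynamic algorithm that maintains an orientation $\overrightarrow{G}^b$ of $G^b$ and an orientation $\overrightarrow{G}$ of $G$ (an edge $\{u,v\}$ of $G$ being oriented $\overrightarrow{uv}$ when more of its copies in $\overrightarrow{G}^b$ point from $u$ to $v$) such that: (i) every directed edge $\overrightarrow{uv}$ of $\overrightarrow{G}^b$ satisfies $d^+(u)\le(1+\eta b^{-1})\,d^+(v)$; (ii) every vertex has out-degree $O(b\cdot\rho)$ in $\overrightarrow{G}^b$; (iii) every vertex has out-degree $O(\rho)$ in $\overrightarrow{G}$. Each operation in $G$ is processed in worst-case time $O(b^3\log\rho)$, which is $O(\log^3 n\log\rho)$ for $b\in O(\log n)$. Here $\rho$ is the maximum subgraph density of $G$ at the time of the update.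
   Context: The maximum subgraph density of $G=(V,E)$ is $\max_{\emptyset\ne S\subseteq V}|E(S)|/|S|$, where $E(S)$ is the set of edges with both endpoints in $S$. $d^+(u)$ denotes out-degree in the relevant orientation (counting parallel copies with multiplicity). *)

theory Defs
  imports Complex_Main
begin

section \<open>Graphs, density and orientations\<close>

text \<open>
  A simple graph on the vertex set \<open>{..<n}\<close> is given by its set \<open>E\<close> of edges, each a
  two-element subset of \<open>{..<n}\<close>.
\<close>

type_synonym graph = "nat set set"

definition simple_graph :: "nat \<Rightarrow> graph \<Rightarrow> bool" where
  "simple_graph n E \<longleftrightarrow> (\<forall>e\<in>E. e \<subseteq> {..<n} \<and> card e = 2)"

definition induced_edges :: "graph \<Rightarrow> nat set \<Rightarrow> graph" where
  "induced_edges E S = {e \<in> E. e \<subseteq> S}"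

definition max_density :: "nat \<Rightarrow> graph \<Rightarrow> real" where
  "max_density n E =
     Max ((\<lambda>S. real (card (induced_edges E S)) / real (card S)) ` (Pow {..<n} - {{}}))"

text \<open>
  A loopless multigraph is given by its multiplicity function; \<open>duplicate b E\<close> is the
  multigraph in which every edge of \<open>E\<close> occurs \<open>b\<close> times.  An orientation assigns to each
  ordered pair \<open>(u, v)\<close> the number of copies of \<open>{u, v}\<close> directed from \<open>u\<close> to \<open>v\<close>.
  A simple graph is \<open>duplicate 1 E\<close>.
\<close>

definition duplicate :: "nat \<Rightarrow> graph \<Rightarrow> nat set \<Rightarrow> nat" where
  "duplicate b E e = (if e \<in> E then b else 0)"

definition is_orientation :: "nat \<Rightarrow> (nat set \<Rightarrow> nat) \<Rightarrow> (nat \<Rightarrow> nat \<Rightarrow> nat) \<Rightarrow> bool" where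
  "is_orientation n m D \<longleftrightarrow>
     (\<forall>u<n. D u u = 0) \<and> (\<forall>u<n. \<forall>v<n. u \<noteq> v \<longrightarrow> D u v + D v u = m {u, v})"

definition outdeg :: "nat \<Rightarrow> (nat \<Rightarrow> nat \<Rightarrow> nat) \<Rightarrow> nat \<Rightarrow> nat" where
  "outdeg n D u = (\<Sum>v<n. D u v)"

datatype update = Insert nat nat | Delete nat nat

fun valid_update :: "nat \<Rightarrow> graph \<Rightarrow> update \<Rightarrow> bool" where
  "valid_update n E (Insert u v) \<longleftrightarrow> u < n \<and> v < n \<and> u \<noteq> v \<and> {u, v} \<notin> E"
| "valid_update n E (Delete u v) \<longleftrightarrow> u < n \<and> v < n \<and> u \<noteq> v \<and> {u, v} \<in> E"

fun apply_update :: "update \<Rightarrow> graph \<Rightarrow> graph" where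
  "apply_update (Insert u v) E = insert {u, v} E"
| "apply_update (Delete u v) E = E - {{u, v}}"


section \<open>A word RAM\<close>

text \<open>
  Deterministic structured programs over registers and arrays of \<open>w\<close>-bit words.  A program
  is a finite syntax tree, so it names only finitely many registers and arrays.  Addition and
  multiplication are modulo \<open>2 ^ w\<close>, subtraction is truncated at \<open>0\<close>, and comparisons yield
  \<open>0\<close> or \<open>1\<close>.  Every node of the syntax tree that is evaluated costs one time unit.
\<close>

datatype exp =
    Const nat
  | Reg nat
  | Load nat exp
  | Add exp exp
  | Sub exp exp
  | Mul exp exp
  | Div exp exp
  | Mod exp exp
  | Less exp exp
  | Equal exp exp

datatype com =
    Skip
  | Assign nat exp
  | Store nat exp exp
  | Seq com com
  | Cond exp com com
  | While exp com

record state =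
  regs :: "nat \<Rightarrow> nat"
  arrays :: "nat \<Rightarrow> nat \<Rightarrow> nat"

fun eval :: "nat \<Rightarrow> state \<Rightarrow> exp \<Rightarrow> nat" where
  "eval w s (Const c) = c mod 2 ^ w"
| "eval w s (Reg r) = regs s r"
| "eval w s (Load a e) = arrays s a (eval w s e)"
| "eval w s (Add e f) = (eval w s e + eval w s f) mod 2 ^ w"
| "eval w s (Sub e f) = eval w s e - eval w s f"
| "eval w s (Mul e f) = (eval w s e * eval w s f) mod 2 ^ w"
| "eval w s (Div e f) = eval w s e div eval w s f"
| "eval w s (Mod e f) = eval w s e mod eval w s f"
| "eval w s (Less e f) = (if eval w s e < eval w s f then 1 else 0) mod 2 ^ w"
| "eval w s (Equal e f) = (if eval w s e = eval w s f then 1 else 0) mod 2 ^ w"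

fun exp_cost :: "exp \<Rightarrow> nat" where
  "exp_cost (Const c) = 1"
| "exp_cost (Reg r) = 1"
| "exp_cost (Load a e) = 1 + exp_cost e"
| "exp_cost (Add e f) = 1 + exp_cost e + exp_cost f"
| "exp_cost (Sub e f) = 1 + exp_cost e + exp_cost f"
| "exp_cost (Mul e f) = 1 + exp_cost e + exp_cost f"
| "exp_cost (Div e f) = 1 + exp_cost e + exp_cost f"
| "exp_cost (Mod e f) = 1 + exp_cost e + exp_cost f"
| "exp_cost (Less e f) = 1 + exp_cost e + exp_cost f"
| "exp_cost (Equal e f) = 1 + exp_cost e + exp_cost f"

definition set_reg :: "nat \<Rightarrow> nat \<Rightarrow> state \<Rightarrow> state" where
  "set_reg r x s = s\<lparr>regs := (regs s)(r := x)\<rparr>"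

definition set_array :: "nat \<Rightarrow> nat \<Rightarrow> nat \<Rightarrow> state \<Rightarrow> state" where
  "set_array a i x s = s\<lparr>arrays := (arrays s)(a := (arrays s a)(i := x))\<rparr>"

text \<open>
  \<open>exec w c s t s'\<close>: with word length \<open>w\<close>, the program \<open>c\<close> started in \<open>s\<close> terminates in \<open>s'\<close>
  after exactly \<open>t\<close> time units.
\<close>

inductive exec :: "nat \<Rightarrow> com \<Rightarrow> state \<Rightarrow> nat \<Rightarrow> state \<Rightarrow> bool" for w :: nat where
  Skip: "exec w Skip s 1 s"
| Assign: "exec w (Assign r e) s (1 + exp_cost e) (set_reg r (eval w s e) s)"
| Store: "exec w (Store a e f) s (1 + exp_cost e + exp_cost f)
            (set_array a (eval w s e) (eval w s f) s)"
| Seq: "exec w c s t s' \<Longrightarrow> exec w d s' t' s'' \<Longrightarrow> exec w (Seq c d) s (1 + t + t') s''"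
| CondTrue: "eval w s e \<noteq> 0 \<Longrightarrow> exec w c s t s' \<Longrightarrow>
    exec w (Cond e c d) s (1 + exp_cost e + t) s'"
| CondFalse: "eval w s e = 0 \<Longrightarrow> exec w d s t s' \<Longrightarrow>
    exec w (Cond e c d) s (1 + exp_cost e + t) s'"
| WhileFalse: "eval w s e = 0 \<Longrightarrow> exec w (While e c) s (1 + exp_cost e) s"
| WhileTrue: "eval w s e \<noteq> 0 \<Longrightarrow> exec w c s t s' \<Longrightarrow> exec w (While e c) s' t' s'' \<Longrightarrow>
    exec w (While e c) s (1 + exp_cost e + t + t') s''"

lemma exec_deterministic:
  assumes "exec w c s t s'" and "exec w c s u s''"
  shows "t = u \<and> s' = s''"
  using assms
proof (induction arbitrary: u s'' rule: exec.induct)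
  case (Skip s)
  then show ?case by cases simp
next
  case (Assign r e s)
  then show ?case by cases simp
next
  case (Store a e f s)
  then show ?case by cases simp
next
  case (Seq c s t s' d t' s1)
  note ih = Seq.IH
  from Seq.prems show ?case
  proof cases
    case (Seq u1 r u2)
    from ih(1)[OF Seq(2)] have "t = u1" "s' = r" by simp_all
    with ih(2)[of u2 s''] Seq(1,3) show ?thesis by blast
  qed
next
  case (CondTrue s e c t s' d)
  note ih = CondTrue.IH and cond = CondTrue.hyps(1)
  from CondTrue.prems show ?case
  proof cases
    case (CondTrue u1)
    from ih[OF CondTrue(3)] CondTrue(1) show ?thesis by simp
  next
    case (CondFalse u1)
    with cond show ?thesis by simp
  qed
next
  case (CondFalse s e d t s' c)
  note ih = CondFalse.IH and cond = CondFalse.hyps(1)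
  from CondFalse.prems show ?case
  proof cases
    case (CondFalse u1)
    from ih[OF CondFalse(3)] CondFalse(1) show ?thesis by simp
  next
    case (CondTrue u1)
    with cond show ?thesis by simp
  qed
next
  case (WhileFalse s e c)
  from WhileFalse.prems WhileFalse.hyps show ?case by cases auto
next
  case (WhileTrue s e c t s' t' s1)
  note ih = WhileTrue.IH
  from WhileTrue.prems show ?case
  proof cases
    case WhileFalse
    with WhileTrue.hyps(1) show ?thesis by simp
  next
    case (WhileTrue u1 r u2)
    from ih(1)[OF WhileTrue(3)] have "t = u1" "s' = r" by simp_all
    with ih(2)[of u2 s''] WhileTrue(1,4) show ?thesis by blast
  qed
qed


section \<open>Dynamic algorithms\<close>

text \<open>
  A dynamic algorithm is a program run once per update.  Initially all memory is \<open>0\<close> except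
  that registers 0 and 1 hold \<open>n\<close> and \<open>b\<close>; before each run the update is written to
  registers 2 (\<open>1\<close> for an insertion, \<open>0\<close> for a deletion), 3 and 4 (the two endpoints).  All
  other memory persists between updates.
\<close>

definition init_state :: "nat \<Rightarrow> nat \<Rightarrow> state" where
  "init_state n b = \<lparr>regs = (\<lambda>_. 0)(0 := n, 1 := b), arrays = (\<lambda>_ _. 0)\<rparr>"

fun load_update :: "update \<Rightarrow> state \<Rightarrow> state" where
  "load_update (Insert u v) s = set_reg 2 1 (set_reg 3 u (set_reg 4 v s))"
| "load_update (Delete u v) s = set_reg 2 0 (set_reg 3 u (set_reg 4 v s))"

text \<open>
  \<open>reachable w P n b E s\<close>: some sequence of valid updates turns the empty graph on
  \<open>{..<n}\<close> into \<open>E\<close> and the algorithm \<open>P\<close>, having processed these updates, is in state \<open>s\<close>.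
\<close>

inductive reachable :: "nat \<Rightarrow> com \<Rightarrow> nat \<Rightarrow> nat \<Rightarrow> graph \<Rightarrow> state \<Rightarrow> bool"
  for w :: nat and P :: com and n b :: nat where
  init: "reachable w P n b {} (init_state n b)"
| step: "reachable w P n b E s \<Longrightarrow> valid_update n E x \<Longrightarrow> exec w P (load_update x s) t s' \<Longrightarrow>
    reachable w P n b (apply_update x E) s'"

lemma reachable_simple_graph:
  assumes "reachable w P n b E s"
  shows "simple_graph n E"
  using assms
proof induction
  case init
  show ?case by (simp add: simple_graph_def)
next
  case (step E s x t s')
  then show ?case by (cases x) (auto simp: simple_graph_def)
qed

text \<open>
  The two maintained orientations are stored explicitly, as \<open>n \<times> n\<close> tables in row-major order
  in arrays 0 and 1.
\<close>

definition multi_orientation :: "nat \<Rightarrow> state \<Rightarrow> nat \<Rightarrow> nat \<Rightarrow> nat" where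
  "multi_orientation n s u v = arrays s 0 (u * n + v)"

definition simple_orientation :: "nat \<Rightarrow> state \<Rightarrow> nat \<Rightarrow> nat \<Rightarrow> nat" where
  "simple_orientation n s u v = arrays s 1 (u * n + v)"

definition maintains_orientations :: "nat \<Rightarrow> nat \<Rightarrow> graph \<Rightarrow> state \<Rightarrow> bool" where
  "maintains_orientations n b E s \<longleftrightarrow>
     is_orientation n (duplicate b E) (multi_orientation n s) \<and>
     is_orientation n (duplicate 1 E) (simple_orientation n s) \<and>
     (\<forall>u<n. \<forall>v<n. multi_orientation n s u v > multi_orientation n s v u \<longrightarrow>
        simple_orientation n s u v = 1)"

text \<open>
  The factor \<open>log \<rho>\<close> of a running time, bounded below by a constant: \<open>\<rho>\<close> may be less than
  \<open>1\<close>, or \<open>0\<close> for the empty graph.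
\<close>

definition log_factor :: "real \<Rightarrow> real" where
  "log_factor \<rho> = max 1 (ln \<rho>)"

end

theory Submission
  imports Defs
begin

text \<open>
  The copies of an edge are inserted and deleted one at a time.  Inserting a copy out of \<open>x\<close> raises
  the out-degree of \<open>x\<close>; if some out-neighbour \<open>y\<close> has a much smaller out-degree, a copy of
  \<open>xy\<close> is reversed and the surplus moves on to \<open>y\<close>.  Deleting a copy out of \<open>x\<close> is repaired
  symmetrically through an in-neighbour of much larger out-degree.  Along such a chain the
  out-degree changes by a factor \<open>1 + \<Theta>(1/b)\<close> per step (and by at least a constant while it is
  small), so the chain has \<open>O(b log \<rho>)\<close> steps.

  A vertex cannot tell all its out-neighbours about each change of its out-degree.  Every vertex \<open>y\<close>
  therefore sorts its in-neighbours \<open>x\<close> into bags by a possibly outdated out-degree \<open>key x y\<close>, and \<open>x\<close>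
  refreshes only \<open>b\<close> out-neighbours per change, in round-robin order.  That suffices: an entry
  at position \<open>i\<close> of the round-robin queue satisfies \<open>i + b |deg x - key x y| \<le> key x y + b\<close>,
  since each change of \<open>deg x\<close> by one moves the entry \<open>b\<close> positions forward, so keys are
  accurate up to a factor \<open>1 + O(1/b)\<close>.  Increments and decrements use separate queues:
  refreshing an entry upwards may reveal a violated arc, which a decrement could not repair.

  The additive slack, needed while out-degrees are small, is harmless after an update because then
  every vertex of positive degree has out-degree \<open>\<Omega>(b)\<close>.
\<close>

text \<open>The threshold \<open>key x y \<le> tol (deg y)\<close> is imposed on the stored key, not
  on the true out-degree. When \<open>deg y\<close> drops by one, \<open>tol (deg y)\<close> drops
  by at most two, so an arc that becomes violated lies in one of two bags and is found in constant
  time. The slope 4/b of \<open>tol\<close> exceeds the loss of about 1/b from outdated keys by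
  enough that every reversal bridges a gap of factor 1 + 2/b.

  While a chain is under way, the surplus or deficit is seen only in \<open>\<delta>\<close>; the
  recorded degrees, on which keys and thresholds rest, change once, at its end. In an insertion it
  is the refreshing that discovers violated arcs, so up to b refreshes precede each of the O(b log
  \<rho>) reversals; with b copies per edge this is the origin of b^3.

  The density bound is independent of the data structure: it uses only fairness up to 1 + 30/b
  together with the smallness of 1/b against 1/log n. It speaks of the graph before the update,
  whereas the time is measured by the density afterwards; one update moves the density by at most
  one.\<close>

section \<open>A cost calculus for programs\<close>

text \<open>Total correctness with a time bound. The bound is real because the potentials are
  logarithms.\<close>

definition runs_in :: "nat \<Rightarrow> com \<Rightarrow> state \<Rightarrow> real \<Rightarrow> (state \<Rightarrow> bool) \<Rightarrow> bool" where
  "runs_in w c s T Q \<longleftrightarrow> (\<exists>t s'. exec w c s t s' \<and> real t \<le> T \<and> Q s')"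

fun loop_free :: "com \<Rightarrow> bool" where
  "loop_free (Seq c d) \<longleftrightarrow> loop_free c \<and> loop_free d"
| "loop_free (Cond e c d) \<longleftrightarrow> loop_free c \<and> loop_free d"
| "loop_free (While e c) \<longleftrightarrow> False"
| "loop_free _ \<longleftrightarrow> True"

text \<open>The clause for \<open>While\<close> is a dummy: \<open>run\<close> is meant for programs
  that satisfy \<open>loop_free\<close>.\<close>

fun run :: "nat \<Rightarrow> com \<Rightarrow> state \<Rightarrow> state" where
  "run w Skip s = s"
| "run w (Assign r e) s = set_reg r (eval w s e) s"
| "run w (Store a e f) s = set_array a (eval w s e) (eval w s f) s"
| "run w (Seq c d) s = run w d (run w c s)"
| "run w (Cond e c d) s = (if eval w s e \<noteq> 0 then run w c s else run w d s)"
| "run w (While e c) s = s"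

text \<open>The costs of both branches are added: only some numeral is wanted, and a sum is
  evaluated by plain simplification.\<close>

fun max_cost :: "com \<Rightarrow> nat" where
  "max_cost Skip = 1"
| "max_cost (Assign r e) = 1 + exp_cost e"
| "max_cost (Store a e f) = 1 + exp_cost e + exp_cost f"
| "max_cost (Seq c d) = 1 + max_cost c + max_cost d"
| "max_cost (Cond e c d) = 1 + exp_cost e + (max_cost c + max_cost d)"
| "max_cost (While e c) = 0"

lemma exec_run: "loop_free c \<Longrightarrow> \<exists>t. exec w c s t (run w c s) \<and> t \<le> max_cost c"
proof (induction c arbitrary: s)
  case (Seq c d)
  then obtain t1 where 1: "exec w c s t1 (run w c s)" "t1 \<le> max_cost c" by auto
  obtain t2 where 2: "exec w d (run w c s) t2 (run w d (run w c s))" "t2 \<le> max_cost d"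
    using Seq by auto
  show ?case
    using exec.Seq[OF 1(1) 2(1)] 1(2) 2(2) by (auto intro!: exI[of _ "1 + t1 + t2"])
next
  case (Cond e c d)
  then obtain t1 where 1: "exec w c s t1 (run w c s)" "t1 \<le> max_cost c" by auto
  obtain t2 where 2: "exec w d s t2 (run w d s)" "t2 \<le> max_cost d"
    using Cond by auto
  show ?case
  proof (cases "eval w s e = 0")
    case True
    then show ?thesis using exec.CondFalse[OF True 2(1), of c] 2(2)
      by (auto intro!: exI[of _ "1 + exp_cost e + t2"])
  next
    case False
    then show ?thesis using exec.CondTrue[OF False 1(1), of d] 1(2)
      by (auto intro!: exI[of _ "1 + exp_cost e + t1"])
  qed
qed (auto intro: exec.intros)

lemma runs_in_run:
  assumes "loop_free c" "real (max_cost c) \<le> T" "Q (run w c s)"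
  shows "runs_in w c s T Q"
proof -
  obtain t where "exec w c s t (run w c s)" "t \<le> max_cost c" using exec_run[OF assms(1)] by blast
  moreover from this(2) assms(2) have "real t \<le> T" by linarith
  ultimately show ?thesis using assms(3) unfolding runs_in_def by blast
qed

lemma runs_in_seq:
  fixes B C :: real
  assumes "runs_in w c s B (\<lambda>s'. runs_in w d s' C Q)" "1 + B + C \<le> T"
  shows "runs_in w (Seq c d) s T Q"
proof -
  from assms(1) obtain t1 s1 where 1: "exec w c s t1 s1" "real t1 \<le> B" "runs_in w d s1 C Q"
    unfolding runs_in_def by blast
  then obtain t2 s2 where 2: "exec w d s1 t2 s2" "real t2 \<le> C" "Q s2"
    unfolding runs_in_def by blast
  show ?thesis unfolding runs_in_def
    using exec.Seq[OF 1(1) 2(1)] 1(2) 2(2,3) assms(2)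
    by (intro exI[of _ "1 + t1 + t2"] exI[of _ s2]) auto
qed

lemma runs_in_cond:
  fixes B :: real
  assumes "eval w s e \<noteq> 0 \<Longrightarrow> runs_in w c s B Q" "eval w s e = 0 \<Longrightarrow> runs_in w d s B Q"
    and "1 + exp_cost e + B \<le> T"
  shows "runs_in w (Cond e c d) s T Q"
proof (cases "eval w s e = 0")
  case True
  then obtain t s' where "exec w d s t s'" "real t \<le> B" "Q s'"
    using assms(2) unfolding runs_in_def by blast
  then show ?thesis using exec.CondFalse[OF True, of d t s' c] assms(3)
    unfolding runs_in_def by (intro exI[of _ "1 + exp_cost e + t"] exI[of _ s']) auto
next
  case False
  then obtain t s' where "exec w c s t s'" "real t \<le> B" "Q s'"
    using assms(1) unfolding runs_in_def by blast
  then show ?thesis using exec.CondTrue[OF False, of c t s' d] assms(3)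
    unfolding runs_in_def by (intro exI[of _ "1 + exp_cost e + t"] exI[of _ s']) auto
qed

lemma runs_in_mono:
  assumes "runs_in w c s T Q" "T \<le> T'" "\<And>s'. Q s' \<Longrightarrow> Q' s'"
  shows "runs_in w c s T' Q'"
  using assms unfolding runs_in_def by (meson order_trans)

text \<open>The variant \<open>V\<close> is a real potential that loses at least one per iteration;
  the \<open>+ 1\<close> in the bound pays for the last, failing test.\<close>

lemma runs_in_while:
  fixes V :: "state \<Rightarrow> real" and B :: real
  assumes "I s"
    and step: "\<And>s. I s \<Longrightarrow> eval w s e \<noteq> 0 \<Longrightarrow> runs_in w c s B (\<lambda>s'. I s' \<and> V s' \<le> V s - 1)"
    and V: "\<And>s. I s \<Longrightarrow> 0 \<le> V s"
    and Q: "\<And>s. I s \<Longrightarrow> eval w s e = 0 \<Longrightarrow> Q s"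
    and B: "0 \<le> B"
    and T: "(V s + 1) * (B + 1 + exp_cost e) \<le> T"
  shows "runs_in w (While e c) s T Q"
proof -
  define C where "C = B + 1 + exp_cost e"
  have C: "0 \<le> C" using B by (simp add: C_def)
  have "runs_in w (While e c) s ((V s + 1) * C) Q"
    using \<open>I s\<close>
  \<comment> \<open>The reals are not well-founded, but a loss of one lowers the floor of a
    nonnegative potential.\<close>
  proof (induction "nat \<lfloor>V s\<rfloor>" arbitrary: s rule: less_induct)
    case less
    show ?case
    proof (cases "eval w s e = 0")
      case True
      have "1 + exp_cost e \<le> 1 * C" using B by (simp add: C_def)
      also have "\<dots> \<le> (V s + 1) * C" using V[OF less.prems] C by (intro mult_right_mono) auto
      finally show ?thesis using exec.WhileFalse[OF True, of c] Q[OF less.prems True]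
        unfolding runs_in_def by (intro exI[of _ "1 + exp_cost e"] exI[of _ s]) auto
    next
      case False
      from step[OF less.prems False] obtain t s1 where
        1: "exec w c s t s1" "real t \<le> B" "I s1" "V s1 \<le> V s - 1" unfolding runs_in_def by blast
      have "nat \<lfloor>V s1\<rfloor> < nat \<lfloor>V s\<rfloor>" using V[OF 1(3)] 1(4) by linarith
      from less.hyps[OF this 1(3)] obtain t2 s2 where
        2: "exec w (While e c) s1 t2 s2" "real t2 \<le> (V s1 + 1) * C" "Q s2"
        unfolding runs_in_def by blast
      have "(V s1 + 1) * C \<le> V s * C" using 1(4) C by (intro mult_right_mono) auto
      then have "real (1 + exp_cost e + t + t2) \<le> (V s + 1) * C"
        using 1(2) 2(2) by (simp add: C_def algebra_simps)
      then show ?thesis using exec.WhileTrue[OF False 1(1) 2(1)] 2(3) unfolding runs_in_def by blast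
    qed
  qed
  then show ?thesis using T runs_in_mono unfolding C_def by blast
qed

lemma regs_set_reg [simp]: "regs (set_reg r x s) r' = (if r' = r then x else regs s r')"
  by (simp add: set_reg_def)

lemma arrays_set_reg [simp]: "arrays (set_reg r x s) = arrays s"
  by (simp add: set_reg_def)

lemma regs_set_array [simp]: "regs (set_array a i x s) = regs s"
  by (simp add: set_array_def)

lemma arrays_set_array [simp]:
  "arrays (set_array a i x s) = (arrays s)(a := (arrays s a)(i := x))"
  by (simp add: set_array_def)

section \<open>Circular queues\<close>

text \<open>A FIFO queue stored as a circular buffer: cell \<open>(h + i) mod n\<close> holds the \<open>i\<close>-th element.\<close>

definition queue_rep :: "nat \<Rightarrow> nat \<Rightarrow> nat \<Rightarrow> (nat \<Rightarrow> nat) \<Rightarrow> (nat \<Rightarrow> nat) \<Rightarrow> nat list \<Rightarrow> bool" where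
  "queue_rep n h l buf pos q \<longleftrightarrow> h < n \<and> l = length q \<and> length q \<le> n \<and> distinct q \<and> set q \<subseteq> {..<n} \<and>
    (\<forall>i<length q. buf ((h + i) mod n) = q ! i \<and> pos (q ! i) = (h + i) mod n)"

text \<open>Deletion in constant time: the last element fills the gap. The order is not kept, but no
  survivor moves backwards.\<close>

definition swap_remove :: "'a \<Rightarrow> 'a list \<Rightarrow> 'a list" where
  "swap_remove y q = butlast (map (\<lambda>x. if x = y then last q else x) q)"

lemma mod_offset_eq:
  fixes h i j n :: nat
  assumes "(h + i) mod n = (h + j) mod n" "i < n" "j < n"
  shows "i = j"
proof -
  have *: "i = j" if "(h + i) mod n = (h + j) mod n" "i \<le> j" "j < n" for i j
  proof -
    have "n dvd (h + j) - (h + i)" using that mod_eq_dvd_iff_nat[of "h + i" "h + j" n] by simp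
    then have "n dvd j - i" by simp
    moreover have "j - i < n" using that by simp
    ultimately have "j - i = 0" using dvd_imp_le not_less by blast
    then show ?thesis using that by simp
  qed
  show ?thesis using *[of i j] *[of j i] assms by (metis nat_le_linear)
qed

lemma queue_rep_append:
  assumes "queue_rep n h l buf pos q" "y < n" "y \<notin> set q"
  defines "c \<equiv> (h + l) mod n"
  shows "queue_rep n h (l + 1) (buf(c := y)) (pos(y := c)) (q @ [y])"
proof -
  \<comment> \<open>As \<open>y\<close> is missing from the queue, a buffer of \<open>n\<close>
    cells still has a free one.\<close>
  have "set q \<subset> {..<n}" using assms by (auto simp: queue_rep_def)
  then have l: "length q < n" using assms(1) psubset_card_mono[of "{..<n}" "set q"]
    by (auto simp: queue_rep_def distinct_card)
  have ne: "(h + i) mod n \<noteq> c" if "i < length q" for i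
    using mod_offset_eq[of h i n "length q"] that l assms(1) unfolding c_def queue_rep_def by auto
  show ?thesis using assms(1,2,3) l ne
    unfolding queue_rep_def c_def by (auto simp: nth_append less_Suc_eq)
qed

lemma distinct_swap_remove:
  assumes "distinct q" "y \<in> set q"
  shows "set (swap_remove y q) = set q - {y}" "distinct (swap_remove y q)"
    "length (swap_remove y q) = length q - 1"
proof -
  obtain r z where q: "q = r @ [z]" using assms by (metis empty_iff empty_set rev_exhaust)
  have "swap_remove y q = map (\<lambda>x. if x = y then z else x) r"
    by (simp add: swap_remove_def q butlast_append)
  moreover have "distinct (map (\<lambda>x. if x = y then z else x) r)"
    using assms by (auto simp: q distinct_map inj_on_def)
  ultimately show "set (swap_remove y q) = set q - {y}" "distinct (swap_remove y q)"
    "length (swap_remove y q) = length q - 1"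
    using assms by (auto simp: q)
qed

lemma nth_swap_remove:
  "i < length q - 1 \<Longrightarrow> swap_remove y q ! i = (if q ! i = y then last q else q ! i)"
  by (simp add: swap_remove_def nth_butlast)

lemma queue_rep_swap_remove:
  assumes "queue_rep n h l buf pos q" "y \<in> set q"
  defines "z \<equiv> buf ((h + (l - 1)) mod n)"
  shows "queue_rep n h (l - 1) (buf(pos y := z)) (pos(z := pos y)) (swap_remove y q)"
    "z < n" "pos y < n"
proof -
  have q: "h < n" "l = length q" "length q \<le> n" "distinct q" "set q \<subseteq> {..<n}"
    "\<And>i. i < length q \<Longrightarrow> buf ((h + i) mod n) = q ! i"
    "\<And>i. i < length q \<Longrightarrow> pos (q ! i) = (h + i) mod n"
    using assms(1) by (auto simp: queue_rep_def)
  have ne: "q \<noteq> []" using assms by auto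
  have z: "z = last q" using q ne by (simp add: z_def last_conv_nth)
  then show "z < n" using q(5) last_in_set[OF ne] by auto
  obtain j where j: "j < length q" "q ! j = y" using assms(2) by (auto simp: in_set_conv_nth)
  have pj: "pos y = (h + j) mod n" using q(7)[OF j(1)] j by simp
  then show "pos y < n" using q(1) by simp
  have inj: "(h + i) mod n = (h + j) mod n \<longleftrightarrow> i = j" if "i < length q" for i
    using mod_offset_eq[of h i n j] that j q(3) by auto
  show "queue_rep n h (l - 1) (buf(pos y := z)) (pos(z := pos y)) (swap_remove y q)"
    unfolding queue_rep_def
  proof (intro conjI allI impI)
    fix i assume i: "i < length (swap_remove y q)"
    then have il: "i < length q - 1" using distinct_swap_remove[OF q(4) assms(2)] by simp
    have nl: "q ! i \<noteq> z" using il z ne q(4) by (auto simp: last_conv_nth nth_eq_iff_index_eq)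
    have ij: "q ! i = y \<longleftrightarrow> i = j" using il j q(4) by (auto simp: nth_eq_iff_index_eq)
    show "(buf(pos y := z)) ((h + i) mod n) = swap_remove y q ! i"
      using nth_swap_remove[OF il, of y] z q(6) inj[of i] il ij pj by auto
    show "(pos(z := pos y)) (swap_remove y q ! i) = (h + i) mod n"
      using nth_swap_remove[OF il, of y] z q(7) il ij pj nl by auto
  qed (use q distinct_swap_remove[OF q(4) assms(2)] in auto)
qed

text \<open>The hypothesis \<open>length q < n\<close> keeps the cell behind the last element free.
  Queues of out-neighbours satisfy it because a vertex is not its own neighbour.\<close>

lemma queue_rep_rotate:
  assumes "queue_rep n h l buf pos q" "q \<noteq> []" "length q < n"
  defines "c \<equiv> (h + l) mod n"
  shows "queue_rep n ((h + 1) mod n) l (buf(c := hd q)) (pos(hd q := c)) (rotate1 q)" "buf h = hd q"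
    "hd q < n"
proof -
  have q: "h < n" "l = length q" "length q \<le> n" "distinct q" "set q \<subseteq> {..<n}"
    "\<And>i. i < length q \<Longrightarrow> buf ((h + i) mod n) = q ! i"
    "\<And>i. i < length q \<Longrightarrow> pos (q ! i) = (h + i) mod n"
    using assms(1) by (auto simp: queue_rep_def)
  obtain y r where yr: "q = y # r" using assms(2) by (cases q) auto
  show "buf h = hd q" using q(6)[of 0] q(1) yr by simp
  show "hd q < n" using q(5) yr by simp
  have sh: "((h + 1) mod n + i) mod n = (h + Suc i) mod n" for i
    by (simp add: mod_add_left_eq add.assoc)
  have ne: "(h + Suc i) mod n \<noteq> c" if "i < length r" for i
    using mod_offset_eq[of h "Suc i" n l] that assms(3) q(2) yr unfolding c_def by auto
  show "queue_rep n ((h + 1) mod n) l (buf(c := hd q)) (pos(hd q := c)) (rotate1 q)"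
    unfolding queue_rep_def
  proof (intro conjI allI impI)
    fix i assume i: "i < length (rotate1 q)"
    show "(buf(c := hd q)) (((h + 1) mod n + i) mod n) = rotate1 q ! i"
    proof (cases "i < length r")
      case True
      then show ?thesis using ne[OF True] q(6)[of "Suc i"] sh[of i] yr by (auto simp: nth_append)
    next
      case False
      then have "i = length r" using i yr by simp
      then show ?thesis using sh[of i] q(2) yr by (simp add: c_def)
    qed
    show "(pos(hd q := c)) (rotate1 q ! i) = ((h + 1) mod n + i) mod n"
    proof (cases "i < length r")
      case True
      then have "r ! i \<noteq> y" using q(4) yr by auto
      then show ?thesis using q(7)[of "Suc i"] sh[of i] yr True by (auto simp: nth_append)
    next
      case False
      then have "i = length r" using i yr by simp
      then show ?thesis using sh[of i] q(2) yr by (simp add: c_def)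
    qed
  qed (use q yr in auto)
qed

section \<open>Bags\<close>

text \<open>\<open>pos\<close> inverts \<open>bag\<close> on the first \<open>c\<close> cells, so
  inserting, deleting and picking some member all take constant time.\<close>

definition bag_rep :: "nat \<Rightarrow> (nat \<Rightarrow> nat) \<Rightarrow> (nat \<Rightarrow> nat) \<Rightarrow> nat set \<Rightarrow> bool" where
  "bag_rep c bag pos B \<longleftrightarrow> (\<forall>i<c. bag i \<in> B \<and> pos (bag i) = i) \<and> (\<forall>x\<in>B. pos x < c \<and> bag (pos x) = x)"

lemma bag_rep_card:
  assumes "bag_rep c bag pos B"
  shows "card B = c"
proof -
  have "bij_betw bag {..<c} B"
    using assms unfolding bag_rep_def bij_betw_def inj_on_def
    by (metis (no_types, lifting) image_iff image_subsetI lessThan_iff subsetI subset_antisym)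
  then show ?thesis using bij_betw_same_card by fastforce
qed

lemma bag_rep_insert:
  assumes "bag_rep c bag pos B" "x \<notin> B"
  shows "bag_rep (c + 1) (bag(c := x)) (pos(x := c)) (insert x B)"
  using assms unfolding bag_rep_def by (auto simp: less_Suc_eq)

lemma bag_rep_remove:
  assumes "bag_rep c bag pos B" "x \<in> B"
  shows "bag_rep (c - 1) (bag(pos x := bag (c - 1))) (pos(bag (c - 1) := pos x)) (B - {x})"
    "bag (c - 1) \<in> B" "pos x < c"
proof -
  have c: "pos x < c" "c - 1 < c" "bag (pos x) = x" using assms unfolding bag_rep_def by auto
  then show "bag (c - 1) \<in> B" "pos x < c" using assms unfolding bag_rep_def by auto
  have p: "pos (bag (c - 1)) = c - 1" using assms(1) c unfolding bag_rep_def by auto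
  show "bag_rep (c - 1) (bag(pos x := bag (c - 1))) (pos(bag (c - 1) := pos x)) (B - {x})"
    unfolding bag_rep_def
  proof (intro conjI allI impI ballI)
    fix i assume i: "i < c - 1"
    then have bi: "bag i \<in> B" "pos (bag i) = i" using assms(1) by (auto simp: bag_rep_def)
    show "(bag(pos x := bag (c - 1))) i \<in> B - {x}"
      using bi c p i assms by (auto simp: bag_rep_def)
    show "(pos(bag (c - 1) := pos x)) ((bag(pos x := bag (c - 1))) i) = i"
      using bi p i by auto
  next
    fix y assume "y \<in> B - {x}"
    then have y: "y \<in> B" "y \<noteq> x" "pos y < c" "bag (pos y) = y" using assms(1) by (auto simp: bag_rep_def)
    have "pos y \<noteq> pos x" using y c by metis
    then show "(pos(bag (c - 1) := pos x)) y < c - 1"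
      using y c p by (cases "pos y = c - 1") auto
    show "(bag(pos x := bag (c - 1))) ((pos(bag (c - 1) := pos x)) y) = y"
      using y \<open>pos y \<noteq> pos x\<close> by auto
  qed
qed

lemma bag_rep_cong:
  assumes "bag_rep c bag pos B" "\<And>i. i < c \<Longrightarrow> bag' i = bag i" "\<And>x. x \<in> B \<Longrightarrow> pos' x = pos x"
  shows "bag_rep c bag' pos' B"
  using assms unfolding bag_rep_def by auto

lemma index_eq_iff:
  fixes n c c' z z' :: nat
  assumes "c < n" "c' < n"
  shows "z * n + c = z' * n + c' \<longleftrightarrow> z = z' \<and> c = c'"
proof
  assume *: "z * n + c = z' * n + c'"
  have "(z * n + c) div n = z" "(z' * n + c') div n = z'" "(z * n + c) mod n = c"
    "(z' * n + c') mod n = c'" using assms by auto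
  with * show "z = z' \<and> c = c'" by metis
qed auto

lemma index_less:
  fixes x y m k :: nat
  assumes "x < m" "y < k"
  shows "x * k + y < m * k"
proof -
  have "x * k + y < Suc x * k" using assms by simp
  also have "\<dots> \<le> m * k" using assms by (intro mult_right_mono) auto
  finally show ?thesis .
qed

definition upd :: "(nat \<Rightarrow> nat \<Rightarrow> 'a) \<Rightarrow> nat \<Rightarrow> nat \<Rightarrow> 'a \<Rightarrow> nat \<Rightarrow> nat \<Rightarrow> 'a" where
  "upd f x y v = f(x := (f x)(y := v))"

lemma upd_apply: "upd f x y v x' y' = (if x' = x \<and> y' = y then v else f x' y')"
  by (simp add: upd_def)

lemma queue_rep_cong:
  assumes "queue_rep n h l buf pos q" "\<And>c. c < n \<Longrightarrow> buf' c = buf c" "\<And>c. c < n \<Longrightarrow> pos' c = pos c"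
  shows "queue_rep n h l buf' pos' q"
proof -
  have "q ! i < n" if "i < length q" for i using that assms(1) nth_mem unfolding queue_rep_def by fastforce
  then show ?thesis using assms unfolding queue_rep_def by simp
qed

section \<open>Primitive operations on queues, bags and arcs\<close>

text \<open>
  Arrays: 0 multiplicities of arcs, 1 the majority orientation, 2 out-degrees, 3 keys;
  4 to 7 circular buffers (cells, positions, heads, lengths), where row \<open>x\<close> is the queue of \<open>x\<close> for
  increments and row \<open>x + n\<close> the one for decrements; 8 to 10 bags (cells, sizes, positions), one
  for each head and key.

  Registers: 0 to 4 as given, 5 the bound on keys, 6 the vertex whose out-degree is out of balance,
  7 a neighbour of it, 8 refreshes still to be done, 9 whether the chain goes on, 10 copies still to
  be processed; 11 and 12 tail and head of an arc, 13 the row of a queue, 14 a key; from 15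
  on temporaries.
\<close>

definition cell :: "exp \<Rightarrow> exp \<Rightarrow> exp" where
  "cell e f = Add (Mul e (Reg 0)) f"

definition bag_id :: "exp \<Rightarrow> exp \<Rightarrow> exp" where
  "bag_id e f = Add (Mul e (Reg 5)) f"

definition bag_cell :: "exp \<Rightarrow> exp \<Rightarrow> exp \<Rightarrow> exp" where
  "bag_cell e f g = cell (bag_id e f) g"

definition queue_append :: com where
  "queue_append =
    Seq (Assign 15 (Mod (Add (Load 6 (Reg 13)) (Load 7 (Reg 13))) (Reg 0)))
   (Seq (Store 4 (cell (Reg 13) (Reg 15)) (Reg 12))
   (Seq (Store 5 (cell (Reg 13) (Reg 12)) (Reg 15))
        (Store 7 (Reg 13) (Add (Load 7 (Reg 13)) (Const 1)))))"

definition queue_remove :: com where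
  "queue_remove =
    Seq (Assign 16 (Sub (Load 7 (Reg 13)) (Const 1)))
   (Seq (Assign 15 (Load 4 (cell (Reg 13) (Mod (Add (Load 6 (Reg 13)) (Reg 16)) (Reg 0)))))
   (Seq (Assign 17 (Load 5 (cell (Reg 13) (Reg 12))))
   (Seq (Store 4 (cell (Reg 13) (Reg 17)) (Reg 15))
   (Seq (Store 5 (cell (Reg 13) (Reg 15)) (Reg 17))
        (Store 7 (Reg 13) (Reg 16))))))"

definition queue_rotate :: com where
  "queue_rotate =
    Seq (Assign 16 (Load 6 (Reg 13)))
   (Seq (Assign 15 (Mod (Add (Reg 16) (Load 7 (Reg 13))) (Reg 0)))
   (Seq (Assign 17 (Load 4 (cell (Reg 13) (Reg 16))))
   (Seq (Store 4 (cell (Reg 13) (Reg 15)) (Reg 17))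
   (Seq (Store 5 (cell (Reg 13) (Reg 17)) (Reg 15))
        (Store 6 (Reg 13) (Mod (Add (Reg 16) (Const 1)) (Reg 0)))))))"

definition bag_insert :: com where
  "bag_insert =
    Seq (Assign 15 (Load 9 (bag_id (Reg 12) (Reg 14))))
   (Seq (Store 8 (bag_cell (Reg 12) (Reg 14) (Reg 15)) (Reg 11))
   (Seq (Store 10 (cell (Reg 11) (Reg 12)) (Reg 15))
   (Seq (Store 9 (bag_id (Reg 12) (Reg 14)) (Add (Reg 15) (Const 1)))
        (Store 3 (cell (Reg 11) (Reg 12)) (Reg 14)))))"

definition bag_remove :: com where
  "bag_remove =
    Seq (Assign 18 (Load 3 (cell (Reg 11) (Reg 12))))
   (Seq (Assign 16 (Sub (Load 9 (bag_id (Reg 12) (Reg 18))) (Const 1)))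
   (Seq (Assign 15 (Load 8 (bag_cell (Reg 12) (Reg 18) (Reg 16))))
   (Seq (Assign 17 (Load 10 (cell (Reg 11) (Reg 12))))
   (Seq (Store 8 (bag_cell (Reg 12) (Reg 18) (Reg 17)) (Reg 15))
   (Seq (Store 10 (cell (Reg 15) (Reg 12)) (Reg 17))
        (Store 9 (bag_id (Reg 12) (Reg 18)) (Reg 16)))))))"

text \<open>For even \<open>b\<close> both directions can have equally many copies; the smaller
  endpoint then becomes the tail, so that exactly one direction is chosen.\<close>

definition majority :: "(nat \<Rightarrow> nat \<Rightarrow> nat) \<Rightarrow> nat \<Rightarrow> nat \<Rightarrow> nat" where
  "majority D x y = (if D y x < D x y \<or> D x y = D y x \<and> 0 < D x y \<and> x < y then 1 else 0)"

text \<open>Conjunctions are products, and the disjunction may be a sum because its two cases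
  exclude each other.\<close>

definition majority_exp :: "nat \<Rightarrow> nat \<Rightarrow> exp" where
  "majority_exp r r' =
    (let d = Load 0 (cell (Reg r) (Reg r')); d' = Load 0 (cell (Reg r') (Reg r)) in
     Add (Less d' d) (Mul (Equal d d') (Mul (Less (Reg r) (Reg r')) (Less (Const 0) d))))"

definition fix_majority :: com where
  "fix_majority =
    Seq (Store 1 (cell (Reg 11) (Reg 12)) (majority_exp 11 12))
        (Store 1 (cell (Reg 12) (Reg 11)) (majority_exp 12 11))"

definition arc_count :: exp where
  "arc_count = Load 0 (cell (Reg 11) (Reg 12))"

definition add_entry :: com where
  "add_entry =
    Cond (Equal arc_count (Const 0))
      (Seq (Assign 13 (Reg 11)) (Seq queue_append
      (Seq (Assign 13 (Add (Reg 11) (Reg 0))) (Seq queue_append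
      (Seq (Assign 14 (Load 2 (Reg 11))) bag_insert)))))
      Skip"

definition add_arc :: com where
  "add_arc =
    Seq add_entry
   (Seq (Store 0 (cell (Reg 11) (Reg 12)) (Add arc_count (Const 1)))
        fix_majority)"

definition remove_arc :: com where
  "remove_arc =
    Seq (Store 0 (cell (Reg 11) (Reg 12)) (Sub arc_count (Const 1)))
   (Seq fix_majority
   (Cond (Equal arc_count (Const 0))
      (Seq (Assign 13 (Reg 11)) (Seq queue_remove
      (Seq (Assign 13 (Add (Reg 11) (Reg 0))) (Seq queue_remove
           bag_remove))))
      Skip))"

definition frame :: "state \<Rightarrow> state \<Rightarrow> nat set \<Rightarrow> nat \<Rightarrow> bool" where
  "frame s s' As r0 \<longleftrightarrow> (\<forall>a. a \<notin> As \<longrightarrow> arrays s' a = arrays s a) \<and> (\<forall>r<r0. regs s' r = regs s r)"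

text \<open>\<open>100 \<le> b\<close> is far less than what the hypothesis of the theorem yields
  for \<open>n \<ge> 2\<close>; a single vertex is treated apart.\<close>

locale ram =
  fixes n b w :: nat
  assumes n: "2 \<le> n" and b: "100 \<le> b" and w: "(n + b) ^ 8 \<le> 2 ^ w"
begin

text \<open>A key is at most \<open>tol (b * n) = b * n + 4 * n + 8\<close>, so this exceeds every
  key, with room for the two values above the threshold that are searched.\<close>

definition keys :: nat where
  "keys = 2 * b * n + 16"

text \<open>The largest addresses are those of bag cells. With \<open>B = n + b\<close> there are
  \<open>keys \<le> B ^ 3\<close> keys, hence addresses up to \<open>B ^ 5\<close>, and
  \<open>B \<ge> 100\<close> absorbs the constants.\<close>

lemma word_bound: "n * keys * n + n * keys + 100 < 2 ^ w"
proof -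
  define B where "B = n + b"
  have B: "100 \<le> B" "n \<le> B" "b \<le> B" "(1::nat) \<le> B" using b by (auto simp: B_def)
  have p: "B ^ i \<le> B ^ j" if "i \<le> j" for i j using that B by (intro power_increasing) auto
  have p2: "100 * B ^ i \<le> B ^ Suc i" for i using B by simp
  have "b * n \<le> B ^ 2" unfolding power2_eq_square using B by (intro mult_mono) auto
  then have "keys \<le> 2 * B ^ 2 + 16" unfolding keys_def by simp
  also have "\<dots> \<le> B ^ 3" using p2[of 2] p2[of 1] p2[of 0] B(1) by (simp add: numeral_eq_Suc)
  finally have keys: "keys \<le> B ^ 3" .
  have nK: "n * keys \<le> B * B ^ 3" using keys B by (intro mult_mono) auto
  then have "n * keys * n \<le> B * B ^ 3 * B" using B by (intro mult_mono[OF nK]) auto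
  moreover have "B * B ^ 3 * B = B ^ 5" "B * B ^ 3 = B ^ 4" by (simp_all add: numeral_eq_Suc)
  ultimately have "n * keys * n + n * keys + 100 \<le> B ^ 5 + B ^ 4 + 100" using nK by simp
  also have "\<dots> < 100 * B ^ 5" proof -
    have "B ^ 4 \<le> B ^ 5" "B \<le> B ^ 5" using p[of 4 5] p[of 1 5] by simp_all
    then show ?thesis using B(1) by linarith
  qed
  also have "\<dots> \<le> B ^ 8" using p2[of 5] p[of 6 8] by simp
  also have "\<dots> \<le> 2 ^ w" using w by (simp add: B_def)
  finally show ?thesis .
qed

lemma n_le_keys: "2 * n \<le> keys" "4 * n \<le> n * keys"
proof -
  have "1 * n \<le> b * n" using b by (intro mult_right_mono) auto
  then show "2 * n \<le> keys" unfolding keys_def mult.assoc by linarith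
  have "4 \<le> keys" using n \<open>2 * n \<le> keys\<close> by simp
  then show "4 * n \<le> n * keys" by simp
qed

lemma word_less: "x \<le> n * keys \<Longrightarrow> x < 2 ^ w"
  using word_bound by linarith

lemma w_pos [simp]: "0 < w"
  using word_bound by (cases w) auto

lemma small_mod [simp]: "(0::nat) mod 2 ^ w = 0" "Suc 0 mod 2 ^ w = 1" "(2::nat) mod 2 ^ w = 2"
  "(4::nat) mod 2 ^ w = 4" "(8::nat) mod 2 ^ w = 8" "(1::nat) mod 2 ^ w = 1"
  using word_bound by simp_all

lemma eval_cell [simp]:
  assumes "regs s 0 = n" "eval w s e < 2 * n" "eval w s f < n"
  shows "eval w s (cell e f) = eval w s e * n + eval w s f"
proof -
  have "eval w s e * n + eval w s f < 2 * n * n" using assms(2,3) by (rule index_less)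
  also have "\<dots> \<le> n * keys" using n_le_keys by (simp add: algebra_simps)
  finally have "eval w s e * n + eval w s f < 2 ^ w" using word_less by simp
  then show ?thesis using assms(1) by (simp add: cell_def)
qed

lemma eval_bag_id [simp]:
  assumes "regs s 5 = keys" "eval w s e < n" "eval w s f < keys"
  shows "eval w s (bag_id e f) = eval w s e * keys + eval w s f"
proof -
  have "eval w s e * keys + eval w s f < n * keys" using assms(2,3) by (rule index_less)
  then have "eval w s e * keys + eval w s f < 2 ^ w" using word_less by simp
  then show ?thesis using assms(1) by (simp add: bag_id_def)
qed

lemma eval_bag_cell [simp]:
  assumes "regs s 0 = n" "regs s 5 = keys" "eval w s e < n" "eval w s f < keys" "eval w s g < n"
  shows "eval w s (bag_cell e f g) = (eval w s e * keys + eval w s f) * n + eval w s g"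
proof -
  have "eval w s e * keys + eval w s f < n * keys" using assms(3,4) by (rule index_less)
  then have "(eval w s e * keys + eval w s f) * n + eval w s g < n * keys * n"
    using assms(5) by (rule index_less)
  then have "(eval w s e * keys + eval w s f) * n + eval w s g < 2 ^ w" using word_bound by linarith
  then show ?thesis using assms by (simp add: bag_cell_def cell_def[of "bag_id _ _"])
qed

lemma mod_word [simp]: "x \<le> 2 * n \<Longrightarrow> x mod 2 ^ w = x" "x \<le> 2 * n \<Longrightarrow> Suc x mod 2 ^ w = Suc x"
proof -
  assume "x \<le> 2 * n"
  then have "Suc x \<le> n * keys" using n_le_keys n by linarith
  then have "Suc x < 2 ^ w" by (rule word_less)
  then show "x mod 2 ^ w = x" "Suc x mod 2 ^ w = Suc x" by simp_all
qed

section \<open>The data structure in memory\<close>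

definition repQ :: "(nat \<Rightarrow> nat \<Rightarrow> nat) \<Rightarrow> (nat \<Rightarrow> nat list) \<Rightarrow> bool" where
  "repQ A q \<longleftrightarrow> (\<forall>z<2 * n.
     queue_rep n (A 6 z) (A 7 z) (\<lambda>c. A 4 (z * n + c)) (\<lambda>y. A 5 (z * n + y)) (q z))"

text \<open>The relation \<open>P\<close> is abstract so that an entry can leave its bag and return
  under another key while the arc stays. The position table is indexed by arcs alone, since an arc
  lies in only one bag of its head.\<close>

definition repB :: "(nat \<Rightarrow> nat \<Rightarrow> nat) \<Rightarrow> (nat \<Rightarrow> nat \<Rightarrow> bool) \<Rightarrow> (nat \<Rightarrow> nat \<Rightarrow> nat) \<Rightarrow> bool" where
  "repB A P key \<longleftrightarrow> (\<forall>y<n. \<forall>k<keys.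
     bag_rep (A 9 (y * keys + k)) (\<lambda>i. A 8 ((y * keys + k) * n + i)) (\<lambda>x. A 10 (x * n + y))
       {x. x < n \<and> P x y \<and> key x y = k}) \<and>
     (\<forall>x<n. \<forall>y<n. A 3 (x * n + y) = key x y)"

definition repD :: "(nat \<Rightarrow> nat \<Rightarrow> nat) \<Rightarrow> (nat \<Rightarrow> nat \<Rightarrow> nat) \<Rightarrow> bool" where
  "repD A D \<longleftrightarrow> (\<forall>x<n. \<forall>y<n. A 0 (x * n + y) = D x y \<and> A 1 (x * n + y) = majority D x y)"

definition rep :: "state \<Rightarrow> (nat \<Rightarrow> nat \<Rightarrow> nat) \<Rightarrow> (nat \<Rightarrow> nat) \<Rightarrow> (nat \<Rightarrow> nat \<Rightarrow> nat) \<Rightarrow>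
    (nat \<Rightarrow> nat list) \<Rightarrow> bool" where
  "rep s D deg key q \<longleftrightarrow> regs s 0 = n \<and> regs s 1 = b \<and> regs s 5 = keys \<and>
     repD (arrays s) D \<and> (\<forall>x<n. arrays s 2 x = deg x) \<and>
     repB (arrays s) (\<lambda>x y. 0 < D x y) key \<and> repQ (arrays s) q"

text \<open>The common shape of all queue operations: one cell, one position, one head and one
  length of a single row are written. The lemmas on single queues then do the rest.\<close>

lemma repQ_update:
  assumes "repQ A q" "z < 2 * n" "c < n" "y < n"
    and "queue_rep n h l ((\<lambda>c. A 4 (z * n + c))(c := v)) ((\<lambda>y. A 5 (z * n + y))(y := p)) r"
  shows "repQ (A(4 := (A 4)(z * n + c := v), 5 := (A 5)(z * n + y := p),
    6 := (A 6)(z := h), 7 := (A 7)(z := l))) (q(z := r))"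
    (is "repQ ?A' _")
  unfolding repQ_def
proof (intro allI impI)
  fix z' assume z': "z' < 2 * n"
  show "queue_rep n (?A' 6 z')
    (?A' 7 z')
    (\<lambda>c'. ?A' 4 (z' * n + c'))
    (\<lambda>y'. ?A' 5 (z' * n + y')) ((q(z := r)) z')"
  proof (cases "z' = z")
    case True
    show ?thesis using True by (simp, intro queue_rep_cong[OF assms(5)]) auto
  next
    case False
    have q0: "queue_rep n (A 6 z') (A 7 z') (\<lambda>c. A 4 (z' * n + c)) (\<lambda>y. A 5 (z' * n + y)) (q z')"
      using assms(1) z' by (simp add: repQ_def)
    have "((A 4)(z * n + c := v)) (z' * n + c') = A 4 (z' * n + c')"
      "((A 5)(z * n + y := p)) (z' * n + c') = A 5 (z' * n + c')" if "c' < n" for c'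
      using False that assms(3,4) by (simp_all add: index_eq_iff)
    then have "queue_rep n (A 6 z') (A 7 z') (\<lambda>c'. ((A 4)(z * n + c := v)) (z' * n + c'))
        (\<lambda>y'. ((A 5)(z * n + y := p)) (z' * n + y')) (q z')"
      by (intro queue_rep_cong[OF q0]) auto
    then show ?thesis using False by simp
  qed
qed

lemma queue_append_run:
  assumes "repQ (arrays s) q" "regs s 0 = n" "regs s 13 = z" "regs s 12 = y"
    and "z < 2 * n" "y < n" "y \<notin> set (q z)"
  shows "repQ (arrays (run w queue_append s)) (q(z := q z @ [y]))"
    "frame s (run w queue_append s) {4, 5, 7} 15"
proof -
  let ?A = "arrays s"
  define h l where "h = ?A 6 z" and "l = ?A 7 z"
  have r: "queue_rep n h l (\<lambda>c. ?A 4 (z * n + c)) (\<lambda>y. ?A 5 (z * n + y)) (q z)"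
    using assms by (simp add: repQ_def h_def l_def)
  then have hl: "h < n" "l \<le> n" by (auto simp: queue_rep_def)
  define c where "c = (h + l) mod n"
  have c: "c < n" using n by (simp add: c_def)
  have run: "arrays (run w queue_append s) = ?A(4 := (?A 4)(z * n + c := y),
      5 := (?A 5)(z * n + y := c), 7 := (?A 7)(z := Suc l))"
    using assms hl c unfolding queue_append_def
    by (simp add: h_def[symmetric] l_def[symmetric] c_def[symmetric])
  \<comment> \<open>Appending leaves the head alone; writing it back unchanged gives the shape that
    \<open>repQ_update\<close> expects.\<close>
  have [simp]: "(?A(4 := f, 5 := g, 6 := (?A 6)(z := h), 7 := h')) = (?A(4 := f, 5 := g, 7 := h'))"
    for f g h' by (auto simp: h_def fun_eq_iff)
  show "repQ (arrays (run w queue_append s)) (q(z := q z @ [y]))"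
    using repQ_update[OF assms(1,5) c assms(6) queue_rep_append[OF r assms(6,7), folded c_def]]
    unfolding run by simp
  show "frame s (run w queue_append s) {4, 5, 7} 15"
    unfolding frame_def run by (auto simp: queue_append_def)
qed

lemma queue_remove_run:
  assumes "repQ (arrays s) q" "regs s 0 = n" "regs s 13 = z" "regs s 12 = y"
    and "z < 2 * n" "y < n" "y \<in> set (q z)"
  shows "repQ (arrays (run w queue_remove s)) (q(z := swap_remove y (q z)))"
    "frame s (run w queue_remove s) {4, 5, 7} 15"
proof -
  let ?A = "arrays s"
  define h l where "h = ?A 6 z" and "l = ?A 7 z"
  have r: "queue_rep n h l (\<lambda>c. ?A 4 (z * n + c)) (\<lambda>y. ?A 5 (z * n + y)) (q z)"
    using assms by (simp add: repQ_def h_def l_def)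
  then have hl: "h < n" "l \<le> n" by (auto simp: queue_rep_def)
  define c where "c = (h + (l - Suc 0)) mod n"
  have c: "c < n" using n by (simp add: c_def)
  define v i where "v = ?A 4 (z * n + c)" and "i = ?A 5 (z * n + y)"
  note rem = queue_rep_swap_remove[OF r assms(7), unfolded One_nat_def, folded c_def, folded v_def i_def]
  have run: "arrays (run w queue_remove s) = ?A(4 := (?A 4)(z * n + i := v),
      5 := (?A 5)(z * n + v := i), 7 := (?A 7)(z := l - Suc 0))"
    using assms hl c rem unfolding queue_remove_def
    by (simp add: h_def[symmetric] l_def[symmetric] c_def[symmetric] v_def[symmetric] i_def[symmetric])
  have [simp]: "(?A(4 := f, 5 := g, 6 := (?A 6)(z := h), 7 := h')) = (?A(4 := f, 5 := g, 7 := h'))"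
    for f g h' by (auto simp: h_def fun_eq_iff)
  show "repQ (arrays (run w queue_remove s)) (q(z := swap_remove y (q z)))"
    using repQ_update[OF assms(1,5) rem(3,2,1)] unfolding run by simp
  show "frame s (run w queue_remove s) {4, 5, 7} 15"
    unfolding frame_def run by (auto simp: queue_remove_def)
qed

lemma front_eq:
  assumes "repQ A q" "z < 2 * n" "q z \<noteq> []"
  shows "A 4 (z * n + A 6 z) = hd (q z)" "A 6 z < n" "hd (q z) < n"
proof -
  have r: "queue_rep n (A 6 z) (A 7 z) (\<lambda>c. A 4 (z * n + c)) (\<lambda>y. A 5 (z * n + y)) (q z)"
    using assms by (simp add: repQ_def)
  then show "A 6 z < n" "hd (q z) < n" using hd_in_set[OF assms(3)] by (auto simp: queue_rep_def)
  have "\<forall>i<length (q z). A 4 (z * n + (A 6 z + i) mod n) = q z ! i" "0 < length (q z)"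
    using r assms(3) by (auto simp: queue_rep_def)
  then have "A 4 (z * n + (A 6 z + 0) mod n) = q z ! 0" by blast
  then show "A 4 (z * n + A 6 z) = hd (q z)" using \<open>A 6 z < n\<close> assms(3) by (simp add: hd_conv_nth)
qed

lemma queue_length_eq: "repQ A q \<Longrightarrow> z < 2 * n \<Longrightarrow> A 7 z = length (q z)"
  by (auto simp: repQ_def queue_rep_def)

lemma queue_rotate_run:
  assumes "repQ (arrays s) q" "regs s 0 = n" "regs s 13 = z"
    and "z < 2 * n" "q z \<noteq> []" "length (q z) < n"
  shows "repQ (arrays (run w queue_rotate s)) (q(z := rotate1 (q z)))"
    "frame s (run w queue_rotate s) {4, 5, 6} 15"
proof -
  let ?A = "arrays s"
  define h l where "h = ?A 6 z" and "l = ?A 7 z"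
  have r: "queue_rep n h l (\<lambda>c. ?A 4 (z * n + c)) (\<lambda>y. ?A 5 (z * n + y)) (q z)"
    using assms by (simp add: repQ_def h_def l_def)
  then have hl: "h < n" "l \<le> n" by (auto simp: queue_rep_def)
  define c where "c = (h + l) mod n"
  have c: "c < n" using n by (simp add: c_def)
  define v where "v = ?A 4 (z * n + h)"
  note rot = queue_rep_rotate[OF r assms(5,6), folded c_def, folded v_def]
  have run: "arrays (run w queue_rotate s) = ?A(4 := (?A 4)(z * n + c := v),
      5 := (?A 5)(z * n + v := c), 6 := (?A 6)(z := Suc h mod n))"
    using assms hl c rot(2,3) unfolding queue_rotate_def
    by (simp add: h_def[symmetric] l_def[symmetric] c_def[symmetric] v_def[symmetric])
  have [simp]: "(?A(4 := f, 5 := g, 6 := h', 7 := (?A 7)(z := l))) = (?A(4 := f, 5 := g, 6 := h'))"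
    for f g h' by (auto simp: l_def fun_eq_iff)
  show "repQ (arrays (run w queue_rotate s)) (q(z := rotate1 (q z)))"
    using repQ_update[OF assms(1,4) c rot(3,1)] unfolding run rot(2) by simp
  show "frame s (run w queue_rotate s) {4, 5, 6} 15"
    unfolding frame_def run by (auto simp: queue_rotate_def)
qed

text \<open>All bags of a head \<open>y\<close> share one position table. \<open>free\<close>
  ensures that no other bag reads the overwritten position, and \<open>old\<close> that no other bag
  changes as a set.\<close>

lemma repB_update:
  assumes rep: "repB A P key" and "x < n" "y < n" "k < keys" "i < n" "x' < n"
    and new: "bag_rep c ((\<lambda>i. A 8 ((y * keys + k) * n + i))(i := v)) ((\<lambda>x. A 10 (x * n + y))(x' := p))
      {x. x < n \<and> P' x y \<and> key' x y = k}"
    and old: "\<And>y' k'. y' < n \<Longrightarrow> k' < keys \<Longrightarrow> (y', k') \<noteq> (y, k) \<Longrightarrow>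
      {x. x < n \<and> P' x y' \<and> key' x y' = k'} = {x. x < n \<and> P x y' \<and> key x y' = k'}"
    and free: "\<And>k'. k' < keys \<Longrightarrow> k' \<noteq> k \<Longrightarrow> \<not> (P x' y \<and> key x' y = k')"
    and A': "A' 8 = (A 8)((y * keys + k) * n + i := v)" "A' 10 = (A 10)(x' * n + y := p)"
      "A' 9 = (A 9)(y * keys + k := c)" "\<forall>x<n. \<forall>y<n. A' 3 (x * n + y) = key' x y"
  shows "repB A' P' key'"
  unfolding repB_def
proof (intro conjI allI impI A'(4)[rule_format])
  fix y' k' assume yk: "y' < n" "k' < keys"
  have pos: "(x2 * n + y' = x' * n + y) \<longleftrightarrow> x2 = x' \<and> y' = y" for x2
    using yk assms(3) by (simp add: index_eq_iff)
  show "bag_rep (A' 9 (y' * keys + k')) (\<lambda>i. A' 8 ((y' * keys + k') * n + i)) (\<lambda>x. A' 10 (x * n + y'))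
    {x. x < n \<and> P' x y' \<and> key' x y' = k'}"
  proof (cases "(y', k') = (y, k)")
    case True
    then have yk': "y' = y" "k' = k" by auto
    have "(\<lambda>i. A' 8 ((y * keys + k) * n + i)) = (\<lambda>i. A 8 ((y * keys + k) * n + i))(i := v)"
      "(\<lambda>x. A' 10 (x * n + y)) = (\<lambda>x. A 10 (x * n + y))(x' := p)" "A' 9 (y * keys + k) = c"
      using pos n by (auto simp: A' fun_eq_iff yk')
    then show ?thesis using new unfolding yk' by simp
  next
    case False
    let ?B = "{x. x < n \<and> P x y' \<and> key x y' = k'}"
    have r: "bag_rep (A 9 (y' * keys + k')) (\<lambda>i. A 8 ((y' * keys + k') * n + i)) (\<lambda>x. A 10 (x * n + y')) ?B"
      using rep yk by (simp add: repB_def)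
    \<comment> \<open>A bag has at most \<open>n\<close> members, so it stays inside its own row of
      \<open>n\<close> cells.\<close>
    have "card ?B \<le> card {..<n}" by (intro card_mono) auto
    then have c: "A 9 (y' * keys + k') \<le> n" using bag_rep_card[OF r] by simp
    have ne: "y' * keys + k' \<noteq> y * keys + k" using False yk assms(4) by (auto simp: index_eq_iff)
    have "bag_rep (A 9 (y' * keys + k')) (\<lambda>i. A' 8 ((y' * keys + k') * n + i)) (\<lambda>x. A' 10 (x * n + y')) ?B"
    proof (rule bag_rep_cong[OF r])
      fix j assume "j < A 9 (y' * keys + k')"
      then show "A' 8 ((y' * keys + k') * n + j) = A 8 ((y' * keys + k') * n + j)"
        using c ne assms(5) by (simp add: A' index_eq_iff del: mult_Suc)
    next
      fix x2 assume "x2 \<in> ?B"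
      then have "\<not> (x2 = x' \<and> y' = y)" using free[of k'] yk False by auto
      then show "A' 10 (x2 * n + y') = A 10 (x2 * n + y')" by (auto simp: A' pos)
    qed
    then show ?thesis using ne False old[OF yk] by (simp add: A')
  qed
qed

lemma bag_insert_run:
  assumes "repB (arrays s) P key" "regs s 0 = n" "regs s 5 = keys" "regs s 11 = x" "regs s 12 = y"
    "regs s 14 = k" and "x < n" "y < n" "k < keys" "\<not> P x y"
  shows "repB (arrays (run w bag_insert s)) (upd P x y True) (upd key x y k)"
    "frame s (run w bag_insert s) {3, 8, 9, 10} 15"
proof -
  let ?A = "arrays s"
  let ?B = "{x. x < n \<and> P x y \<and> key x y = k}"
  define c where "c = ?A 9 (y * keys + k)"
  have r: "bag_rep c (\<lambda>i. ?A 8 ((y * keys + k) * n + i)) (\<lambda>x. ?A 10 (x * n + y)) ?B"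
    using assms by (simp add: repB_def c_def)
  have "?B \<subset> {..<n}" using assms(7,10) by auto
  then have "card ?B < card {..<n}" by (intro psubset_card_mono) auto
  then have c: "c < n" using bag_rep_card[OF r] by simp
  have run: "arrays (run w bag_insert s) = ?A(8 := (?A 8)((y * keys + k) * n + c := x),
      10 := (?A 10)(x * n + y := c), 9 := (?A 9)(y * keys + k := Suc c), 3 := (?A 3)(x * n + y := k))"
    using assms c unfolding bag_insert_def by (simp add: c_def[symmetric])
  have B: "insert x ?B = {x'. x' < n \<and> upd P x y True x' y \<and> upd key x y k x' y = k}"
    using assms(7) by (auto simp: upd_apply)
  show "repB (arrays (run w bag_insert s)) (upd P x y True) (upd key x y k)"
  proof (rule repB_update[OF assms(1,7,8,9) c assms(7)])
    show "bag_rep (Suc c) ((\<lambda>i. ?A 8 ((y * keys + k) * n + i))(c := x)) ((\<lambda>x. ?A 10 (x * n + y))(x := c))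
      {x'. x' < n \<and> upd P x y True x' y \<and> upd key x y k x' y = k}"
      using bag_rep_insert[OF r, of x] assms(10) unfolding B by simp
    show "\<forall>x'<n. \<forall>y'<n. arrays (run w bag_insert s) 3 (x' * n + y') = upd key x y k x' y'"
      using assms(1,7,8) unfolding run by (simp add: upd_apply index_eq_iff repB_def)
  qed (use assms(10) in \<open>auto simp: upd_apply run\<close>)
  show "frame s (run w bag_insert s) {3, 8, 9, 10} 15"
    unfolding frame_def run by (auto simp: bag_insert_def)
qed

lemma bag_remove_run:
  assumes "repB (arrays s) P key" "regs s 0 = n" "regs s 5 = keys" "regs s 11 = x" "regs s 12 = y"
    and "x < n" "y < n" "key x y < keys" "P x y"
  shows "repB (arrays (run w bag_remove s)) (upd P x y False) key"
    "frame s (run w bag_remove s) {8, 9, 10} 15"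
proof -
  let ?A = "arrays s"
  define k where "k = key x y"
  let ?B = "{x. x < n \<and> P x y \<and> key x y = k}"
  define c where "c = ?A 9 (y * keys + k)"
  have k: "k < keys" "?A 3 (x * n + y) = k" using assms by (auto simp: k_def repB_def)
  have r: "bag_rep c (\<lambda>i. ?A 8 ((y * keys + k) * n + i)) (\<lambda>x. ?A 10 (x * n + y)) ?B"
    using assms k by (simp add: repB_def c_def)
  have "card ?B \<le> card {..<n}" by (intro card_mono) auto
  then have c: "c \<le> n" using bag_rep_card[OF r] by simp
  have xB: "x \<in> ?B" using assms by (simp add: k_def)
  define v i where "v = ?A 8 ((y * keys + k) * n + (c - Suc 0))" and "i = ?A 10 (x * n + y)"
  note rem = bag_rep_remove[OF r xB, unfolded One_nat_def, folded v_def i_def]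
  have i: "i < n" "v < n" "c - Suc 0 < n" using rem c n by auto
  have run: "arrays (run w bag_remove s) = ?A(8 := (?A 8)((y * keys + k) * n + i := v),
      10 := (?A 10)(v * n + y := i), 9 := (?A 9)(y * keys + k := c - Suc 0))"
    using assms k c i unfolding bag_remove_def
    by (simp add: c_def[symmetric] v_def[symmetric] i_def[symmetric])
  have B: "?B - {x} = {x'. x' < n \<and> upd P x y False x' y \<and> key x' y = k}"
    by (auto simp: upd_apply)
  show "repB (arrays (run w bag_remove s)) (upd P x y False) key"
  proof (rule repB_update[OF assms(1,6,7) k(1) i(1,2)])
    show "bag_rep (c - Suc 0) ((\<lambda>i. ?A 8 ((y * keys + k) * n + i))(i := v)) ((\<lambda>x. ?A 10 (x * n + y))(v := i))
      {x'. x' < n \<and> upd P x y False x' y \<and> key x' y = k}"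
      using rem(1) unfolding B .
    show "\<forall>x'<n. \<forall>y'<n. arrays (run w bag_remove s) 3 (x' * n + y') = key x' y'"
      using assms(1) unfolding run by (simp add: repB_def)
  qed (use rem(2) in \<open>auto simp: upd_apply run k_def\<close>)
  show "frame s (run w bag_remove s) {8, 9, 10} 15"
    unfolding frame_def run by (auto simp: bag_remove_def)
qed

lemma eval_majority_exp:
  assumes "regs s 0 = n" "regs s r < n" "regs s r' < n"
    "\<forall>x<n. \<forall>y<n. arrays s 0 (x * n + y) = D x y"
  shows "eval w s (majority_exp r r') = majority D (regs s r) (regs s r')"
  using assms unfolding majority_exp_def majority_def Let_def by simp

end

definition set_key :: com where
  "set_key = Seq bag_remove bag_insert"

lemma frameD:
  assumes "frame s s' As r0"
  shows "a \<notin> As \<Longrightarrow> arrays s' a = arrays s a" "r < r0 \<Longrightarrow> regs s' r = regs s r"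
  using assms by (auto simp: frame_def)

context ram
begin

lemma repQ_cong: "repQ A q \<Longrightarrow> (\<And>a. a \<in> {4, 5, 6, 7} \<Longrightarrow> A' a = A a) \<Longrightarrow> repQ A' q"
  by (simp add: repQ_def)

lemma repB_cong: "repB A P key \<Longrightarrow> (\<And>a. a \<in> {3, 8, 9, 10} \<Longrightarrow> A' a = A a) \<Longrightarrow> repB A' P key"
  by (simp add: repB_def)

lemma repD_cong: "repD A D \<Longrightarrow> (\<And>a. a \<in> {0, 1} \<Longrightarrow> A' a = A a) \<Longrightarrow> repD A' D"
  by (simp add: repD_def)

text \<open>A changed multiplicity affects the majority of its own pair only, but in both
  directions.\<close>

lemma fix_majority_run:
  assumes "regs s 0 = n" "regs s 11 = x" "regs s 12 = y" "x < n" "y < n" "x \<noteq> y"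
    and "repD A D" "arrays s = A(0 := (A 0)(x * n + y := v))"
  shows "repD (arrays (run w fix_majority s)) (upd D x y v)"
    "frame s (run w fix_majority s) {1} 15"
proof -
  let ?D = "upd D x y v"
  have D: "arrays s 0 (x' * n + y') = ?D x' y'" if "x' < n" "y' < n" for x' y'
    using that assms(4,5,7) by (simp add: assms(8) upd_apply index_eq_iff repD_def)
  define s1 where "s1 = set_array 1 (x * n + y) (majority ?D x y) s"
  have s1: "run w (Store 1 (cell (Reg 11) (Reg 12)) (majority_exp 11 12)) s = s1"
    using eval_majority_exp[of s 11 12 ?D] assms D by (simp add: s1_def)
  have "run w fix_majority s = set_array 1 (y * n + x) (majority ?D y x) s1"
    using eval_majority_exp[of s1 12 11 ?D] assms(1-6) D s1 unfolding fix_majority_def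
    by (simp add: s1_def)
  then have run: "run w fix_majority s = set_array 1 (y * n + x) (majority ?D y x)
    (set_array 1 (x * n + y) (majority ?D x y) s)" by (simp add: s1_def)
  show "frame s (run w fix_majority s) {1} 15" by (simp add: run frame_def)
  show "repD (arrays (run w fix_majority s)) ?D"
    unfolding repD_def
  proof (intro allI impI conjI)
    fix x' y' assume xy: "x' < n" "y' < n"
    show "arrays (run w fix_majority s) 0 (x' * n + y') = ?D x' y'" using D xy by (simp add: run)
    show "arrays (run w fix_majority s) 1 (x' * n + y') = majority ?D x' y'"
    proof (cases "(x' = x \<and> y' = y) \<or> (x' = y \<and> y' = x)")
      case True
      then show ?thesis using assms(4-6) by (auto simp: run index_eq_iff)
    next
      case False
      then have "?D x' y' = D x' y'" "?D y' x' = D y' x'" by (simp_all only: upd_apply) meson+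
      then have "majority ?D x' y' = majority D x' y'" by (simp only: majority_def)
      moreover have "A 1 (x' * n + y') = majority D x' y'" using assms(7) xy by (simp add: repD_def)
      moreover have "x' * n + y' \<noteq> x * n + y" "x' * n + y' \<noteq> y * n + x"
        using False assms(4,5) xy by (simp_all add: index_eq_iff)
      ultimately show ?thesis by (simp add: run assms(8))
    qed
  qed
qed

lemma arc_count_eval:
  assumes "repD (arrays s) D" "regs s 0 = n" "regs s 11 = x" "regs s 12 = y" "x < n" "y < n"
  shows "eval w s arc_count = D x y"
  using assms unfolding arc_count_def repD_def by simp

lemma rep_parts:
  assumes "rep s D deg key q"
  shows "regs s 0 = n" "regs s 1 = b" "regs s 5 = keys" "repD (arrays s) D"
    "\<forall>x<n. arrays s 2 x = deg x" "repB (arrays s) (\<lambda>x y. 0 < D x y) key" "repQ (arrays s) q"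
  using assms by (simp_all add: rep_def)

text \<open>Queues and bags hold arcs without multiplicity, so they change only when the first copy
  appears.\<close>

lemma add_arc_run:
  assumes rep: "rep s D deg key q" and "regs s 11 = x" "regs s 12 = y"
    and xy: "x < n" "y < n" "x \<noteq> y" and "deg x < keys" "D x y \<le> b"
    and set: "D x y = 0 \<Longrightarrow> y \<notin> set (q x)" "D x y = 0 \<Longrightarrow> y \<notin> set (q (x + n))"
  shows "rep (run w add_arc s) (upd D x y (D x y + 1)) deg
      (if D x y = 0 then upd key x y (deg x) else key)
      (if D x y = 0 then q(x := q x @ [y], x + n := q (x + n) @ [y]) else q)"
    "\<forall>r<13. regs (run w add_arc s) r = regs s r"
proof -
  note R = rep_parts[OF rep]
  let ?key = "if D x y = 0 then upd key x y (deg x) else key"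
  let ?q = "if D x y = 0 then q(x := q x @ [y], x + n := q (x + n) @ [y]) else q"
  let ?P = "\<lambda>x y. 0 < D x y"
  define s6 where "s6 = run w add_entry s"
  have D: "eval w s arc_count = D x y" using R assms(2-5) by (intro arc_count_eval) auto
  have xn: "x + n < 2 * n" "x < 2 * n" using xy by auto
  have "repQ (arrays s6) ?q \<and> repB (arrays s6) (upd ?P x y True) ?key \<and> frame s s6 {3,4,5,7,8,9,10} 13"
  proof (cases "D x y = 0")
    case True
    define s1 where "s1 = set_reg 13 x s"
    define s2 where "s2 = run w queue_append s1"
    define s3 where "s3 = set_reg 13 (x + n) s2"
    define s4 where "s4 = run w queue_append s3"
    define s5 where "s5 = set_reg 14 (deg x) s4"
    have 2: "repQ (arrays s2) (q(x := q x @ [y]))" "frame s1 s2 {4, 5, 7} 15"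
      unfolding s2_def by (rule queue_append_run; use R assms(2-5) True set xn in \<open>simp add: s1_def\<close>)+
    have r2: "regs s2 11 = x" "regs s2 0 = n" "regs s2 12 = y" "regs s2 5 = keys"
      using frameD(2)[OF 2(2)] R assms(2,3) by (simp_all add: s1_def)
    have 4: "repQ (arrays s4) ((q(x := q x @ [y]))(x + n := (q(x := q x @ [y])) (x + n) @ [y]))"
      "frame s3 s4 {4, 5, 7} 15"
      unfolding s4_def using queue_append_run[of s3 "q(x := q x @ [y])" "x + n" y] 2(1) r2 xy True set xn n
      by (simp_all add: s3_def)
    have r4: "regs s4 11 = x" "regs s4 0 = n" "regs s4 12 = y" "regs s4 5 = keys"
      using frameD(2)[OF 4(2)] r2 by (simp_all add: s3_def)
    have a4: "arrays s4 a = arrays s a" if "a \<notin> {4, 5, 7}" for a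
      using frameD(1)[OF 4(2) that] frameD(1)[OF 2(2) that] by (simp add: s3_def s1_def)
    have s6: "s6 = run w bag_insert s5"
      using True D R r2 r4 a4 xy by (simp add: s6_def add_entry_def s1_def[symmetric] s2_def[symmetric]
          s3_def[symmetric] s4_def[symmetric] s5_def[symmetric] assms(2))
    have B4: "repB (arrays s4) ?P key" by (rule repB_cong[OF R(6)]) (use a4 in auto)
    have 6: "repB (arrays s6) (upd ?P x y True) (upd key x y (deg x))" "frame s5 s6 {3, 8, 9, 10} 15"
      unfolding s6 using bag_insert_run[of s5 ?P key x y "deg x"] B4 r4 xy True \<open>deg x < keys\<close>
      by (simp_all add: s5_def)
    have "repQ (arrays s6) ?q"
    proof -
      have "arrays s6 a = arrays s4 a" if "a \<in> {4, 5, 6, 7}" for a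
        using frameD(1)[OF 6(2), of a] that by (auto simp: s5_def)
      from repQ_cong[OF 4(1) this] show ?thesis using True n by simp
    qed
    moreover have "arrays s6 a = arrays s a" if "a \<notin> {3,4,5,7,8,9,10}" for a
      using that frameD(1)[OF 6(2), of a] a4[of a] by (simp add: s5_def)
    moreover have "regs s6 r = regs s r" if "r < 13" for r
      using that frameD(2)[OF 6(2), of r] frameD(2)[OF 4(2), of r] frameD(2)[OF 2(2), of r]
      by (simp add: s5_def s3_def s1_def)
    ultimately show ?thesis using 6(1) True by (auto simp: frame_def)
  next
    case False
    then have "s6 = s" using D by (simp add: s6_def add_entry_def)
    moreover have "upd ?P x y True = ?P" using False by (auto simp: upd_apply fun_eq_iff)
    ultimately show ?thesis using R False by (auto simp: frame_def)
  qed
  then have Q: "repQ (arrays s6) ?q" and B: "repB (arrays s6) (upd ?P x y True) ?key"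
    and F: "frame s s6 {3,4,5,7,8,9,10} 13" by blast+
  have r6: "regs s6 0 = n" "regs s6 11 = x" "regs s6 12 = y" "regs s6 1 = b" "regs s6 5 = keys"
    using frameD(2)[OF F] R(1-3) assms(2,3) by simp_all
  have D6: "repD (arrays s6) D" by (rule repD_cong[OF R(4)]) (use frameD(1)[OF F] in auto)
  have e6: "eval w s6 arc_count = D x y" using D6 r6 xy by (intro arc_count_eval) auto
  have "b * 1 \<le> b * n" using n by (intro mult_le_mono2) auto
  then have "Suc b \<le> keys" unfolding keys_def mult.assoc by linarith
  also have "\<dots> \<le> n * keys" using n by simp
  finally have "Suc (D x y) < 2 ^ w" using assms(8) by (intro word_less) simp
  then have v: "eval w s6 (Add arc_count (Const 1)) = D x y + 1" using e6 by simp
  define s7 where "s7 = set_array 0 (x * n + y) (D x y + 1) s6"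
  have run: "run w add_arc s = run w fix_majority s7"
    unfolding add_arc_def run.simps s6_def[symmetric] v using r6 xy by (simp add: s7_def)
  have 8: "repD (arrays (run w fix_majority s7)) (upd D x y (D x y + 1))"
    "frame s7 (run w fix_majority s7) {1} 15"
    by (rule fix_majority_run[OF _ _ _ xy D6]; use r6 in \<open>simp add: s7_def\<close>)+
  let ?s = "run w fix_majority s7"
  have a: "arrays ?s a = arrays s6 a" if "a \<notin> {0, 1}" for a
    using frameD(1)[OF 8(2), of a] that by (simp add: s7_def)
  have "(\<lambda>x' y'. 0 < upd D x y (D x y + 1) x' y') = upd ?P x y True"
    by (auto simp: upd_apply fun_eq_iff)
  moreover have "repB (arrays ?s) (upd ?P x y True) ?key" using B by (rule repB_cong) (use a in auto)
  moreover have "repQ (arrays ?s) ?q" using Q by (rule repQ_cong) (use a in auto)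
  moreover have "\<forall>x<n. arrays ?s 2 x = deg x" using a[of 2] frameD(1)[OF F, of 2] R by simp
  moreover have r: "\<forall>r<13. regs ?s r = regs s r"
    using frameD(2)[OF 8(2)] frameD(2)[OF F] by (simp add: s7_def)
  ultimately show "rep (run w add_arc s) (upd D x y (D x y + 1)) deg ?key ?q"
    "\<forall>r<13. regs (run w add_arc s) r = regs s r"
    using 8(1) R unfolding rep_def run by auto
qed

lemma remove_arc_run:
  assumes rep: "rep s D deg key q" and "regs s 11 = x" "regs s 12 = y"
    and xy: "x < n" "y < n" "x \<noteq> y" and pos: "0 < D x y" and "key x y < keys"
    and set: "y \<in> set (q x)" "y \<in> set (q (x + n))"
  shows "rep (run w remove_arc s) (upd D x y (D x y - 1)) deg key
      (if D x y = 1 then q(x := swap_remove y (q x), x + n := swap_remove y (q (x + n))) else q)"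
    "\<forall>r<13. regs (run w remove_arc s) r = regs s r"
proof -
  note R = rep_parts[OF rep]
  let ?q = "if D x y = 1 then q(x := swap_remove y (q x), x + n := swap_remove y (q (x + n))) else q"
  let ?P = "\<lambda>x y. 0 < D x y"
  let ?P' = "\<lambda>x' y'. 0 < upd D x y (D x y - 1) x' y'"
  have xn: "x + n < 2 * n" "x < 2 * n" using xy by auto
  have e: "eval w s arc_count = D x y" using R assms(2-5) by (intro arc_count_eval) auto
  define s0 where "s0 = set_array 0 (x * n + y) (D x y - 1) s"
  have s0: "run w (Store 0 (cell (Reg 11) (Reg 12)) (Sub arc_count (Const 1))) s = s0"
    using e R assms(2,3) xy by (simp add: s0_def)
  define s7 where "s7 = run w fix_majority s0"
  have 8: "repD (arrays s7) (upd D x y (D x y - 1))" "frame s0 s7 {1} 15"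
    unfolding s7_def by (rule fix_majority_run[OF _ _ _ xy R(4)]; use R(1) assms(2,3) in \<open>simp add: s0_def\<close>)+
  have a7: "arrays s7 a = arrays s a" if "a \<notin> {0, 1}" for a
    using frameD(1)[OF 8(2), of a] that by (simp add: s0_def)
  have r7: "regs s7 r = regs s r" if "r < 13" for r
    using frameD(2)[OF 8(2), of r] that by (simp add: s0_def)
  have e7: "eval w s7 arc_count = D x y - 1"
    using arc_count_eval[OF 8(1), of x y] r7 R assms(2-5) by (simp add: upd_apply)
  have Q7: "repQ (arrays s7) q" by (rule repQ_cong[OF R(7)]) (use a7 in auto)
  have B7: "repB (arrays s7) ?P key" by (rule repB_cong[OF R(6)]) (use a7 in auto)
  define s6 where "s6 = run w remove_arc s"
  have "repQ (arrays s6) ?q \<and> repB (arrays s6) ?P' key \<and> frame s7 s6 {4,5,7,8,9,10} 13"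
  proof (cases "D x y = 1")
    case True
    define s1 where "s1 = set_reg 13 x s7"
    define s2 where "s2 = run w queue_remove s1"
    define s3 where "s3 = set_reg 13 (x + n) s2"
    define s4 where "s4 = run w queue_remove s3"
    have rs: "regs s7 11 = x" "regs s7 0 = n" "regs s7 12 = y" "regs s7 5 = keys"
      using R r7 assms(2,3) by auto
    have 2: "repQ (arrays s2) (q(x := swap_remove y (q x)))" "frame s1 s2 {4, 5, 7} 15"
      unfolding s2_def by (rule queue_remove_run; use Q7 rs assms(2-5) set xn in \<open>simp add: s1_def\<close>)+
    have r2: "regs s2 11 = x" "regs s2 0 = n" "regs s2 12 = y" "regs s2 5 = keys"
      using frameD(2)[OF 2(2)] rs by (simp_all add: s1_def)
    have 4: "repQ (arrays s4) ((q(x := swap_remove y (q x)))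
        (x + n := swap_remove y ((q(x := swap_remove y (q x))) (x + n))))"
      "frame s3 s4 {4, 5, 7} 15"
      unfolding s4_def using queue_remove_run[of s3 "q(x := swap_remove y (q x))" "x + n" y] 2(1) r2 xy set xn n
      by (simp_all add: s3_def)
    have r4: "regs s4 11 = x" "regs s4 0 = n" "regs s4 12 = y" "regs s4 5 = keys"
      using frameD(2)[OF 4(2)] r2 by (simp_all add: s3_def)
    have a4: "arrays s4 a = arrays s7 a" if "a \<notin> {4, 5, 7}" for a
      using frameD(1)[OF 4(2) that] frameD(1)[OF 2(2) that] by (simp add: s3_def s1_def)
    have s6: "s6 = run w bag_remove s4"
      unfolding s6_def remove_arc_def run.simps(4) s0 s7_def[symmetric]
      using True e7 rs r2 xn by (simp add: s1_def[symmetric] s2_def[symmetric]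
          s3_def[symmetric] s4_def[symmetric])
    have B4: "repB (arrays s4) ?P key" by (rule repB_cong[OF B7]) (use a4 in auto)
    have 6: "repB (arrays s6) (upd ?P x y False) key" "frame s4 s6 {8, 9, 10} 15"
      unfolding s6 using bag_remove_run[OF B4, of x y] r4 xy True \<open>key x y < keys\<close> by simp_all
    have "repQ (arrays s6) ?q"
    proof -
      have "arrays s6 a = arrays s4 a" if "a \<in> {4, 5, 6, 7}" for a
        using frameD(1)[OF 6(2), of a] that by auto
      from repQ_cong[OF 4(1) this] show ?thesis using True n by simp
    qed
    moreover have "arrays s6 a = arrays s7 a" if "a \<notin> {4,5,7,8,9,10}" for a
      using that frameD(1)[OF 6(2), of a] a4[of a] by simp
    moreover have "regs s6 r = regs s7 r" if "r < 13" for r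
      using that frameD(2)[OF 6(2), of r] frameD(2)[OF 4(2), of r] frameD(2)[OF 2(2), of r]
      by (simp add: s3_def s1_def)
    moreover have "?P' = upd ?P x y False" using True by (auto simp: upd_apply fun_eq_iff)
    ultimately show ?thesis using 6(1) by (auto simp: frame_def)
  next
    case False
    then have "s6 = s7"
      unfolding s6_def remove_arc_def run.simps(4) s0 s7_def[symmetric] using e7 pos by simp
    moreover have "?P' = ?P" using False pos by (auto simp: upd_apply fun_eq_iff)
    ultimately show ?thesis using Q7 B7 False by (auto simp: frame_def)
  qed
  then have Q: "repQ (arrays s6) ?q" and B: "repB (arrays s6) ?P' key"
    and F: "frame s7 s6 {4,5,7,8,9,10} 13" by blast+
  have r: "\<forall>r<13. regs s6 r = regs s r" using frameD(2)[OF F] r7 by simp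
  moreover have "repD (arrays s6) (upd D x y (D x y - 1))"
    using 8(1) by (rule repD_cong) (use frameD(1)[OF F] in auto)
  moreover have "\<forall>x<n. arrays s6 2 x = deg x" using a7[of 2] frameD(1)[OF F, of 2] R by simp
  ultimately show "rep (run w remove_arc s) (upd D x y (D x y - 1)) deg key ?q"
    "\<forall>r<13. regs (run w remove_arc s) r = regs s r"
    using Q B R unfolding rep_def s6_def by auto
qed

lemma set_key_run:
  assumes rep: "rep s D deg key q" and "regs s 11 = x" "regs s 12 = y" "regs s 14 = k"
    and xy: "x < n" "y < n" and pos: "0 < D x y" and "key x y < keys" "k < keys"
  shows "rep (run w set_key s) D deg (upd key x y k) q" "\<forall>r<15. regs (run w set_key s) r = regs s r"
proof -
  note R = rep_parts[OF rep]
  let ?P = "\<lambda>x y. 0 < D x y"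
  define s1 where "s1 = run w bag_remove s"
  have 1: "repB (arrays s1) (upd ?P x y False) key" "frame s s1 {8, 9, 10} 15"
    unfolding s1_def using bag_remove_run[OF R(6,1,3) assms(2,3) xy assms(8)] pos by simp_all
  have r1: "regs s1 r = regs s r" if "r < 15" for r using frameD(2)[OF 1(2) that] .
  define s2 where "s2 = run w bag_insert s1"
  have 2: "repB (arrays s2) (upd (upd ?P x y False) x y True) (upd key x y k)"
    "frame s1 s2 {3, 8, 9, 10} 15"
    unfolding s2_def using bag_insert_run[OF 1(1), of x y k] R(1,3) assms(2-9) r1 by (simp_all add: upd_apply)
  have run: "run w set_key s = s2" by (simp add: set_key_def s1_def s2_def)
  have P: "upd (upd ?P x y False) x y True = ?P" using pos by (auto simp: upd_apply fun_eq_iff)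
  have a: "arrays s2 a = arrays s a" if "a \<notin> {3, 8, 9, 10}" for a
    using frameD(1)[OF 2(2) that] frameD(1)[OF 1(2), of a] that by simp
  have r: "regs s2 r = regs s r" if "r < 15" for r using frameD(2)[OF 2(2) that] r1[OF that] by simp
  have "repQ (arrays s2) q" by (rule repQ_cong[OF R(7)]) (use a in auto)
  moreover have "repD (arrays s2) D" by (rule repD_cong[OF R(4)]) (use a in auto)
  ultimately show "rep (run w set_key s) D deg (upd key x y k) q"
    using 2(1) P R(1-3,5) r a[of 2] unfolding run rep_def by simp
  show "\<forall>r<15. regs (run w set_key s) r = regs s r" using r unfolding run by simp
qed

lemma rotate_rep:
  assumes rep: "rep s D deg key q" and "regs s 13 = z" "z < 2 * n" "q z \<noteq> []" "length (q z) < n"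
  shows "rep (run w queue_rotate s) D deg key (q(z := rotate1 (q z)))"
    "\<forall>r<15. regs (run w queue_rotate s) r = regs s r"
proof -
  note R = rep_parts[OF rep]
  have 1: "repQ (arrays (run w queue_rotate s)) (q(z := rotate1 (q z)))"
    "frame s (run w queue_rotate s) {4, 5, 6} 15"
    by (rule queue_rotate_run; use R assms(2-5) in simp)+
  note a = frameD(1)[OF 1(2)]
  have "repB (arrays (run w queue_rotate s)) (\<lambda>x y. 0 < D x y) key"
    by (rule repB_cong[OF R(6)]) (use a in auto)
  moreover have "repD (arrays (run w queue_rotate s)) D" by (rule repD_cong[OF R(4)]) (use a in auto)
  ultimately show "rep (run w queue_rotate s) D deg key (q(z := rotate1 (q z)))"
    using 1 R frameD(2)[OF 1(2)] a[of 2] unfolding rep_def by simp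
  show "\<forall>r<15. regs (run w queue_rotate s) r = regs s r" using frameD(2)[OF 1(2)] by simp
qed

end

section \<open>The invariant\<close>

text \<open>Stated as an equation of sums because subtraction truncates.\<close>

lemma outdeg_upd:
  assumes "x < n" "y < n"
  shows "outdeg n (upd D x y v) x' + (if x' = x then D x y else 0) = outdeg n D x' + (if x' = x then v else 0)"
proof (cases "x' = x")
  case True
  have "outdeg n (upd D x y v) x = v + (\<Sum>y'\<in>{..<n} - {y}. upd D x y v x y')"
    unfolding outdeg_def using assms by (subst sum.remove[of _ y]) (auto simp: upd_apply)
  moreover have "outdeg n D x = D x y + (\<Sum>y'\<in>{..<n} - {y}. D x y')"
    unfolding outdeg_def using assms by (subst sum.remove[of _ y]) auto
  moreover have "(\<Sum>y'\<in>{..<n} - {y}. upd D x y v x y') = (\<Sum>y'\<in>{..<n} - {y}. D x y')"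
    by (intro sum.cong) (auto simp: upd_apply)
  ultimately show ?thesis using True by simp
qed (simp add: outdeg_def upd_apply)

text \<open>The bounds \<open>up\<close> and \<open>down\<close> get easier towards the front, so
  this is why they survive a deletion.\<close>

lemma swap_remove_nth:
  assumes "distinct q" "y \<in> set q" "i < length (swap_remove y q)"
  shows "\<exists>j\<ge>i. j < length q \<and> swap_remove y q ! i = q ! j"
proof -
  have i: "i < length q - 1" using distinct_swap_remove(3)[OF assms(1,2)] assms(3) by simp
  show ?thesis
  proof (cases "q ! i = y")
    case True
    have "last q = q ! (length q - 1)" using assms(2) by (intro last_conv_nth) auto
    then show ?thesis using nth_swap_remove[OF i, of y] True i by (intro exI[of _ "length q - 1"]) auto
  next
    case False
    then show ?thesis using nth_swap_remove[OF i, of y] i by (intro exI[of _ i]) auto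
  qed
qed

context ram
begin

definition tol :: "nat \<Rightarrow> nat" where
  "tol d = d + 8 + 4 * d div b"

lemma tol_mono: "d \<le> d' \<Longrightarrow> tol d \<le> tol d'"
  unfolding tol_def by (intro add_mono div_le_mono) auto

lemma le_tol: "d \<le> tol d"
  by (simp add: tol_def)

text \<open>Hence lowering the out-degree of a head from \<open>Suc d\<close> to \<open>d\<close>
  can only violate arcs with key \<open>tol d + 1\<close> or \<open>tol d + 2\<close>, and two bags
  are enough to search.\<close>

lemma tol_Suc: "tol (Suc d) \<le> tol d + 2"
proof -
  have "4 * Suc d \<le> 4 * d + b" using b by simp
  then have "4 * Suc d div b \<le> (4 * d + b) div b" by (rule div_le_mono)
  also have "\<dots> = 4 * d div b + 1" using b by simp
  finally show ?thesis by (simp add: tol_def)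
qed

text \<open>
  \<open>m\<close> gives the current multiplicities, which are between those of two graphs in the midst of an
  update, and \<open>\<delta> x\<close> is the amount by which the true out-degree of \<open>x\<close> exceeds the recorded one.
\<close>

definition core :: "(nat set \<Rightarrow> nat) \<Rightarrow> (nat \<Rightarrow> int) \<Rightarrow> (nat \<Rightarrow> nat \<Rightarrow> nat) \<Rightarrow> (nat \<Rightarrow> nat) \<Rightarrow>
    (nat \<Rightarrow> nat \<Rightarrow> nat) \<Rightarrow> (nat \<Rightarrow> nat list) \<Rightarrow> bool" where
  "core m \<delta> D deg key q \<longleftrightarrow>
     is_orientation n m D \<and> (\<forall>e. m e \<le> b) \<and>
     (\<forall>x<n. \<delta> x \<in> {-1..1} \<and> int (outdeg n D x) = int (deg x) + \<delta> x) \<and>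
     (\<forall>x<n. \<forall>y<n. 0 < D x y \<longrightarrow> key x y \<le> tol (deg y)) \<and>
     (\<forall>x<n. distinct (q x) \<and> distinct (q (x + n)) \<and>
        set (q x) = {y. y < n \<and> 0 < D x y} \<and> set (q (x + n)) = {y. y < n \<and> 0 < D x y})"

text \<open>The term \<open>key\<close> on the right absorbs the position of a fresh entry, since a
  queue is no longer than the out-degree. The last summand \<open>b\<close> absorbs a difference of
  one between key and recorded degree, as an abandoned scan leaves behind.\<close>

definition up :: "(nat \<Rightarrow> nat) \<Rightarrow> (nat \<Rightarrow> nat \<Rightarrow> nat) \<Rightarrow> (nat \<Rightarrow> nat list) \<Rightarrow> nat \<Rightarrow> bool" where
  "up deg key q x \<longleftrightarrow> (\<forall>i<length (q x).
     i + b * deg x \<le> b * key x (q x ! i) + key x (q x ! i) + b)"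

definition down :: "(nat \<Rightarrow> nat) \<Rightarrow> (nat \<Rightarrow> nat \<Rightarrow> nat) \<Rightarrow> (nat \<Rightarrow> nat list) \<Rightarrow> nat \<Rightarrow> bool" where
  "down deg key q x \<longleftrightarrow> (\<forall>i<length (q (x + n)).
     i + b * key x (q (x + n) ! i) \<le> b * deg x + key x (q (x + n) ! i) + b)"

definition invar :: "(nat set \<Rightarrow> nat) \<Rightarrow> (nat \<Rightarrow> int) \<Rightarrow> (nat \<Rightarrow> nat \<Rightarrow> nat) \<Rightarrow> (nat \<Rightarrow> nat) \<Rightarrow>
    (nat \<Rightarrow> nat \<Rightarrow> nat) \<Rightarrow> (nat \<Rightarrow> nat list) \<Rightarrow> bool" where
  "invar m \<delta> D deg key q \<longleftrightarrow> core m \<delta> D deg key q \<and> (\<forall>x<n. up deg key q x \<and> down deg key q x)"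

lemma invarD:
  assumes "invar m \<delta> D deg key q"
  shows "core m \<delta> D deg key q" "x < n \<Longrightarrow> up deg key q x" "x < n \<Longrightarrow> down deg key q x"
  using assms by (simp_all add: invar_def)

lemma coreD:
  assumes "core m \<delta> D deg key q"
  shows "is_orientation n m D" "m e \<le> b"
    "x < n \<Longrightarrow> \<delta> x \<in> {-1..1}" "x < n \<Longrightarrow> int (outdeg n D x) = int (deg x) + \<delta> x"
    "x < n \<Longrightarrow> y < n \<Longrightarrow> 0 < D x y \<Longrightarrow> key x y \<le> tol (deg y)"
    "x < n \<Longrightarrow> distinct (q x)" "x < n \<Longrightarrow> distinct (q (x + n))"
    "x < n \<Longrightarrow> set (q x) = {y. y < n \<and> 0 < D x y}"
    "x < n \<Longrightarrow> set (q (x + n)) = {y. y < n \<and> 0 < D x y}"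
  using assms unfolding core_def by blast+

lemma core_arc:
  assumes "core m \<delta> D deg key q" "x < n" "y < n"
  shows "D x x = 0" "x \<noteq> y \<Longrightarrow> D x y + D y x = m {x, y}" "D x y \<le> b" "0 < D x y \<Longrightarrow> x \<noteq> y"
proof -
  note o = coreD(1)[OF assms(1), unfolded is_orientation_def]
  show 1: "D x x = 0" and 2: "x \<noteq> y \<Longrightarrow> D x y + D y x = m {x, y}" using o assms(2,3) by blast+
  then show "0 < D x y \<Longrightarrow> x \<noteq> y" by auto
  show "D x y \<le> b"
  proof (cases "x = y")
    case False
    then have "D x y + D y x \<le> b" using 2 coreD(2)[OF assms(1)] by simp
    then show ?thesis by simp
  qed (use 1 in simp)
qed

lemma core_bounds:
  assumes c: "core m \<delta> D deg key q" and x: "x < n"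
  shows "deg x \<le> b * n" "length (q x) < n" "length (q (x + n)) < n"
    "int (length (q x)) \<le> int (deg x) + \<delta> x" "int (length (q (x + n))) \<le> int (deg x) + \<delta> x"
proof -
  let ?S = "{y. y < n \<and> 0 < D x y}"
  have S: "?S \<subseteq> {..<n} - {x}" using core_arc(1)[OF c x x] by auto
  have l: "length (q x) = card ?S" "length (q (x + n)) = card ?S"
    using coreD(6-9)[OF c x] distinct_card by metis+
  have "card ?S \<le> card ({..<n} - {x})" using S by (intro card_mono) auto
  then show "length (q x) < n" "length (q (x + n)) < n" using x l by auto
  \<comment> \<open>Each entry of the queue stands for at least one copy.\<close>
  have "card ?S \<le> (\<Sum>y\<in>?S. D x y)" using sum_mono[of ?S "\<lambda>_. 1" "D x"] by simp
  also have "\<dots> \<le> outdeg n D x" unfolding outdeg_def by (intro sum_mono2) auto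
  finally show "int (length (q x)) \<le> int (deg x) + \<delta> x" "int (length (q (x + n))) \<le> int (deg x) + \<delta> x"
    using l coreD(4)[OF c x] by linarith+
  have "outdeg n D x = (\<Sum>y\<in>{..<n} - {x}. D x y)"
    unfolding outdeg_def using core_arc(1)[OF c x x] x by (subst sum.remove[of _ x]) auto
  also have "\<dots> \<le> (\<Sum>y\<in>{..<n} - {x}. b)" using core_arc(3)[OF c x] by (intro sum_mono) auto
  also have "\<dots> = b * (n - 1)" using x by simp
  \<comment> \<open>Only \<open>n - 1\<close> heads are possible. This leaves a slack of
    \<open>b\<close>, which covers a recorded degree that is one above the true one.\<close>
  finally have "outdeg n D x + b \<le> b * n" using n by (cases n) auto
  then show "deg x \<le> b * n" using coreD(3,4)[OF c x] b by auto
qed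

lemma tol_less:
  assumes "d \<le> b * n"
  shows "tol d + 2 < keys" "d + 1 < keys"
proof -
  have "4 * d div b \<le> 4 * (b * n) div b" using assms by (intro div_le_mono) auto
  also have "\<dots> = 4 * n" using b by simp
  also have "\<dots> \<le> b * n" using b by simp
  finally show "tol d + 2 < keys" using assms unfolding tol_def keys_def mult.assoc by linarith
  then show "d + 1 < keys" by (simp add: tol_def)
qed

lemma key_less: "core m \<delta> D deg key q \<Longrightarrow> x < n \<Longrightarrow> y < n \<Longrightarrow> 0 < D x y \<Longrightarrow> key x y < keys"
  using coreD(5) core_bounds(1) tol_less(1) by (meson add_lessD1 le_less_trans)

lemma orientation_upd:
  assumes "is_orientation n m D" "x < n" "y < n" "x \<noteq> y" "v + D y x = k"
  shows "is_orientation n (m({x, y} := k)) (upd D x y v)"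
  unfolding is_orientation_def
proof (intro conjI allI impI)
  fix u v' assume uv: "u < n" "v' < n" "u \<noteq> v'"
  have D: "D u v' + D v' u = m {u, v'}" using assms(1) uv by (auto simp: is_orientation_def)
  consider "u = x \<and> v' = y" | "u = y \<and> v' = x" | "{u, v'} \<noteq> {x, y}" by (auto simp: doubleton_eq_iff)
  then show "upd D x y v u v' + upd D x y v v' u = (m({x, y} := k)) {u, v'}"
    using D assms(4,5) by cases (auto simp: upd_apply doubleton_eq_iff insert_commute)
qed (use assms in \<open>auto simp: is_orientation_def upd_apply\<close>)

section \<open>Adding and removing one copy\<close>

text \<open>The new copy is not recorded in \<open>deg\<close> but in \<open>\<delta>\<close>, so
  all old bounds stay literally the same. A new entry gets the recorded degree as its key, which the
  hypothesis places below the threshold.\<close>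

lemma inv_add_arc:
  assumes i: "invar m \<delta> D deg key q" and xy: "x < n" "y < n" "x \<noteq> y"
    and m: "m {x, y} < b" and d: "deg x \<le> tol (deg y)" and \<delta>: "\<delta> x \<le> 0"
  shows "invar (m({x, y} := m {x, y} + 1)) (\<delta>(x := \<delta> x + 1)) (upd D x y (D x y + 1)) deg
      (if D x y = 0 then upd key x y (deg x) else key)
      (if D x y = 0 then q(x := q x @ [y], x + n := q (x + n) @ [y]) else q)"
    (is "invar ?m ?\<delta> ?D deg ?key ?q")
proof -
  note c = invarD(1)[OF i] and ud = invarD(2,3)[OF i]
  note cD = coreD[OF c]
  have D: "0 < ?D x' y' \<longleftrightarrow> x' = x \<and> y' = y \<or> 0 < D x' y'" for x' y' by (auto simp: upd_apply)
  have "core ?m ?\<delta> ?D deg ?key ?q"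
    unfolding core_def
  proof (intro conjI allI impI)
    show "is_orientation n ?m ?D"
      using core_arc(2)[OF c xy(1,2)] xy cD(1) by (intro orientation_upd) auto
    show "?m e \<le> b" for e using cD(2) m by auto
    fix x' assume x': "x' < n"
    show "?\<delta> x' \<in> {-1..1}" using cD(3)[OF x'] \<delta> by auto
    show "int (outdeg n ?D x') = int (deg x') + ?\<delta> x'"
      using outdeg_upd[OF xy(1,2), of D "D x y + 1" x'] cD(4)[OF x'] by (auto split: if_splits)
    show "?key x' y' \<le> tol (deg y')" if "y' < n" "0 < ?D x' y'" for y'
      using that x' cD(5) d unfolding D by (auto simp: upd_apply)
    have ne: "x' \<noteq> x + n" "x' + n \<noteq> x" "x' + n = x + n \<longleftrightarrow> x' = x" using x' xy by auto
    have "distinct (?q x') \<and> distinct (?q (x' + n)) \<and>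
      set (?q x') = {y. y < n \<and> 0 < ?D x' y} \<and> set (?q (x' + n)) = {y. y < n \<and> 0 < ?D x' y}"
    proof (cases "D x y = 0 \<and> x' = x")
      case True
      have q: "?q x = q x @ [y]" "?q (x + n) = q (x + n) @ [y]" using True xy by auto
      have "{y'. y' < n \<and> 0 < ?D x y'} = insert y {y'. y' < n \<and> 0 < D x y'}"
        using xy unfolding D by auto
      then show ?thesis using True cD(6-9)[OF xy(1)] unfolding conjunct2[OF True] q by simp
    next
      case False
      have q: "?q x' = q x'" "?q (x' + n) = q (x' + n)" using False ne by auto
      have "{y'. y' < n \<and> 0 < ?D x' y'} = {y'. y' < n \<and> 0 < D x' y'}"
        using False unfolding D by auto
      then show ?thesis using cD(6-9)[OF x'] unfolding q by simp
    qed
    then show "distinct (?q x')" "distinct (?q (x' + n))" "set (?q x') = {y. y < n \<and> 0 < ?D x' y}"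
      "set (?q (x' + n)) = {y. y < n \<and> 0 < ?D x' y}" by blast+
  qed
  moreover have "up deg ?key ?q x'" "down deg ?key ?q x'" if x': "x' < n" for x'
  proof -
    have "up deg ?key ?q x' \<and> down deg ?key ?q x'"
    proof (cases "D x y = 0 \<and> x' = x")
      case False
      then have "?q x' = q x'" "?q (x' + n) = q (x' + n)" "?key x' = key x'"
        using xy x' by (auto simp: upd_def)
      then show ?thesis using ud[OF x'] unfolding up_def down_def by simp
    next
      case True
      have q: "?q x = q x @ [y]" "?q (x + n) = q (x + n) @ [y]" using True xy by auto
      \<comment> \<open>The new entry comes at position \<open>length (q x) \<le> deg x\<close>,
        which its key pays for.\<close>
      have l: "length (q x) \<le> deg x" "length (q (x + n)) \<le> deg x"
        using core_bounds(4,5)[OF c xy(1)] \<delta> by linarith+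
      have s: "?key x y = deg x" "y' \<noteq> y \<Longrightarrow> ?key x y' = key x y'" for y'
        using True by (auto simp: upd_apply)
      have "y \<notin> set (q x)" "y \<notin> set (q (x + n))"
        unfolding cD(8)[OF xy(1)] cD(9)[OF xy(1)] using conjunct1[OF True] by simp_all
      then have ne: "i < length (q x) \<Longrightarrow> q x ! i \<noteq> y"
        and ne': "i < length (q (x + n)) \<Longrightarrow> q (x + n) ! i \<noteq> y" for i
        by (metis nth_mem)+
      have "up deg ?key ?q x" unfolding up_def q
      proof (intro allI impI)
        fix i assume "i < length (q x @ [y])"
        then consider "i < length (q x)" | "i = length (q x)" by fastforce
        then show "i + b * deg x \<le> b * ?key x ((q x @ [y]) ! i) + ?key x ((q x @ [y]) ! i) + b"
        proof cases
          case 1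
          then show ?thesis using ud(1)[OF xy(1)] ne[OF 1] s(2) by (simp add: up_def nth_append)
        next
          case 2
          then show ?thesis using l s(1) by simp
        qed
      qed
      moreover have "down deg ?key ?q x" unfolding down_def q
      proof (intro allI impI)
        fix i assume "i < length (q (x + n) @ [y])"
        then consider "i < length (q (x + n))" | "i = length (q (x + n))" by fastforce
        then show "i + b * ?key x ((q (x + n) @ [y]) ! i)
          \<le> b * deg x + ?key x ((q (x + n) @ [y]) ! i) + b"
        proof cases
          case 1
          then show ?thesis using ud(2)[OF xy(1)] ne'[OF 1] s(2) by (simp add: down_def nth_append)
        next
          case 2
          then show ?thesis using l s(1) by simp
        qed
      qed
      ultimately show ?thesis using True by simp
    qed
    then show "up deg ?key ?q x'" "down deg ?key ?q x'" by auto
  qed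
  ultimately show ?thesis unfolding invar_def by blast
qed

lemma inv_remove_arc:
  assumes i: "invar m \<delta> D deg key q" and xy: "x < n" "y < n" and D0: "0 < D x y" and \<delta>: "0 \<le> \<delta> x"
  shows "invar (m({x, y} := m {x, y} - 1)) (\<delta>(x := \<delta> x - 1)) (upd D x y (D x y - 1)) deg key
      (if D x y = 1 then q(x := swap_remove y (q x), x + n := swap_remove y (q (x + n))) else q)"
    (is "invar ?m ?\<delta> ?D deg key ?q")
proof -
  note c = invarD(1)[OF i] and ud = invarD(2,3)[OF i]
  note cD = coreD[OF c]
  have ne: "x \<noteq> y" using core_arc(4)[OF c xy D0] .
  have D: "0 < ?D x' y' \<longleftrightarrow> 0 < D x' y' \<and> \<not> (D x y = 1 \<and> x' = x \<and> y' = y)" for x' y'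
    using D0 by (auto simp: upd_apply)
  have y: "y \<in> set (q x)" "y \<in> set (q (x + n))" using cD(8,9)[OF xy(1)] xy(2) D0 by auto
  have dx: "distinct (q x)" "distinct (q (x + n))" using cD(6,7)[OF xy(1)] by auto
  note sr = distinct_swap_remove[OF dx(1) y(1)] distinct_swap_remove[OF dx(2) y(2)]
  have "core ?m ?\<delta> ?D deg key ?q"
    unfolding core_def
  proof (intro conjI allI impI)
    show "is_orientation n ?m ?D"
      using core_arc(2)[OF c xy ne] xy cD(1) ne D0 by (intro orientation_upd) auto
    show "?m e \<le> b" for e using cD(2)[of e] by auto
    fix x' assume x': "x' < n"
    show "?\<delta> x' \<in> {-1..1}" using cD(3)[OF x'] \<delta> by auto
    show "int (outdeg n ?D x') = int (deg x') + ?\<delta> x'"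
      using outdeg_upd[OF xy, of D "D x y - 1" x'] cD(4)[OF x'] D0 by (auto split: if_splits)
    show "key x' y' \<le> tol (deg y')" if "y' < n" "0 < ?D x' y'" for y'
      using that x' cD(5) unfolding D by auto
    have ne: "x' \<noteq> x + n" "x' + n \<noteq> x" "x' + n = x + n \<longleftrightarrow> x' = x" using x' xy by auto
    have "distinct (?q x') \<and> distinct (?q (x' + n)) \<and>
      set (?q x') = {y. y < n \<and> 0 < ?D x' y} \<and> set (?q (x' + n)) = {y. y < n \<and> 0 < ?D x' y}"
    proof (cases "D x y = 1 \<and> x' = x")
      case True
      have q: "?q x = swap_remove y (q x)" "?q (x + n) = swap_remove y (q (x + n))" using True xy by auto
      have "{y'. y' < n \<and> 0 < ?D x y'} = {y'. y' < n \<and> 0 < D x y'} - {y}"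
        using True unfolding D by auto
      then show ?thesis using True cD(6-9)[OF xy(1)] sr unfolding conjunct2[OF True] q by simp
    next
      case False
      have q: "?q x' = q x'" "?q (x' + n) = q (x' + n)" using False ne by auto
      have "{y'. y' < n \<and> 0 < ?D x' y'} = {y'. y' < n \<and> 0 < D x' y'}"
        using False unfolding D by auto
      then show ?thesis using cD(6-9)[OF x'] unfolding q by simp
    qed
    then show "distinct (?q x')" "distinct (?q (x' + n))" "set (?q x') = {y. y < n \<and> 0 < ?D x' y}"
      "set (?q (x' + n)) = {y. y < n \<and> 0 < ?D x' y}" by blast+
  qed
  moreover have "up deg key ?q x' \<and> down deg key ?q x'" if x': "x' < n" for x'
  proof (cases "D x y = 1 \<and> x' = x")
    case False
    then have "?q x' = q x'" "?q (x' + n) = q (x' + n)" using xy x' by auto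
    then show ?thesis using ud[OF x'] unfolding up_def down_def by simp
  next
    case True
    have q: "?q x = swap_remove y (q x)" "?q (x + n) = swap_remove y (q (x + n))" using True xy by auto
    have "up deg key ?q x" unfolding up_def q
    proof (intro allI impI)
      fix i assume "i < length (swap_remove y (q x))"
      from swap_remove_nth[OF dx(1) y(1) this] obtain j where
        j: "i \<le> j" "j < length (q x)" "swap_remove y (q x) ! i = q x ! j" by blast
      then show "i + b * deg x \<le> b * key x (swap_remove y (q x) ! i) + key x (swap_remove y (q x) ! i) + b"
        using ud(1)[OF xy(1), unfolded up_def, rule_format, OF j(2)] by simp
    qed
    moreover have "down deg key ?q x" unfolding down_def q
    proof (intro allI impI)
      fix i assume "i < length (swap_remove y (q (x + n)))"
      from swap_remove_nth[OF dx(2) y(2) this] obtain j where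
        j: "i \<le> j" "j < length (q (x + n))" "swap_remove y (q (x + n)) ! i = q (x + n) ! j" by blast
      then show "i + b * key x (swap_remove y (q (x + n)) ! i)
          \<le> b * deg x + key x (swap_remove y (q (x + n)) ! i) + b"
        using ud(2)[OF xy(1), unfolded down_def, rule_format, OF j(2)] by simp
    qed
    ultimately show ?thesis using True by simp
  qed
  ultimately show ?thesis unfolding invar_def by blast
qed

end

lemma nth_rotate1_hd:
  assumes "i < length q"
  shows "rotate1 q ! i = (if Suc i = length q then hd q else q ! Suc i)"
proof (cases q)
  case (Cons a r)
  then show ?thesis using assms by (auto simp: nth_append)
qed (use assms in simp)

section \<open>Refreshing keys in round-robin order\<close>

context ram
begin

text \<open>
  \<open>c\<close> entries have been refreshed, and now are at the back of the queue, for a pending increment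
  (\<open>up_scan\<close>) or a decrement already recorded in \<open>deg\<close> (\<open>down_scan\<close>).
\<close>

definition up_scan :: "nat \<Rightarrow> (nat \<Rightarrow> nat) \<Rightarrow> (nat \<Rightarrow> nat \<Rightarrow> nat) \<Rightarrow> (nat \<Rightarrow> nat list) \<Rightarrow> nat \<Rightarrow> bool" where
  "up_scan c deg key q x \<longleftrightarrow> (\<forall>i<length (q x).
     if i + c < length (q x) then i + c + b * deg x \<le> b * key x (q x ! i) + key x (q x ! i) + b
     else key x (q x ! i) = deg x + 1)"

definition down_scan :: "nat \<Rightarrow> (nat \<Rightarrow> nat) \<Rightarrow> (nat \<Rightarrow> nat \<Rightarrow> nat) \<Rightarrow> (nat \<Rightarrow> nat list) \<Rightarrow> nat \<Rightarrow> bool" where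
  "down_scan c deg key q x \<longleftrightarrow> (\<forall>i<length (q (x + n)).
     if i + c < length (q (x + n))
     then i + c + b * key x (q (x + n) ! i) \<le> b * (deg x + 1) + key x (q (x + n) ! i) + b
     else key x (q (x + n) ! i) \<le> deg x)"

lemma up_scan_0: "invar m \<delta> D deg key q \<Longrightarrow> x < n \<Longrightarrow> up_scan 0 deg key q x"
  by (simp add: invar_def up_def up_scan_def)

lemma core_rotate:
  assumes c: "core m \<delta> D deg key q" and x: "x < n" and y: "y < n"
    and key: "0 < D x y \<Longrightarrow> key' x y \<le> tol (deg y)"
    and key': "\<And>x' y'. (x', y') \<noteq> (x, y) \<Longrightarrow> key' x' y' = key x' y'"
  shows "core m \<delta> D deg key' (q(z := rotate1 (q z)))"
proof -
  have rot: "distinct ((q(z := rotate1 (q z))) z') = distinct (q z')"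
    "set ((q(z := rotate1 (q z))) z') = set (q z')" for z' by simp_all
  show ?thesis
    unfolding core_def rot
  proof (intro conjI allI impI)
    fix x' y' assume xy: "x' < n" "y' < n" "0 < D x' y'"
    show "key' x' y' \<le> tol (deg y')"
      using coreD(5)[OF c xy] key xy key'[of x' y'] by (cases "(x', y') = (x, y)") auto
  qed (use coreD[OF c] in simp_all)
qed

text \<open>Rotation lowers the other positions by one while \<open>c\<close> grows by one, so
  \<open>i + c\<close> is unchanged. \<open>invar\<close> is kept as well, because a reversal may
  abandon the scan at any moment.\<close>

lemma up_scan_step:
  assumes i: "invar m \<delta> D deg key q" and x: "x < n" and \<delta>: "\<delta> x = 1" and s: "up_scan c deg key q x"
    and ne: "q x \<noteq> []" and y: "y = hd (q x)" and tol: "deg x + 1 \<le> tol (deg y)"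
  defines "key' \<equiv> upd key x y (deg x + 1)" and "q' \<equiv> q(x := rotate1 (q x))"
  shows "invar m \<delta> D deg key' q'" "up_scan (c + 1) deg key' q' x"
proof -
  note c = invarD(1)[OF i] and ud = invarD(2,3)[OF i]
  have "y \<in> set (q x)" using ne y by simp
  then have yn: "y < n" using coreD(8)[OF c x] by simp
  have l: "length (q x) \<le> deg x + 1" "length (q (x + n)) \<le> deg x + 1"
    using core_bounds(4,5)[OF c x] \<delta> by linarith+
  have key'_x: "key' x y' = (if y' = y then deg x + 1 else key x y')" for y'
    by (simp add: key'_def upd_apply)
  show scan: "up_scan (c + 1) deg key' q' x"
    unfolding up_scan_def
  proof (intro allI impI)
    fix i assume "i < length (q' x)"
    then have i: "i < length (q x)" by (simp add: q'_def)
    show "if i + (c + 1) < length (q' x)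
      then i + (c + 1) + b * deg x \<le> b * key' x (q' x ! i) + key' x (q' x ! i) + b
      else key' x (q' x ! i) = deg x + 1"
    proof (cases "Suc i = length (q x)")
      case True
      then show ?thesis using i y by (simp add: q'_def nth_rotate1_hd key'_x)
    next
      case False
      then have i': "Suc i < length (q x)" using i by simp
      have "q x ! Suc i \<noteq> q x ! 0" using i' coreD(6)[OF c x] ne by (subst nth_eq_iff_index_eq) auto
      then have "q x ! Suc i \<noteq> y" using y ne by (simp add: hd_conv_nth)
      then show ?thesis using s[unfolded up_scan_def, rule_format, OF i'] i i'
        by (auto simp: q'_def nth_rotate1_hd key'_x)
    qed
  qed
  have "core m \<delta> D deg key' q'"
    unfolding q'_def using tol by (intro core_rotate[OF c x yn]) (auto simp: key'_def upd_apply)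
  moreover have "up deg key' q' x' \<and> down deg key' q' x'" if x': "x' < n" for x'
  proof (cases "x' = x")
    case False
    then have "q' x' = q x'" "q' (x' + n) = q (x' + n)" "key' x' = key x'"
      using x by (auto simp: q'_def key'_def upd_def)
    then show ?thesis using ud[OF x'] unfolding up_def down_def by simp
  next
    case True
    have "up deg key' q' x" unfolding up_def
    proof (intro allI impI)
      fix i assume i: "i < length (q' x)"
      then have "i \<le> deg x" using l by (simp add: q'_def)
      then show "i + b * deg x \<le> b * key' x (q' x ! i) + key' x (q' x ! i) + b"
        using scan[unfolded up_scan_def, rule_format, OF i] by (auto split: if_splits)
    qed
    moreover have "down deg key' q' x" unfolding down_def
    proof (intro allI impI)
      fix i assume "i < length (q' (x + n))"
      then have i: "i < length (q (x + n))" and q: "q' (x + n) = q (x + n)"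
        using x n by (auto simp: q'_def)
      \<comment> \<open>The refreshed key is one above the recorded degree; this costs
        \<open>b\<close> on the left, which the summand \<open>b\<close> on the right pays
        for.\<close>
      then have "i \<le> deg x" using l by simp
      then show "i + b * key' x (q' (x + n) ! i) \<le> b * deg x + key' x (q' (x + n) ! i) + b"
        using ud(2)[OF x, unfolded down_def, rule_format, OF i] by (simp add: q key'_x)
    qed
    ultimately show ?thesis using True by simp
  qed
  ultimately show "invar m \<delta> D deg key' q'" unfolding invar_def by blast
qed

text \<open>The \<open>b\<close> rotations have gained exactly the \<open>b\<close> that raising
  \<open>deg x\<close> by one costs. Arcs into \<open>x\<close> only profit, since
  \<open>tol\<close> is monotone.\<close>

lemma up_scan_finish:
  assumes i: "invar m \<delta> D deg key q" and x: "x < n" and \<delta>: "\<delta> x = 1" and s: "up_scan b deg key q x"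
  shows "invar m (\<delta>(x := 0)) D (deg(x := deg x + 1)) key q"
proof -
  note c = invarD(1)[OF i] and ud = invarD(2,3)[OF i]
  let ?deg = "deg(x := deg x + 1)"
  have l: "length (q x) \<le> deg x + 1" using core_bounds(4)[OF c x] \<delta> by linarith
  have "core m (\<delta>(x := 0)) D ?deg key q"
    unfolding core_def
  proof (intro conjI allI impI)
    fix x' y' assume xy: "x' < n" "y' < n" "0 < D x' y'"
    show "key x' y' \<le> tol (?deg y')"
      using coreD(5)[OF c xy] tol_mono[of "deg x" "deg x + 1"] by auto
  next
    fix x' assume "x' < n"
    then show "int (outdeg n D x') = int (?deg x') + (\<delta>(x := 0)) x'"
      using coreD(4)[OF c] \<delta> by auto
  qed (use coreD[OF c] in simp_all)
  moreover have "up ?deg key q x' \<and> down ?deg key q x'" if x': "x' < n" for x'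
  proof (cases "x' = x")
    case False
    then show ?thesis using ud[OF x'] unfolding up_def down_def by simp
  next
    case True
    have "up ?deg key q x" unfolding up_def
    proof (intro allI impI)
      fix i assume i: "i < length (q x)"
      then have "i \<le> deg x" using l by simp
      then show "i + b * ?deg x \<le> b * key x (q x ! i) + key x (q x ! i) + b"
        using s[unfolded up_scan_def, rule_format, OF i] by (auto split: if_splits)
    qed
    moreover have "down ?deg key q x"
      using ud(2)[OF x] unfolding down_def by (auto intro: order_trans)
    ultimately show ?thesis using True by simp
  qed
  ultimately show ?thesis unfolding invar_def by blast
qed

text \<open>A decrement is recorded before its scan, so until the end of the scan the bound
  \<open>down\<close> may fail at \<open>x\<close>, and only there.\<close>

definition down_inv :: "(nat set \<Rightarrow> nat) \<Rightarrow> nat \<Rightarrow> nat \<Rightarrow> (nat \<Rightarrow> nat \<Rightarrow> nat) \<Rightarrow> (nat \<Rightarrow> nat) \<Rightarrow>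
    (nat \<Rightarrow> nat \<Rightarrow> nat) \<Rightarrow> (nat \<Rightarrow> nat list) \<Rightarrow> bool" where
  "down_inv m x c D deg key q \<longleftrightarrow> core m (\<lambda>_. 0) D deg key q \<and> (\<forall>x<n. up deg key q x) \<and>
     (\<forall>x'<n. x' \<noteq> x \<longrightarrow> down deg key q x') \<and> down_scan c deg key q x"

text \<open>Keys into \<open>x\<close> were at most
  \<open>tol (deg x) \<le> tol (deg x - 1) + 2\<close>. If the two topmost values do not occur, the
  lowered threshold is respected.\<close>

lemma down_scan_start:
  assumes i: "invar m \<delta> D deg key q" and x: "x < n" and \<delta>: "\<delta> = (\<lambda>_. 0)(x := -1)"
    and none: "\<And>w. w < n \<Longrightarrow> 0 < D w x \<Longrightarrow> key w x \<noteq> tol (deg x - 1) + 1 \<and> key w x \<noteq> tol (deg x - 1) + 2"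
  shows "down_inv m x 0 D (deg(x := deg x - 1)) key q"
proof -
  note c = invarD(1)[OF i] and ud = invarD(2,3)[OF i]
  let ?deg = "deg(x := deg x - 1)"
  have d: "1 \<le> deg x" using coreD(4)[OF c x] \<delta> by simp
  have "core m (\<lambda>_. 0) D ?deg key q"
    unfolding core_def
  proof (intro conjI allI impI)
    fix x' y' assume xy: "x' < n" "y' < n" "0 < D x' y'"
    have "tol (deg x) \<le> tol (deg x - 1) + 2" using tol_Suc[of "deg x - 1"] d by simp
    then show "key x' y' \<le> tol (?deg y')"
      using coreD(5)[OF c xy] none[of x'] xy by (cases "y' = x") force+
  next
    fix x' assume "x' < n"
    then show "int (outdeg n D x') = int (?deg x') + 0"
      using coreD(4)[OF c, of x'] \<delta> d by (cases "x' = x") auto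
  qed (use coreD[OF c] in simp_all)
  moreover have "up ?deg key q x'" if x': "x' < n" for x'
    unfolding up_def
  proof (intro allI impI)
    fix i assume i: "i < length (q x')"
    have "b * ?deg x' \<le> b * deg x'" by (intro mult_le_mono2) auto
    then show "i + b * ?deg x' \<le> b * key x' (q x' ! i) + key x' (q x' ! i) + b"
      using ud(1)[OF x', unfolded up_def, rule_format, OF i] by linarith
  qed
  moreover have "down ?deg key q x'" if "x' < n" "x' \<noteq> x" for x'
    using ud(2)[OF that(1)] that unfolding down_def by simp
  moreover have "down_scan 0 ?deg key q x"
    using ud(2)[OF x] d unfolding down_def down_scan_def by simp
  ultimately show ?thesis unfolding down_inv_def by blast
qed

text \<open>The last copy out of \<open>x\<close> may be gone, while the loop still counts down its
  \<open>b\<close> refreshes.\<close>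

lemma down_scan_empty: "down_inv m x c D deg key q \<Longrightarrow> q (x + n) = [] \<Longrightarrow> down_inv m x (c + 1) D deg key q"
  by (simp add: down_inv_def down_scan_def)

text \<open>Keys are only lowered, never raised: raising one could exceed the threshold, and a
  decrement cannot repair that. So a scanned key is at most \<open>deg x\<close>, but not
  necessarily equal to it.\<close>

lemma down_scan_step:
  assumes i: "down_inv m x c D deg key q" and x: "x < n"
    and ne: "q (x + n) \<noteq> []" and y: "y = hd (q (x + n))"
  defines "key' \<equiv> (if deg x < key x y then upd key x y (deg x) else key)"
    and "q' \<equiv> q(x + n := rotate1 (q (x + n)))"
  shows "down_inv m x (c + 1) D deg key' q'"
proof -
  have c: "core m (\<lambda>_. 0) D deg key q" and u: "\<And>x. x < n \<Longrightarrow> up deg key q x"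
    and d: "\<And>x'. x' < n \<Longrightarrow> x' \<noteq> x \<Longrightarrow> down deg key q x'" and s: "down_scan c deg key q x"
    using i by (auto simp: down_inv_def)
  have "y \<in> set (q (x + n))" using ne y by simp
  then have yn: "y < n" using coreD(9)[OF c x] by simp
  have l: "length (q x) \<le> deg x" using core_bounds(4)[OF c x] by linarith
  have key'_x: "key' x y' = (if y' = y \<and> deg x < key x y then deg x else key x y')" for y'
    by (simp add: key'_def upd_apply)
  have "down_scan (c + 1) deg key' q' x"
    unfolding down_scan_def
  proof (intro allI impI)
    fix i assume "i < length (q' (x + n))"
    then have i: "i < length (q (x + n))" by (simp add: q'_def)
    show "if i + (c + 1) < length (q' (x + n))
      then i + (c + 1) + b * key' x (q' (x + n) ! i) \<le> b * (deg x + 1) + key' x (q' (x + n) ! i) + b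
      else key' x (q' (x + n) ! i) \<le> deg x"
    proof (cases "Suc i = length (q (x + n))")
      case True
      then show ?thesis using i y by (simp add: q'_def nth_rotate1_hd key'_x)
    next
      case False
      then have i': "Suc i < length (q (x + n))" using i by simp
      have "q (x + n) ! Suc i \<noteq> q (x + n) ! 0"
        using i' coreD(7)[OF c x] ne by (subst nth_eq_iff_index_eq) auto
      then have "q (x + n) ! Suc i \<noteq> y" using y ne by (simp add: hd_conv_nth)
      then show ?thesis using s[unfolded down_scan_def, rule_format, OF i'] i i'
        by (auto simp: q'_def nth_rotate1_hd key'_x)
    qed
  qed
  moreover have "core m (\<lambda>_. 0) D deg key' q'"
    unfolding q'_def
  proof (rule core_rotate[OF c x yn])
    show "key' x y \<le> tol (deg y)" if "0 < D x y"
      using coreD(5)[OF c x yn that] by (simp add: key'_x)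
  qed (auto simp: key'_def upd_apply)
  moreover have "up deg key' q' x'" if x': "x' < n" for x'
  proof -
    have q: "q' x' = q x'" using x' x n by (simp add: q'_def)
    show ?thesis
    proof (cases "x' = x")
      case False
      then have "key' x' = key x'" by (auto simp: key'_def upd_def)
      then show ?thesis using u[OF x'] q by (simp add: up_def)
    next
      case True
      show ?thesis unfolding up_def True
      proof (intro allI impI)
        fix i assume "i < length (q' x)"
        then have i: "i < length (q x)" using q True by simp
        then show "i + b * deg x \<le> b * key' x (q' x ! i) + key' x (q' x ! i) + b"
          using u[OF x, unfolded up_def, rule_format, OF i] l q True by (simp add: key'_x)
      qed
    qed
  qed
  moreover have "down deg key' q' x'" if x': "x' < n" "x' \<noteq> x" for x'
  proof -
    have "q' (x' + n) = q (x' + n)" "key' x' = key x'"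
      using x' by (auto simp: q'_def key'_def upd_def)
    then show ?thesis using d[OF x'] by (simp add: down_def)
  qed
  ultimately show ?thesis unfolding down_inv_def by blast
qed

lemma down_scan_finish:
  assumes i: "down_inv m x b D deg key q" and x: "x < n"
  shows "invar m (\<lambda>_. 0) D deg key q"
proof -
  have c: "core m (\<lambda>_. 0) D deg key q" and s: "down_scan b deg key q x"
    using i by (auto simp: down_inv_def)
  have l: "length (q (x + n)) \<le> deg x" using core_bounds(5)[OF c x] by linarith
  have "down deg key q x" unfolding down_def
  proof (intro allI impI)
    fix i assume i: "i < length (q (x + n))"
    let ?s = "key x (q (x + n) ! i)"
    show "i + b * ?s \<le> b * deg x + ?s + b"
    proof (cases "i + b < length (q (x + n))")
      case True
      then show ?thesis using s[unfolded down_scan_def, rule_format, OF i] by simp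
    next
      case False
      then obtain e where e: "deg x = ?s + e"
        using s[unfolded down_scan_def, rule_format, OF i] le_Suc_ex by auto
      \<comment> \<open>A scanned key may lie far below \<open>deg x\<close>. Then
        \<open>i \<le> deg x = ?s + e\<close>, and the distance \<open>e\<close> is covered by
        \<open>b * e\<close>.\<close>
      have "e \<le> b * e" using b by simp
      moreover have "b * deg x = b * ?s + b * e" by (simp add: e distrib_left)
      ultimately show ?thesis using i l e by linarith
    qed
  qed
  then show ?thesis using i unfolding down_inv_def invar_def by metis
qed

section \<open>The length of a chain\<close>

text \<open>The potential that changes by at least one in each step of a chain.\<close>

definition phi :: "nat \<Rightarrow> real" where
  "phi d = b * ln (1 + 2 * real d / b)"

lemma phi_nonneg: "0 \<le> phi d"
  unfolding phi_def by simp

lemma phi_mono: "d \<le> d' \<Longrightarrow> phi d \<le> phi d'"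
  unfolding phi_def using b by (intro mult_left_mono) (auto simp: divide_right_mono add_pos_nonneg)

text \<open>The hypothesis says that \<open>1 + 2 * d / b\<close> grows at least by the factor
  \<open>1 + 2 / b\<close>, whose logarithm is at least \<open>1 / b\<close>. The inner
  \<open>1 +\<close> of \<open>phi\<close> is what lets a constant gap suffice while
  \<open>d\<close> is small.\<close>

lemma phi_step:
  assumes "real d + 1 + 2 * real d / b \<le> real d'"
  shows "phi d + 1 \<le> phi d'"
proof -
  have b0: "0 < real b" using b by simp
  have "exp (1 / b) \<le> 1 + 1 / b + (1 / b)\<^sup>2" using b by (intro exp_bound) auto
  also have "(1 / real b)\<^sup>2 \<le> 1 / b" using b by (simp add: power2_eq_square field_simps)
  finally have "exp (1 / b) \<le> 1 + 2 / b" by simp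
  then have "1 / b \<le> ln (1 + 2 / b)" using b0 by (subst ln_ge_iff) (auto simp: add_pos_pos)
  then have 1: "1 \<le> b * ln (1 + 2 / b)" using b0 by (simp add: field_simps)
  have "(1 + 2 * real d / b) * (1 + 2 / b) = 1 + 2 / b * (real d + 1 + 2 * real d / b)"
    using b0 by (simp add: field_simps)
  also have "\<dots> \<le> 1 + 2 / b * d'" using b0 assms by (intro add_left_mono mult_left_mono) auto
  finally have 2: "(1 + 2 * real d / b) * (1 + 2 / b) \<le> 1 + 2 * real d' / b" by simp
  have pos: "0 < 1 + 2 * real d / b" "0 < 1 + 2 / real b" using b0 by (auto intro: add_pos_nonneg)
  have "ln (1 + 2 * real d / b) + ln (1 + 2 / b) = ln ((1 + 2 * real d / b) * (1 + 2 / b))"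
    using pos by (simp add: ln_mult)
  also have "\<dots> \<le> ln (1 + 2 * real d' / b)" using 2 pos by (intro ln_mono) auto
  finally have "b * (ln (1 + 2 * real d / b) + ln (1 + 2 / b)) \<le> b * ln (1 + 2 * real d' / b)"
    using b0 by (intro mult_left_mono) auto
  then show ?thesis using 1 unfolding phi_def by (simp add: distrib_left)
qed

text \<open>One of the 8 units of \<open>tol\<close> pays for the rounding in the division.\<close>

lemma real_tol_ge: "real d + 7 + 4 * real d / b \<le> real (tol d)"
proof -
  have "4 * d < b * (4 * d div b) + b"
    using b mod_less_divisor[of b "4 * d"] div_mult_mod_eq[of "4 * d" b] by (metis add_strict_left_mono
        less_le_trans mult.commute not_gr_zero not_numeral_le_zero order_refl)
  then have "real (4 * d) < real (b * (4 * d div b) + b)" using of_nat_less_iff by blast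
  then have "4 * real d / b < real (4 * d div b) + 1" using b by (simp add: field_simps)
  then show ?thesis unfolding tol_def by simp
qed

text \<open>Along a chain of increments the recorded degrees fall. The test uses them directly, so
  no error of keys enters.\<close>

lemma phi_up_step:
  assumes "\<not> dx + 1 \<le> tol dy"
  shows "phi dy + 1 \<le> phi dx" "dy \<le> dx"
proof -
  have "real (tol dy) \<le> real dx" using assms by simp
  moreover have "2 * real dy / b \<le> 4 * real dy / b" by (simp add: divide_right_mono)
  ultimately have "real dy + 1 + 2 * real dy / b \<le> real dx" using real_tol_ge[of dy] by linarith
  then show "phi dy + 1 \<le> phi dx" by (rule phi_step)
  show "dy \<le> dx" using assms le_tol[of dy] by simp
qed

text \<open>Along a chain of decrements the degrees rise, but the in-neighbour is known only through
  its key \<open>s\<close>. The error of the key costs a factor \<open>1 - 1 / b\<close> and one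
  unit; slope 4 and constant 8 of \<open>tol\<close> leave the gap \<open>1 + 2 * dx / b\<close>
  after that.\<close>

lemma phi_down_step:
  assumes "tol (dx - 1) < s" "b * s \<le> b * dw + s + b" "1 \<le> dx"
  shows "phi dx + 1 \<le> phi dw" "dx \<le> dw"
proof -
  define r where "r = 1 / real b"
  define d where "d = real (dx - 1)"
  have r: "0 < r" "r \<le> 1 / 100" using b by (auto simp: r_def field_simps)
  have d: "0 \<le> d" "real dx = d + 1" using assms(3) by (auto simp: d_def)
  have "real (b * s) \<le> real (b * dw + s + b)" using assms(2) of_nat_le_iff by blast
  then have 1: "s - s * r \<le> real dw + 1" using b by (simp add: r_def field_simps)
  have 2: "d + 8 + 4 * (d * r) \<le> s" using real_tol_ge[of "dx - 1"] assms(1) by (simp add: d_def r_def)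
  have "(d + 8 + 4 * (d * r)) * (1 - r) \<le> s * (1 - r)" using 2 r by (intro mult_right_mono) auto
  then have 3: "d + 8 + 4 * (d * r) - d * r - 8 * r - 4 * (d * r * r) \<le> s - s * r"
    by (simp add: algebra_simps)
  have "d * r * r \<le> d * r * (1 / 100)" using r d by (intro mult_left_mono) auto
  moreover have dr: "0 \<le> d * r" using r d by simp
  ultimately have 4: "real dx + 1 + 2 * (d * r) + 2 * r \<le> real dw"
    using 1 3 r d(2) by linarith
  have "2 * real dx / b = 2 * (d * r) + 2 * r" unfolding d(2) r_def by (simp add: add_divide_distrib algebra_simps)
  then show "phi dx + 1 \<le> phi dw" using 4 by (intro phi_step) simp
  show "dx \<le> dw" using 4 dr r by linarith
qed

text \<open>The accuracy of keys that the queues guarantee: the position of the entry is simply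
  dropped from both bounds.\<close>

lemma key_near:
  assumes "invar m \<delta> D deg key q" "x < n" "y < n" "0 < D x y"
  shows "b * deg x \<le> b * key x y + key x y + b" "b * key x y \<le> b * deg x + key x y + b"
proof -
  have c: "core m \<delta> D deg key q" and u: "up deg key q x" "down deg key q x"
    using assms by (auto simp: invar_def)
  have "y \<in> set (q x)" "y \<in> set (q (x + n))" using coreD(8,9)[OF c assms(2)] assms(3,4) by auto
  then obtain i j where "i < length (q x)" "q x ! i = y" "j < length (q (x + n))" "q (x + n) ! j = y"
    by (metis in_set_conv_nth)
  then show "b * deg x \<le> b * key x y + key x y + b" "b * key x y \<le> b * deg x + key x y + b"
    using u unfolding up_def down_def by (metis add_leD2 add.assoc)+
qed

end

section \<open>The program\<close>

definition threshold :: "exp \<Rightarrow> exp" where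
  "threshold e = Add (Add e (Const 8)) (Div (Mul (Const 4) e) (Reg 1))"

definition reverse_arc :: "nat \<Rightarrow> nat \<Rightarrow> com" where
  "reverse_arc r r' =
    Seq (Assign 11 (Reg r)) (Seq (Assign 12 (Reg r')) (Seq remove_arc
   (Seq (Assign 11 (Reg r')) (Seq (Assign 12 (Reg r)) add_arc))))"

definition up_flip :: com where
  "up_flip = Seq (reverse_arc 6 7) (Seq (Assign 6 (Reg 7)) (Assign 8 (Reg 1)))"

definition up_refresh :: com where
  "up_refresh =
    Seq (Assign 11 (Reg 6)) (Seq (Assign 12 (Reg 7))
   (Seq (Assign 14 (Add (Load 2 (Reg 6)) (Const 1))) (Seq set_key
   (Seq (Assign 13 (Reg 6)) (Seq queue_rotate
        (Assign 8 (Sub (Reg 8) (Const 1))))))))"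

text \<open>Refreshing and moving along the chain share one loop. Its body is therefore loop-free,
  and a single potential bounds both.\<close>

definition up_step :: com where
  "up_step =
    Cond (Equal (Reg 8) (Const 0))
      (Seq (Store 2 (Reg 6) (Add (Load 2 (Reg 6)) (Const 1))) (Assign 9 (Const 0)))
      (Seq (Assign 7 (Load 4 (cell (Reg 6) (Load 6 (Reg 6)))))
           (Cond (Less (threshold (Load 2 (Reg 7))) (Add (Load 2 (Reg 6)) (Const 1)))
              up_flip up_refresh))"

definition down_flip :: com where
  "down_flip = Seq (reverse_arc 7 6) (Assign 6 (Reg 7))"

definition down_find :: com where
  "down_find =
    Cond (Equal (Load 9 (bag_id (Reg 6) (Reg 14))) (Const 0))
      (Assign 9 (Const 0))
      (Seq (Assign 7 (Load 8 (bag_cell (Reg 6) (Reg 14) (Const 0)))) down_flip)"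

definition down_step :: com where
  "down_step =
    Seq (Assign 14 (Add (threshold (Sub (Load 2 (Reg 6)) (Const 1))) (Const 1)))
   (Seq (Cond (Equal (Load 9 (bag_id (Reg 6) (Reg 14))) (Const 0))
          (Assign 14 (Add (Reg 14) (Const 1))) Skip)
        down_find)"

definition down_lower :: com where
  "down_lower =
    Cond (Less (Load 2 (Reg 6)) (Load 3 (cell (Reg 6) (Reg 7))))
      (Seq (Assign 11 (Reg 6)) (Seq (Assign 12 (Reg 7)) (Seq (Assign 14 (Load 2 (Reg 6))) set_key)))
      Skip"

definition down_refresh :: com where
  "down_refresh =
    Seq (Cond (Load 7 (Add (Reg 6) (Reg 0)))
          (Seq (Assign 13 (Add (Reg 6) (Reg 0)))
          (Seq (Assign 7 (Load 4 (cell (Reg 13) (Load 6 (Reg 13)))))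
          (Seq down_lower queue_rotate)))
          Skip)
        (Assign 8 (Sub (Reg 8) (Const 1)))"

definition choose_arc :: "exp \<Rightarrow> com" where
  "choose_arc e =
    Cond e (Seq (Assign 11 (Reg 4)) (Assign 12 (Reg 3)))
           (Seq (Assign 11 (Reg 3)) (Assign 12 (Reg 4)))"

text \<open>The endpoint of smaller recorded out-degree becomes the tail, so the new arc respects
  the threshold by \<open>le_tol\<close>.\<close>

definition insert_start :: com where
  "insert_start =
    Seq (choose_arc (Less (Load 2 (Reg 4)) (Load 2 (Reg 3)))) (Seq add_arc
   (Seq (Assign 6 (Reg 11)) (Seq (Assign 8 (Reg 1)) (Assign 9 (Const 1)))))"

definition insert_copy :: com where
  "insert_copy =
    Seq insert_start
   (Seq (While (Reg 9) up_step)
        (Assign 10 (Sub (Reg 10) (Const 1))))"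

definition delete_start :: com where
  "delete_start =
    Seq (choose_arc (Load 0 (cell (Reg 4) (Reg 3)))) (Seq remove_arc
   (Seq (Assign 6 (Reg 11)) (Assign 9 (Const 1))))"

definition decrement :: com where
  "decrement = Seq (Store 2 (Reg 6) (Sub (Load 2 (Reg 6)) (Const 1))) (Assign 8 (Reg 1))"

definition delete_copy :: com where
  "delete_copy =
    Seq delete_start
   (Seq (While (Reg 9) down_step)
   (Seq decrement
   (Seq (While (Reg 8) down_refresh)
        (Assign 10 (Sub (Reg 10) (Const 1))))))"

definition prepare :: com where
  "prepare = Seq (Assign 5 (Add (Mul (Mul (Const 2) (Reg 1)) (Reg 0)) (Const 16))) (Assign 10 (Reg 1))"

definition program :: com where
  "program =
    Seq prepare
        (Cond (Reg 2) (While (Reg 10) insert_copy) (While (Reg 10) delete_copy))"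

lemmas cost_defs = cell_def bag_id_def bag_cell_def queue_append_def queue_remove_def queue_rotate_def
  bag_insert_def bag_remove_def majority_exp_def Let_def fix_majority_def arc_count_def
  add_entry_def add_arc_def remove_arc_def set_key_def threshold_def reverse_arc_def up_flip_def up_refresh_def up_step_def
  down_flip_def down_find_def down_step_def down_lower_def down_refresh_def

lemma step_costs:
  "loop_free up_step" "max_cost up_step \<le> 2000"
  "loop_free down_step" "max_cost down_step \<le> 2000"
  "loop_free down_refresh" "max_cost down_refresh \<le> 2000"
  "loop_free add_arc" "max_cost add_arc \<le> 900"
  "loop_free remove_arc" "max_cost remove_arc \<le> 900"
  by (simp_all add: cost_defs)

section \<open>Correctness and cost of an update\<close>

context ram
begin

lemma rep_set_reg [simp]: "r \<notin> {0, 1, 5} \<Longrightarrow> rep (set_reg r v s) D deg key q = rep s D deg key q"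
  by (simp add: rep_def)

lemma repD_regs:
  assumes "rep s D deg key q"
  shows "regs s 0 = n" "regs s 1 = b" "regs s (Suc 0) = b" "regs s 5 = keys" "x < n \<Longrightarrow> arrays s 2 x = deg x"
    "x < n \<Longrightarrow> y < n \<Longrightarrow> arrays s 0 (x * n + y) = D x y"
    "x < n \<Longrightarrow> y < n \<Longrightarrow> arrays s 3 (x * n + y) = key x y" "repQ (arrays s) q"
    "repB (arrays s) (\<lambda>x y. 0 < D x y) key"
  using assms by (auto simp: rep_def repD_def repB_def)

lemma eval_threshold:
  assumes "regs s 1 = b" "eval w s e \<le> b * n"
  shows "eval w s (threshold e) = tol (eval w s e)" "tol (eval w s e) + 2 < 2 ^ w" "eval w s e + 1 < 2 ^ w"
proof -
  let ?d = "eval w s e"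
  have "1 * keys \<le> n * keys" using n by (intro mult_right_mono) auto
  then have keys: "keys \<le> n * keys" by simp
  have tol: "tol ?d + 2 < keys" using tol_less(1)[OF assms(2)] .
  then show tol': "tol ?d + 2 < 2 ^ w" using keys by (intro word_less) linarith
  have "2 * keys \<le> n * keys" using n by (intro mult_right_mono) auto
  moreover have "4 * ?d \<le> 2 * keys" using assms(2) by (simp add: keys_def)
  ultimately have "4 * ?d < 2 ^ w" using word_less[of "4 * ?d"] by linarith
  moreover show "?d + 1 < 2 ^ w" using tol' by (simp add: tol_def)
  moreover have "?d + 8 < 2 ^ w" using tol' by (simp add: tol_def)
  ultimately show "eval w s (threshold e) = tol ?d"
    using tol' assms(1) unfolding threshold_def by (simp add: tol_def)
qed

text \<open>Joins the machine level to the invariant. From here on multiplicities, keys and queues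
  can be hidden behind existential quantifiers, while \<open>m\<close>, \<open>\<delta>\<close> and
  \<open>deg\<close> stay visible.\<close>

lemma add_arc_inv:
  assumes rep: "rep s D deg key q" and invar: "invar m \<delta> D deg key q"
    and "regs s 11 = x" "regs s 12 = y" and xy: "x < n" "y < n" "x \<noteq> y"
    and "m {x, y} < b" "deg x \<le> tol (deg y)" "\<delta> x \<le> 0"
  shows "\<exists>D' key' q'. rep (run w add_arc s) D' deg key' q' \<and>
    invar (m({x, y} := m {x, y} + 1)) (\<delta>(x := \<delta> x + 1)) D' deg key' q'" (is ?P)
    "r < 13 \<Longrightarrow> regs (run w add_arc s) r = regs s r"
proof -
  note c = invarD(1)[OF invar]
  have "D x y = 0 \<Longrightarrow> y \<notin> set (q x)" "D x y = 0 \<Longrightarrow> y \<notin> set (q (x + n))"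
    using coreD(8,9)[OF c xy(1)] by auto
  moreover have "deg x < keys" using core_bounds(1)[OF c xy(1)] tol_less(2) by fastforce
  ultimately have a: "deg x < keys" "D x y \<le> b" "D x y = 0 \<Longrightarrow> y \<notin> set (q x)"
    "D x y = 0 \<Longrightarrow> y \<notin> set (q (x + n))"
    using core_arc(3)[OF c xy(1,2)] by blast+
  show ?P
    using add_arc_run(1)[OF rep assms(3,4) xy a] inv_add_arc[OF invar xy assms(8-10)] by blast
  show "r < 13 \<Longrightarrow> regs (run w add_arc s) r = regs s r"
    using add_arc_run(2)[OF rep assms(3,4) xy a] by blast
qed

lemma remove_arc_inv:
  assumes rep: "rep s D deg key q" and invar: "invar m \<delta> D deg key q"
    and "regs s 11 = x" "regs s 12 = y" and xy: "x < n" "y < n" and "0 < D x y" "0 \<le> \<delta> x"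
  shows "\<exists>D' key' q'. rep (run w remove_arc s) D' deg key' q' \<and>
    invar (m({x, y} := m {x, y} - 1)) (\<delta>(x := \<delta> x - 1)) D' deg key' q'" (is ?P)
    "r < 13 \<Longrightarrow> regs (run w remove_arc s) r = regs s r" "x \<noteq> y"
proof -
  note c = invarD(1)[OF invar]
  have "y \<in> set (q x)" "y \<in> set (q (x + n))"
    using coreD(8,9)[OF c xy(1)] assms(6,7) by auto
  moreover show ne: "x \<noteq> y" using core_arc(4)[OF c xy assms(7)] .
  ultimately have r: "rep (run w remove_arc s) (upd D x y (D x y - 1)) deg key
      (if D x y = 1 then q(x := swap_remove y (q x), x + n := swap_remove y (q (x + n))) else q)"
    "\<forall>r<13. regs (run w remove_arc s) r = regs s r"
    using remove_arc_run[OF rep assms(3,4) xy _ assms(7) key_less[OF c xy assms(7)]] by blast+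
  show ?P
    using r(1) inv_remove_arc[OF invar xy assms(7,8)] by blast
  show "r < 13 \<Longrightarrow> regs (run w remove_arc s) r = regs s r" using r(2) by blast
qed

text \<open>Serves both kinds of chains: a surplus at the tail \<open>x\<close> moves on to
  \<open>y\<close>, or a deficit at the head \<open>y\<close> moves to \<open>x\<close>. The
  multiplicities of edges are restored.\<close>

lemma reverse_arc_inv:
  assumes rep: "rep s D deg key q" and invar: "invar m \<delta> D deg key q"
    and "regs s r = x" "regs s r' = y" and xy: "x < n" "y < n" and "0 < D x y" "0 \<le> \<delta> x"
    and d: "deg y \<le> tol (deg x)" and \<delta>: "\<delta> y \<le> 0" and r: "r \<in> {6..<11}" "r' \<in> {6..<11}"
  shows "\<exists>D' key' q'. rep (run w (reverse_arc r r') s) D' deg key' q' \<and>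
    invar m (\<delta>(x := \<delta> x - 1, y := \<delta> y + 1)) D' deg key' q'" (is ?P)
    "r'' < 11 \<Longrightarrow> regs (run w (reverse_arc r r') s) r'' = regs s r''" "x \<noteq> y"
proof -
  note c = invarD(1)[OF invar]
  define s1 where "s1 = set_reg 12 y (set_reg 11 x s)"
  define s2 where "s2 = run w remove_arc s1"
  define s3 where "s3 = set_reg 12 x (set_reg 11 y s2)"
  have rep1: "rep s1 D deg key q" "regs s1 11 = x" "regs s1 12 = y" using rep by (simp_all add: s1_def)
  note 2 = remove_arc_inv[OF rep1(1) invar rep1(2,3) xy assms(7,8), folded s2_def]
  show ne: "x \<noteq> y" using 2(3) .
  from 2(1) obtain D2 key2 q2 where rep2: "rep s2 D2 deg key2 q2"
    and inv2: "invar (m({x, y} := m {x, y} - 1)) (\<delta>(x := \<delta> x - 1)) D2 deg key2 q2" by blast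
  have r2: "regs s2 r = x" "regs s2 r' = y" using 2(2) r assms(3,4) by (auto simp: s1_def)
  have rep3: "rep s3 D2 deg key2 q2" "regs s3 11 = y" "regs s3 12 = x"
    using rep2 by (simp_all add: s3_def)
  have run: "run w (reverse_arc r r') s = run w add_arc s3"
    using r r2 assms(3,4) unfolding reverse_arc_def by (auto simp: s1_def s2_def s3_def)
  have m: "0 < m {x, y}" "m {x, y} \<le> b" using core_arc(2)[OF c xy ne] assms(7) coreD(2)[OF c] by auto
  have m2: "(m({x, y} := m {x, y} - 1)) {y, x} < b" "{y, x} = {x, y}" using m by auto
  have 4: "\<exists>D' key' q'. rep (run w add_arc s3) D' deg key' q' \<and>
    invar ((m({x, y} := m {x, y} - 1))({y, x} := (m({x, y} := m {x, y} - 1)) {y, x} + 1))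
      ((\<delta>(x := \<delta> x - 1))(y := (\<delta>(x := \<delta> x - 1)) y + 1)) D' deg key' q'"
    "r'' < 13 \<Longrightarrow> regs (run w add_arc s3) r'' = regs s3 r''" for r''
    using add_arc_inv[OF rep3(1) inv2 rep3(2,3) xy(2,1) ne[symmetric] m2(1) d] \<delta> ne by (simp_all del: fun_upd_apply add: fun_upd_other)
  have "(m({x, y} := m {x, y} - 1))({y, x} := (m({x, y} := m {x, y} - 1)) {y, x} + 1) = m"
    using m unfolding m2(2) by (auto simp: fun_eq_iff)
  moreover have "(\<delta>(x := \<delta> x - 1))(y := (\<delta>(x := \<delta> x - 1)) y + 1) = \<delta>(x := \<delta> x - 1, y := \<delta> y + 1)"
    using ne by auto
  ultimately show ?P using 4(1) unfolding run by simp
  show "r'' < 11 \<Longrightarrow> regs (run w (reverse_arc r r') s) r'' = regs s r''"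
    unfolding run using 4(2)[of r''] 2(2)[of r''] by (simp add: s1_def s3_def)
qed

text \<open>A pending increment makes the true out-degree positive even if the recorded one is 0. So
  \<open>up_step\<close> can read the front of the queue without a test for emptiness.\<close>

lemma queue_nonempty:
  assumes "core m \<delta> D deg key q" "x < n" "\<delta> x = 1"
  shows "q x \<noteq> []"
proof
  assume "q x = []"
  then have "\<forall>y<n. D x y = 0" using coreD(8)[OF assms(1,2)] by auto
  then have "outdeg n D x = 0" by (simp add: outdeg_def)
  then show False using coreD(4)[OF assms(1,2)] assms(3) by simp
qed

text \<open>The update and the counter of copies, on which the outer loop depends.\<close>

definition kept :: "state \<Rightarrow> state \<Rightarrow> bool" where
  "kept s s' \<longleftrightarrow> (\<forall>r\<in>{2, 3, 4, 10}. regs s' r = regs s r)"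

text \<open>Recorded degrees do not change before the chain ends, so they stay below
  \<open>M\<close>; only the final increment makes it \<open>M + 1\<close>.\<close>

definition up_state :: "(nat set \<Rightarrow> nat) \<Rightarrow> nat \<Rightarrow> state \<Rightarrow> bool" where
  "up_state m M s \<longleftrightarrow> (\<exists>D deg key q. rep s D deg key q \<and>
    (if regs s 9 = 0 then invar m (\<lambda>_. 0) D deg key q \<and> (\<forall>y<n. deg y \<le> M + 1)
     else regs s 9 = 1 \<and> regs s 6 < n \<and> regs s 8 \<le> b \<and> (\<forall>y<n. deg y \<le> M) \<and>
       invar m ((\<lambda>_. 0)(regs s 6 := 1)) D deg key q \<and> up_scan (b - regs s 8) deg key q (regs s 6)))"

text \<open>A reversal resets register 8 to \<open>b\<close>, but it lowers \<open>phi\<close> by at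
  least one, which is worth \<open>b + 1\<close>.\<close>

definition up_measure :: "state \<Rightarrow> real" where
  "up_measure s = (if regs s 9 = 0 then 0 else phi (arrays s 2 (regs s 6)) * (b + 1) + regs s 8 + 1)"

lemma up_step_run:
  assumes st: "up_state m M s" and act: "regs s 9 \<noteq> 0"
  shows "up_state m M (run w up_step s)" "kept s (run w up_step s)"
    "up_measure (run w up_step s) \<le> up_measure s - 1"
proof -
  let ?s' = "run w up_step s"
  define x where "x = regs s 6"
  define j where "j = regs s 8"
  let ?\<delta> = "(\<lambda>_. 0::int)(x := 1)"
  from st act obtain D deg key q where rep: "rep s D deg key q" and invar: "invar m ?\<delta> D deg key q"
    and xj: "x < n" "j \<le> b" and M: "\<forall>y<n. deg y \<le> M" and scan: "up_scan (b - j) deg key q x"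
    and r9: "regs s 9 = 1"
    unfolding up_state_def x_def j_def by auto
  note R = repD_regs[OF rep]
  have regs: "regs s 6 = x" "regs s 8 = j" by (simp_all add: x_def j_def)
  note c = invarD(1)[OF invar]
  have dx: "arrays s 2 x = deg x" "deg x \<le> b * n" using R(5) core_bounds(1)[OF c] xj by auto
  have dx1: "Suc (deg x) < 2 ^ w" using eval_threshold(3)[of s "Const 0"] dx eval_threshold(3)[of s "Load 2 (Reg 6)"]
    R(2) regs by simp
  have "up_state m M ?s' \<and> kept s ?s' \<and>
    up_measure ?s' \<le> up_measure s - 1"
  proof (cases "j = 0")
    case True
    have run: "?s' = set_reg 9 0 (set_array 2 x (deg x + 1) s)"
      unfolding up_step_def using True regs dx dx1 by simp
    have "invar m (?\<delta>(x := 0)) D (deg(x := deg x + 1)) key q"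
      using up_scan_finish[OF invar xj(1)] scan True by simp
    moreover have "?\<delta>(x := 0) = (\<lambda>_. 0)" by auto
    ultimately have "invar m (\<lambda>_. 0) D (deg(x := deg x + 1)) key q" by simp
    moreover have "rep ?s' D (deg(x := deg x + 1)) key q"
      unfolding run using rep by (simp add: rep_def repD_def repB_def repQ_def)
    moreover have "\<forall>y<n. (deg(x := deg x + 1)) y \<le> M + 1" using M xj by (auto simp: le_Suc_eq)
    moreover have "kept s ?s'" unfolding run kept_def by simp
    moreover have "1 \<le> up_measure s" using r9 phi_nonneg by (simp add: up_measure_def)
    moreover have "regs ?s' 9 = 0" unfolding run by simp
    ultimately show ?thesis unfolding up_state_def up_measure_def by (simp del: fun_upd_apply) blast
  next
    case False
    have ne: "q x \<noteq> []" using queue_nonempty[OF c xj(1)] by simp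
    define y where "y = hd (q x)"
    have "y \<in> set (q x)" using ne by (simp add: y_def)
    then have y: "y < n" "0 < D x y" using coreD(8)[OF c xj(1)] by auto
    have front: "arrays s 4 (x * n + arrays s 6 x) = y" "arrays s 6 x < n"
      using front_eq[OF R(8), of x] ne xj by (auto simp: y_def)
    have dy: "arrays s 2 y = deg y" "deg y \<le> b * n" using R(5) core_bounds(1)[OF c] y by auto
    define s1 where "s1 = set_reg 7 y s"
    have rep1: "rep s1 D deg key q" using rep by (simp add: s1_def)
    have r1: "regs s1 6 = x" "regs s1 7 = y" "regs s1 8 = j" "regs s1 1 = b" "regs s1 0 = n"
      "arrays s1 = arrays s" "\<And>r. r \<noteq> 7 \<Longrightarrow> regs s1 r = regs s r"
      using R regs by (simp_all add: s1_def)
    have th: "eval w s1 (threshold (Load 2 (Reg 7))) = tol (deg y)"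
      using eval_threshold(1)[of s1 "Load 2 (Reg 7)"] r1 dy by simp
    have run: "?s' = (if tol (deg y) < deg x + 1 then run w up_flip s1 else run w up_refresh s1)"
      unfolding up_step_def using False regs dx dx1 front R(1) xj th r1
      by (simp add: s1_def[symmetric])
    show ?thesis
    proof (cases "tol (deg y) < deg x + 1")
      case True
      have flip: "phi (deg y) + 1 \<le> phi (deg x)" "deg y \<le> deg x" using phi_up_step[of "deg x" "deg y"] True by auto
      have "deg y \<le> tol (deg x)" using flip(2) le_tol[of "deg x"] by simp
      have ne': "x \<noteq> y" using core_arc(4)[OF c xj(1) y] .
      have \<delta>': "?\<delta>(x := ?\<delta> x - 1, y := ?\<delta> y + 1) = (\<lambda>_. 0)(y := 1)" using ne' by (auto simp: fun_eq_iff)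
      note rv = reverse_arc_inv[OF rep1 invar r1(1,2) xj(1) y _ \<open>deg y \<le> tol (deg x)\<close>]
      from rv(1) ne' \<delta>'
      obtain D' key' q' where rep2: "rep (run w (reverse_arc 6 7) s1) D' deg key' q'"
        and inv2: "invar m ((\<lambda>_. 0)(y := 1)) D' deg key' q'" by auto
      have r2: "r < 11 \<Longrightarrow> regs (run w (reverse_arc 6 7) s1) r = regs s1 r" for r
        using rv(2) ne' by auto
      have run2: "?s' = set_reg 8 b (set_reg 6 y (run w (reverse_arc 6 7) s1))"
        unfolding run up_flip_def using True r2[of 7] r2[of 1] r1 by simp
      have "rep ?s' D' deg key' q'" using rep2 unfolding run2 by simp
      moreover have "regs ?s' 9 = 1" "regs ?s' 6 = y"
        "regs ?s' 8 = b" "arrays ?s' 2 y = deg y"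
        using r2[of 9] r1(7)[of 9] r9 repD_regs(5)[OF rep2 y(1)] unfolding run2 by simp_all
      moreover have "kept s ?s'"
        unfolding kept_def run2 using r2 r1(7) by simp
      moreover have "phi (deg y) * (b + 1) + real b + 1 \<le> phi (deg x) * (b + 1) + j + 1 - 1"
      proof -
        have "(phi (deg y) + 1) * (b + 1) \<le> phi (deg x) * (b + 1)"
          using flip(1) by (intro mult_right_mono) auto
        then show ?thesis by (simp add: algebra_simps)
      qed
      ultimately show ?thesis
        using inv2 y M up_scan_0[OF inv2 y(1)] r9 regs dx unfolding up_state_def up_measure_def by auto
    next
      case tol: False
      define s2 where "s2 = set_reg 14 (deg x + 1) (set_reg 12 y (set_reg 11 x s1))"
      define s3 where "s3 = run w set_key s2"
      define s4 where "s4 = set_reg 13 x s3"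
      define s5 where "s5 = run w queue_rotate s4"
      have rep2: "rep s2 D deg key q" using rep1 by (simp add: s2_def)
      have k: "rep s3 D deg (upd key x y (deg x + 1)) q" "\<forall>r<15. regs s3 r = regs s2 r"
        unfolding s3_def using set_key_run[OF rep2, of x y "deg x + 1"] xj y key_less[OF c xj(1) y]
          tol_less(2)[OF dx(2)] by (simp_all add: s2_def)
      have rep4: "rep s4 D deg (upd key x y (deg x + 1)) q" using k(1) by (simp add: s4_def)
      have ro: "rep s5 D deg (upd key x y (deg x + 1)) (q(x := rotate1 (q x)))"
        "\<forall>r<15. regs s5 r = regs s4 r"
        unfolding s5_def using rotate_rep[OF rep4, of x] xj ne core_bounds(2)[OF c xj(1)]
        by (simp_all add: s4_def)
      have r5: "r < 11 \<Longrightarrow> regs s5 r = regs s1 r" for r using ro(2) k(2) by (simp add: s4_def s2_def)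
      have e: "run w up_refresh s1 = set_reg 8 (j - 1) s5"
        unfolding up_refresh_def using dx dx1 r1 k(2) r5[of 8]
        by (simp add: s2_def[symmetric] s3_def[symmetric] s4_def[symmetric] s5_def[symmetric]) (simp add: s2_def s3_def s4_def s5_def)
      have run2: "?s' = set_reg 8 (j - 1) s5" unfolding run e using tol by simp
      have rep': "rep ?s' D deg (upd key x y (deg x + 1)) (q(x := rotate1 (q x)))"
        using ro(1) unfolding run2 by simp
      have "deg x + 1 \<le> tol (deg y)" using tol by simp
      note scan' = up_scan_step[OF invar xj(1) _ scan ne y_def this]
      have bj: "b - j + 1 = b - (j - 1)" using False xj by simp
      have r': "regs ?s' 9 = 1" "regs ?s' 6 = x"
        "regs ?s' 8 = j - 1" "arrays ?s' 2 x = deg x"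
        using r5[of 9] r5[of 6] r1 r9 repD_regs(5)[OF ro(1) xj(1)] unfolding run2 by simp_all
      have "kept s ?s'"
        unfolding kept_def run2 using r5 r1(7) by simp
      moreover have "up_measure ?s' \<le> up_measure s - 1"
        using r' r9 regs dx False unfolding up_measure_def by simp
      moreover have "up_state m M ?s'"
        unfolding up_state_def r'
        using rep' scan'[unfolded bj] M xj by (intro exI conjI) (assumption, simp)
      ultimately show ?thesis by blast
    qed
  qed
  then show "up_state m M ?s'" "kept s ?s'"
    "up_measure ?s' \<le> up_measure s - 1" by blast+
qed

lemma up_loop_total:
  assumes rep: "rep s D deg key q" and invar: "invar m ((\<lambda>_. 0)(x := 1)) D deg key q" and x: "x < n"
    and r: "regs s 6 = x" "regs s 8 = b" "regs s 9 = 1" and M: "\<forall>y<n. deg y \<le> M"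
  shows "runs_in w (While (Reg 9) up_step) s ((phi M * (b + 1) + b + 2) * 2002)
    (\<lambda>s'. kept s s' \<and> (\<exists>D deg key q. rep s' D deg key q \<and> invar m (\<lambda>_. 0) D deg key q \<and> (\<forall>y<n. deg y \<le> M + 1)))"
proof (rule runs_in_while[where I = "\<lambda>s'. up_state m M s' \<and> kept s s'" and V = up_measure and B = 2000])
  show "up_state m M s \<and> kept s s"
    unfolding up_state_def kept_def using assms up_scan_0[OF invar x] by auto
  show "0 \<le> up_measure s" for s using phi_nonneg by (simp add: up_measure_def)
  show "runs_in w up_step s1 2000 (\<lambda>s'. (up_state m M s' \<and> kept s s') \<and> up_measure s' \<le> up_measure s1 - 1)"
    if "up_state m M s1 \<and> kept s s1" "eval w s1 (Reg 9) \<noteq> 0" for s1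
    using up_step_run[of m M s1] that step_costs(1,2) by (intro runs_in_run) (auto simp: kept_def)
  show "kept s s1 \<and> (\<exists>D deg key q. rep s1 D deg key q \<and> invar m (\<lambda>_. 0) D deg key q \<and> (\<forall>y<n. deg y \<le> M + 1))"
    if "up_state m M s1 \<and> kept s s1" "eval w s1 (Reg 9) = 0" for s1
    using that unfolding up_state_def by auto
  have "phi (deg x) * (b + 1) \<le> phi M * (b + 1)" using M x by (intro mult_right_mono phi_mono) auto
  then show "(up_measure s + 1) * (2000 + 1 + real (exp_cost (Reg 9))) \<le> (phi M * (b + 1) + b + 2) * 2002"
    using r repD_regs(5)[OF rep x] by (simp add: up_measure_def)
qed simp


lemma bag_lookup:
  assumes "repB A P key" "y < n" "k < keys"
  shows "A 9 (y * keys + k) = 0 \<Longrightarrow> x < n \<Longrightarrow> P x y \<Longrightarrow> key x y \<noteq> k"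
    "0 < A 9 (y * keys + k) \<Longrightarrow> A 8 ((y * keys + k) * n) < n \<and> P (A 8 ((y * keys + k) * n)) y \<and>
       key (A 8 ((y * keys + k) * n)) y = k"
proof -
  have r: "bag_rep (A 9 (y * keys + k)) (\<lambda>i. A 8 ((y * keys + k) * n + i)) (\<lambda>x. A 10 (x * n + y))
    {x. x < n \<and> P x y \<and> key x y = k}"
    using assms by (simp add: repB_def)
  show "A 9 (y * keys + k) = 0 \<Longrightarrow> x < n \<Longrightarrow> P x y \<Longrightarrow> key x y \<noteq> k"
    using r unfolding bag_rep_def by fastforce
  show "0 < A 9 (y * keys + k) \<Longrightarrow> A 8 ((y * keys + k) * n) < n \<and> P (A 8 ((y * keys + k) * n)) y \<and>
       key (A 8 ((y * keys + k) * n)) y = k"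
    using r unfolding bag_rep_def by fastforce
qed

text \<open>When register 9 is 0, both candidate bags are empty, as \<open>down_scan_start\<close>
  requires.\<close>

definition down_state :: "(nat set \<Rightarrow> nat) \<Rightarrow> nat \<Rightarrow> state \<Rightarrow> bool" where
  "down_state m M s \<longleftrightarrow> (\<exists>D deg key q. rep s D deg key q \<and> regs s 6 < n \<and> regs s 9 \<le> 1 \<and>
    (\<forall>y<n. deg y \<le> M) \<and> invar m ((\<lambda>_. 0)(regs s 6 := -1)) D deg key q \<and>
    (regs s 9 = 0 \<longrightarrow> (\<forall>y<n. 0 < D y (regs s 6) \<longrightarrow>
       key y (regs s 6) \<noteq> tol (deg (regs s 6) - 1) + 1 \<and> key y (regs s 6) \<noteq> tol (deg (regs s 6) - 1) + 2)))"

text \<open>Degrees rise along this chain, so the potential is the distance to the largest degree. A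
  step needs no refreshing, hence there is no factor \<open>b + 1\<close>.\<close>

definition down_measure :: "nat \<Rightarrow> state \<Rightarrow> real" where
  "down_measure M s = (if regs s 9 = 0 then 0 else phi M - phi (arrays s 2 (regs s 6)) + 1)"

lemma down_measure_nonneg:
  assumes "down_state m M s"
  shows "0 \<le> down_measure M s"
proof -
  from assms obtain D deg key q where "rep s D deg key q" "regs s 6 < n" "\<forall>y<n. deg y \<le> M"
    unfolding down_state_def by blast
  then have "arrays s 2 (regs s 6) \<le> M" using repD_regs(5) by metis
  then show ?thesis using phi_mono unfolding down_measure_def by fastforce
qed

lemma down_step_run:
  assumes st: "down_state m M s" and act: "regs s 9 \<noteq> 0"
  shows "down_state m M (run w down_step s)" "kept s (run w down_step s)"
    "down_measure M (run w down_step s) \<le> down_measure M s - 1"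
proof -
  let ?s' = "run w down_step s"
  define x where "x = regs s 6"
  let ?\<delta> = "(\<lambda>_. 0::int)(x := -1)"
  from st act obtain D deg key q where rep: "rep s D deg key q" and invar: "invar m ?\<delta> D deg key q"
    and x: "x < n" and M: "\<forall>y<n. deg y \<le> M" and r9: "regs s 9 = 1"
    unfolding down_state_def x_def by force
  note R = repD_regs[OF rep]
  have regs: "regs s 6 = x" by (simp add: x_def)
  note c = invarD(1)[OF invar]
  have dx: "arrays s 2 x = deg x" "deg x \<le> b * n" "1 \<le> deg x"
    using R(5) core_bounds(1)[OF c] coreD(4)[OF c x] x by auto
  define k1 where "k1 = tol (deg x - 1) + 1"
  have k1: "k1 + 1 < keys" using tol_less(1)[of "deg x - 1"] dx by (simp add: k1_def)
  let ?e = "Sub (Load 2 (Reg 6)) (Const 1)"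
  have "eval w s ?e = deg x - 1" using regs dx by simp
  then have e1: "eval w s (threshold ?e) = tol (deg x - 1)" "tol (deg x - 1) + 2 < 2 ^ w"
    using eval_threshold(1,2)[of s ?e] R(2) dx by simp_all
  \<comment> \<open>The bag finally inspected: of the two candidates the smaller key, unless its bag
    is empty.\<close>
  define k where "k = (if arrays s 9 (x * keys + k1) = 0 then k1 + 1 else k1)"
  have k: "k < keys" "tol (deg x - 1) < k" using k1 by (auto simp: k_def k1_def)
  define s2 where "s2 = (if arrays s 9 (x * keys + k1) = 0 then set_reg 14 k (set_reg 14 k1 s) else set_reg 14 k1 s)"
  have rep2: "rep s2 D deg key q" using rep by (simp add: s2_def)
  have r2: "r \<noteq> 14 \<Longrightarrow> regs s2 r = regs s r" "regs s2 14 = k" "arrays s2 = arrays s" for r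
    by (auto simp: s2_def k_def)
  have run1: "?s' = run w down_find s2"
    unfolding down_step_def using e1 k1 R(4) regs x
    by (simp add: s2_def k_def k1_def)
  have "down_state m M ?s' \<and> kept s ?s' \<and>
    down_measure M ?s' \<le> down_measure M s - 1"
  proof (cases "arrays s 9 (x * keys + k) = 0")
    case True
    have run: "?s' = set_reg 9 0 s2"
      unfolding run1 down_find_def using True R(4) r2 k x regs by simp
    have empty: "arrays s 9 (x * keys + k1) = 0" "k = k1 + 1"
      using True by (auto simp: k_def split: if_splits)
    have "key y x \<noteq> k1 \<and> key y x \<noteq> k1 + 1" if "y < n" "0 < D y x" for y
      using bag_lookup(1)[OF R(9) x _ _ that] k1 empty True by simp
    then have "\<forall>y<n. 0 < D y x \<longrightarrow> key y x \<noteq> tol (deg x - 1) + 1 \<and> key y x \<noteq> tol (deg x - 1) + 2"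
      by (simp add: k1_def)
    moreover have "rep ?s' D deg key q" using rep2 unfolding run by simp
    moreover have r: "regs ?s' 9 = 0" "regs ?s' 6 = x"
      using r2 regs unfolding run by simp_all
    ultimately have "down_state m M ?s'"
      unfolding down_state_def r using M invar x by (intro exI conjI) (assumption | simp)+
    moreover have "kept s ?s'" unfolding kept_def run using r2 by simp
    moreover have "phi (deg x) \<le> phi M" using M x by (intro phi_mono) simp
    then have "1 \<le> down_measure M s" using r9 regs dx unfolding down_measure_def by simp
    ultimately show ?thesis using r unfolding down_measure_def by simp
  next
    case False
    define y where "y = arrays s 8 ((x * keys + k) * n)"
    have y: "y < n" "0 < D y x" "key y x = k"
      using bag_lookup(2)[OF R(9) x k(1)] False by (auto simp: y_def)
    define s3 where "s3 = set_reg 7 y s2"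
    have run: "?s' = run w down_flip s3"
      unfolding run1 down_find_def using False R(1,4) r2 k x regs n by (simp add: y_def s3_def)
    have rep3: "rep s3 D deg key q" using rep2 by (simp add: s3_def)
    have r3: "regs s3 7 = y" "regs s3 6 = x" "r \<noteq> 7 \<Longrightarrow> r \<noteq> 14 \<Longrightarrow> regs s3 r = regs s r" for r
      using r2 regs by (simp_all add: s3_def)
    have flip: "phi (deg x) + 1 \<le> phi (deg y)" "deg x \<le> deg y"
      using phi_down_step[of "deg x" k "deg y"] k(2) dx(3) key_near(2)[OF invar y(1) x y(2)] y(3) by simp_all
    then have d: "deg x \<le> tol (deg y)" using le_tol[of "deg y"] by simp
    have ne: "y \<noteq> x" using core_arc(4)[OF c y(1) x y(2)] .
    have \<delta>': "?\<delta>(y := ?\<delta> y - 1, x := ?\<delta> x + 1) = (\<lambda>_. 0)(y := -1)" using ne by (auto simp: fun_eq_iff)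
    note rv = reverse_arc_inv[OF rep3 invar r3(1,2) y(1) x y(2) _ d]
    from rv(1) ne \<delta>'
    obtain D' key' q' where rep4: "rep (run w (reverse_arc 7 6) s3) D' deg key' q'"
      and inv4: "invar m ((\<lambda>_. 0)(y := -1)) D' deg key' q'" by auto
    have r4: "r < 11 \<Longrightarrow> regs (run w (reverse_arc 7 6) s3) r = regs s3 r" for r
      using rv(2) ne by auto
    have run2: "?s' = set_reg 6 y (run w (reverse_arc 7 6) s3)"
      unfolding run down_flip_def using r4[of 7] r3 by simp
    have "rep ?s' D' deg key' q'" using rep4 unfolding run2 by simp
    moreover have r: "regs ?s' 9 = 1" "regs ?s' 6 = y"
      "arrays ?s' 2 y = deg y"
      using r4[of 9] r3(3)[of 9] r9 repD_regs(5)[OF rep4 y(1)] unfolding run2 by simp_all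
    ultimately have "down_state m M ?s'"
      unfolding down_state_def r using M inv4 y by (intro exI conjI) (assumption | simp)+
    moreover have "kept s ?s'" unfolding kept_def run2 using r4 r3(3) by simp
    moreover have "down_measure M ?s' \<le> down_measure M s - 1"
      using flip(1) r r9 regs dx unfolding down_measure_def by simp
    ultimately show ?thesis by blast
  qed
  then show "down_state m M ?s'" "kept s ?s'"
    "down_measure M ?s' \<le> down_measure M s - 1" by blast+
qed

definition scan_state :: "(nat set \<Rightarrow> nat) \<Rightarrow> nat \<Rightarrow> state \<Rightarrow> bool" where
  "scan_state m M s \<longleftrightarrow> (\<exists>D deg key q. rep s D deg key q \<and> regs s 6 < n \<and> regs s 8 \<le> b \<and>
    (\<forall>y<n. deg y \<le> M) \<and> down_inv m (regs s 6) (b - regs s 8) D deg key q)"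

lemma down_refresh_run:
  assumes st: "scan_state m M s" and act: "regs s 8 \<noteq> 0"
  shows "scan_state m M (run w down_refresh s)" "kept s (run w down_refresh s)"
    "regs (run w down_refresh s) 8 = regs s 8 - 1"
proof -
  let ?s' = "run w down_refresh s"
  define x where "x = regs s 6"
  define j where "j = regs s 8"
  from st act obtain D deg key q where rep: "rep s D deg key q" and invar: "down_inv m x (b - j) D deg key q"
    and xj: "x < n" "j \<le> b" and M: "\<forall>y<n. deg y \<le> M"
    unfolding scan_state_def x_def j_def by force
  note R = repD_regs[OF rep]
  have regs: "regs s 6 = x" "regs s 8 = j" by (simp_all add: x_def j_def)
  have bj: "b - j + 1 = b - (j - 1)" using act xj regs by simp
  have c: "core m (\<lambda>_. 0) D deg key q" using invar by (simp add: down_inv_def)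
  have xn: "x + n < 2 * n" using xj by simp
  have len: "arrays s 7 (x + n) = length (q (x + n))" using queue_length_eq[OF R(8) xn] .
  have "scan_state m M ?s' \<and> kept s ?s' \<and>
    regs ?s' 8 = j - 1"
  proof (cases "q (x + n) = []")
    case True
    have run: "?s' = set_reg 8 (j - 1) s"
      unfolding down_refresh_def using True len R(1) regs xj by simp
    have "scan_state m M ?s'"
      unfolding scan_state_def run using rep M xj regs down_scan_empty[OF invar True, unfolded bj]
      by (intro exI[of _ D] exI[of _ deg] exI[of _ key] exI[of _ q]) simp
    then show ?thesis unfolding kept_def run by simp
  next
    case False
    define y where "y = hd (q (x + n))"
    have "y \<in> set (q (x + n))" using False by (simp add: y_def)
    then have y: "y < n" "0 < D x y" using coreD(9)[OF c xj(1)] by auto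
    have front: "arrays s 4 ((x + n) * n + arrays s 6 (x + n)) = y" "arrays s 6 (x + n) < n"
      using front_eq[OF R(8) xn False] by (auto simp: y_def)
    define s1 where "s1 = set_reg 7 y (set_reg 13 (x + n) s)"
    have rep1: "rep s1 D deg key q" using rep by (simp add: s1_def)
    have r1: "regs s1 6 = x" "regs s1 7 = y" "regs s1 8 = j" "regs s1 0 = n" "regs s1 13 = x + n"
      "arrays s1 = arrays s" "r \<notin> {7, 13} \<Longrightarrow> regs s1 r = regs s r" for r
      using R regs by (simp_all add: s1_def)
    define key' where "key' = (if deg x < key x y then upd key x y (deg x) else key)"
    define s2 where "s2 = run w down_lower s1"
    have dx: "arrays s 2 x = deg x" "deg x \<le> b * n" using R(5) core_bounds(1)[OF c] xj by auto
    have s2: "rep s2 D deg key' q \<and> (\<forall>r<11. regs s2 r = regs s1 r) \<and> regs s2 13 = x + n"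
    proof (cases "deg x < key x y")
      case True
      define s0 where "s0 = set_reg 14 (deg x) (set_reg 12 y (set_reg 11 x s1))"
      have rep0: "rep s0 D deg key q" using rep1 by (simp add: s0_def)
      have "rep (run w set_key s0) D deg (upd key x y (deg x)) q"
        "\<forall>r<15. regs (run w set_key s0) r = regs s0 r"
        using set_key_run[OF rep0, of x y "deg x"] xj y key_less[OF c xj(1) y]
          tol_less(2)[OF dx(2)] by (simp_all add: s0_def)
      moreover have "s2 = run w set_key s0"
        unfolding s2_def down_lower_def using True r1 R(7)[OF xj(1) y(1)] dx xj y by (simp add: s0_def)
      ultimately show ?thesis using True r1 by (simp add: key'_def s0_def)
    next
      case False
      then have "s2 = s1"
        unfolding s2_def down_lower_def using r1 R(7)[OF xj(1) y(1)] dx xj y by simp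
      then show ?thesis using False rep1 r1 by (simp add: key'_def)
    qed
    define s3 where "s3 = run w queue_rotate s2"
    have s3: "rep s3 D deg key' (q(x + n := rotate1 (q (x + n))))" "\<forall>r<15. regs s3 r = regs s2 r"
      unfolding s3_def using rotate_rep[of s2 D deg key' q "x + n"] s2 xn False core_bounds(3)[OF c xj(1)]
      by simp_all
    have r3: "r < 11 \<Longrightarrow> regs s3 r = regs s1 r" for r using s2 s3(2) by simp
    have run: "?s' = set_reg 8 (j - 1) s3"
      unfolding down_refresh_def using False len R(1) regs xj front r3[of 8] r1
      by (simp add: s3_def s2_def s1_def)
    have "down_inv m x (b - j + 1) D deg key' (q(x + n := rotate1 (q (x + n))))"
      unfolding key'_def by (rule down_scan_step[OF invar xj(1) False y_def])
    moreover have "rep ?s' D deg key' (q(x + n := rotate1 (q (x + n))))"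
      using s3(1) unfolding run by simp
    moreover have r: "regs ?s' 6 = x" "regs ?s' 8 = j - 1"
      using r3[of 6] r1 unfolding run by simp_all
    ultimately have "scan_state m M ?s'"
      unfolding scan_state_def r bj using M xj by (intro exI conjI) (assumption | simp)+
    moreover have "kept s ?s'" unfolding kept_def run using r3 r1(7) by simp
    ultimately show ?thesis using r by blast
  qed
  then show "scan_state m M ?s'" "kept s ?s'"
    "regs ?s' 8 = regs s 8 - 1" using regs by auto
qed

text \<open>Sufficient for an inserted and for a deleted copy: an iteration costs at most 2002, and
  the summand 6 also pays for the code outside the loops.\<close>

definition copy_cost :: "nat \<Rightarrow> real" where
  "copy_cost M = (phi M * (b + 1) + b + 6) * 2002"

lemma insert_copy_total:
  assumes rep: "rep s D deg key q" and invar: "invar m (\<lambda>_. 0) D deg key q"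
    and uv: "u < n" "v < n" "u \<noteq> v" "regs s 3 = u" "regs s 4 = v"
    and m: "m {u, v} < b" and M: "\<forall>y<n. deg y \<le> M"
  shows "runs_in w insert_copy s (copy_cost M) (\<lambda>s'. \<exists>D deg key q. rep s' D deg key q \<and>
    invar (m({u, v} := m {u, v} + 1)) (\<lambda>_. 0) D deg key q \<and> (\<forall>y<n. deg y \<le> M + 1) \<and>
    regs s' 2 = regs s 2 \<and> regs s' 3 = u \<and> regs s' 4 = v \<and> regs s' 10 = regs s 10 - 1)"
proof -
  let ?m = "m({u, v} := m {u, v} + 1)"
  define x y where "x = (if deg v < deg u then v else u)" and "y = (if deg v < deg u then u else v)"
  have xy: "x < n" "y < n" "x \<noteq> y" "{x, y} = {u, v}" "deg x \<le> deg y"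
    using uv by (auto simp: x_def y_def)
  note R = repD_regs[OF rep]
  define s1 where "s1 = set_reg 12 y (set_reg 11 x s)"
  have rep1: "rep s1 D deg key q" "regs s1 11 = x" "regs s1 12 = y" using rep by (simp_all add: s1_def)
  define s2 where "s2 = run w add_arc s1"
  have d: "deg x \<le> tol (deg y)" using xy(5) le_tol[of "deg y"] by simp
  have "m {x, y} < b" using m xy(4) by simp
  note 2 = add_arc_inv[OF rep1(1) invar rep1(2,3) xy(1-3) this d, folded s2_def]
  have "(\<lambda>_. 0::int)(x := 0 + 1) = (\<lambda>_. 0)(x := 1)" by simp
  then obtain D2 key2 q2 where rep2: "rep s2 D2 deg key2 q2" and inv2: "invar ?m ((\<lambda>_. 0)(x := 1)) D2 deg key2 q2"
    using 2(1) xy(4) by auto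
  have r2: "r < 13 \<Longrightarrow> regs s2 r = regs s1 r" for r using 2(2) by simp
  define s3 where "s3 = set_reg 9 1 (set_reg 8 b (set_reg 6 x s2))"
  have rep3: "rep s3 D2 deg key2 q2" "regs s3 6 = x" "regs s3 8 = b" "regs s3 9 = 1"
    using rep2 by (simp_all add: s3_def)
  have "run w (choose_arc (Less (Load 2 (Reg 4)) (Load 2 (Reg 3)))) s = s1"
    using uv R(5) by (simp add: choose_arc_def s1_def x_def y_def)
  then have run: "run w insert_start s = s3"
    unfolding insert_start_def using r2[of 11] r2[of 1] rep1(2) repD_regs(2)[OF rep1(1)]
    by (simp add: s2_def[symmetric] s3_def)
  have k3: "kept s s3" using r2 by (simp add: kept_def s3_def s1_def)
  let ?Q = "\<lambda>s'. \<exists>D deg key q. rep s' D deg key q \<and>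
    invar ?m (\<lambda>_. 0) D deg key q \<and> (\<forall>y<n. deg y \<le> M + 1) \<and>
    regs s' 2 = regs s 2 \<and> regs s' 3 = u \<and> regs s' 4 = v \<and> regs s' 10 = regs s 10 - 1"
  let ?rest = "Seq (While (Reg 9) up_step) (Assign 10 (Sub (Reg 10) (Const 1)))"
  have loop: "runs_in w (While (Reg 9) up_step) s3 ((phi M * (b + 1) + b + 2) * 2002)
    (\<lambda>s'. runs_in w (Assign 10 (Sub (Reg 10) (Const 1))) s' 10 ?Q)"
    by (rule runs_in_mono[OF up_loop_total[OF rep3(1) inv2 xy(1) rep3(2-4) M] order_refl])
      (intro runs_in_run; use k3 uv in \<open>auto simp: kept_def\<close>)
  have "runs_in w ?rest (run w insert_start s) ((phi M * (b + 1) + b + 2) * 2002 + 11) ?Q"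
    unfolding run by (rule runs_in_seq[OF loop]) simp
  moreover have "loop_free insert_start" "real (max_cost insert_start) \<le> 1000"
    using step_costs(7,8) by (simp_all add: insert_start_def choose_arc_def)
  ultimately have "runs_in w insert_start s 1000
      (\<lambda>s'. runs_in w ?rest s' ((phi M * (b + 1) + b + 2) * 2002 + 11) ?Q)"
    by (rule runs_in_run[rotated 2])
  then show ?thesis
    unfolding insert_copy_def
    by (rule runs_in_seq) (simp add: copy_cost_def algebra_simps)
qed

lemma down_loop_total:
  assumes "down_state m M s" and "regs s 9 = 1"
  shows "runs_in w (While (Reg 9) down_step) s ((phi M + 2) * 2002)
    (\<lambda>s'. kept s s' \<and> down_state m M s' \<and> regs s' 9 = 0)"
proof (rule runs_in_while[where I = "\<lambda>s'. down_state m M s' \<and> kept s s'" and V = "down_measure M" and B = 2000])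
  show "down_state m M s \<and> kept s s" using assms by (simp add: kept_def)
  show "0 \<le> down_measure M s" if "down_state m M s \<and> kept s0 s" for s s0
    using that down_measure_nonneg by blast
  show "runs_in w down_step s1 2000
      (\<lambda>s'. (down_state m M s' \<and> kept s s') \<and> down_measure M s' \<le> down_measure M s1 - 1)"
    if "down_state m M s1 \<and> kept s s1" "eval w s1 (Reg 9) \<noteq> 0" for s1
    using down_step_run[of m M s1] that step_costs(3,4) by (intro runs_in_run) (auto simp: kept_def)
  show "(down_measure M s + 1) * (2000 + 1 + real (exp_cost (Reg 9))) \<le> (phi M + 2) * 2002"
    using phi_nonneg by (simp add: down_measure_def)
qed (use down_measure_nonneg in auto)

lemma scan_loop_total:
  assumes "scan_state m M s" "regs s 8 = b"
  shows "runs_in w (While (Reg 8) down_refresh) s ((real b + 1) * 2002)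
    (\<lambda>s'. kept s s' \<and> (\<exists>D deg key q. rep s' D deg key q \<and> invar m (\<lambda>_. 0) D deg key q \<and> (\<forall>y<n. deg y \<le> M)))"
proof (rule runs_in_while[where I = "\<lambda>s'. scan_state m M s' \<and> kept s s'" and V = "\<lambda>s. real (regs s 8)" and B = 2000])
  show "scan_state m M s \<and> kept s s" using assms by (simp add: kept_def)
  show "runs_in w down_refresh s1 2000
      (\<lambda>s'. (scan_state m M s' \<and> kept s s') \<and> real (regs s' 8) \<le> real (regs s1 8) - 1)"
    if "scan_state m M s1 \<and> kept s s1" "eval w s1 (Reg 8) \<noteq> 0" for s1
    using down_refresh_run[of m M s1] that step_costs(5,6) by (intro runs_in_run) (auto simp: kept_def)
  show "kept s s1 \<and> (\<exists>D deg key q. rep s1 D deg key q \<and> invar m (\<lambda>_. 0) D deg key q \<and> (\<forall>y<n. deg y \<le> M))"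
    if "scan_state m M s1 \<and> kept s s1" "eval w s1 (Reg 8) = 0" for s1
    using that down_scan_finish unfolding scan_state_def by fastforce
  show "(real (regs s 8) + 1) * (2000 + 1 + real (exp_cost (Reg 8))) \<le> (real b + 1) * 2002"
    using assms by simp
qed simp_all

lemma delete_copy_total:
  assumes rep: "rep s D deg key q" and invar: "invar m (\<lambda>_. 0) D deg key q"
    and uv: "u < n" "v < n" "u \<noteq> v" "regs s 3 = u" "regs s 4 = v"
    and m: "0 < m {u, v}" and M: "\<forall>y<n. deg y \<le> M"
  shows "runs_in w delete_copy s (copy_cost M) (\<lambda>s'. \<exists>D deg key q. rep s' D deg key q \<and>
    invar (m({u, v} := m {u, v} - 1)) (\<lambda>_. 0) D deg key q \<and> (\<forall>y<n. deg y \<le> M) \<and>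
    regs s' 2 = regs s 2 \<and> regs s' 3 = u \<and> regs s' 4 = v \<and> regs s' 10 = regs s 10 - 1)"
proof -
  let ?m = "m({u, v} := m {u, v} - 1)"
  let ?Q = "\<lambda>s'. \<exists>D deg key q. rep s' D deg key q \<and>
    invar ?m (\<lambda>_. 0) D deg key q \<and> (\<forall>y<n. deg y \<le> M) \<and>
    regs s' 2 = regs s 2 \<and> regs s' 3 = u \<and> regs s' 4 = v \<and> regs s' 10 = regs s 10 - 1"
  note c = invarD(1)[OF invar]
  define x y where "x = (if 0 < D v u then v else u)" and "y = (if 0 < D v u then u else v)"
  \<comment> \<open>Some copy is left, so at least one direction has a copy to remove.\<close>
  have "0 < D u v + D v u" using m core_arc(2)[OF c uv(1,2)] uv(3) by simp
  then have xy: "x < n" "y < n" "{x, y} = {u, v}" "0 < D x y"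
    using uv by (auto simp: x_def y_def)
  note R = repD_regs[OF rep]
  define s1 where "s1 = set_reg 12 y (set_reg 11 x s)"
  have rep1: "rep s1 D deg key q" "regs s1 11 = x" "regs s1 12 = y" using rep by (simp_all add: s1_def)
  define s2 where "s2 = run w remove_arc s1"
  note 2 = remove_arc_inv[OF rep1(1) invar rep1(2,3) xy(1,2,4), folded s2_def]
  have "(\<lambda>_. 0::int)(x := 0 - 1) = (\<lambda>_. 0)(x := - 1)" by simp
  then obtain D2 key2 q2 where rep2: "rep s2 D2 deg key2 q2" and inv2: "invar ?m ((\<lambda>_. 0)(x := - 1)) D2 deg key2 q2"
    using 2(1) xy(3) by auto
  have r2: "r < 13 \<Longrightarrow> regs s2 r = regs s1 r" for r using 2(2) by simp
  define s3 where "s3 = set_reg 9 1 (set_reg 6 x s2)"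
  have rep3: "rep s3 D2 deg key2 q2" "regs s3 6 = x" "regs s3 9 = 1"
    using rep2 by (simp_all add: s3_def)
  have "run w (choose_arc (Load 0 (cell (Reg 4) (Reg 3)))) s = s1"
    using uv R(1,6) by (simp add: choose_arc_def s1_def x_def y_def)
  then have run: "run w delete_start s = s3"
    unfolding delete_start_def using r2[of 11] rep1(2) by (simp add: s2_def[symmetric] s3_def)
  have k3: "kept s s3" using r2 by (simp add: kept_def s3_def s1_def)
  have st: "down_state ?m M s3"
    unfolding down_state_def rep3(2,3) using rep3(1) inv2 M xy(1)
    by (intro exI[of _ D2] exI[of _ deg] exI[of _ key2] exI[of _ q2]) simp
  define last where "last = Assign 10 (Sub (Reg 10) (Const 1))"
  \<comment> \<open>The phases are treated from the last to the first, since each one has the run of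
    all later phases as its postcondition.\<close>
  have last: "runs_in w last s' 10 ?Q" if "kept s s'"
    "\<exists>D deg key q. rep s' D deg key q \<and> invar ?m (\<lambda>_. 0) D deg key q \<and> (\<forall>y<n. deg y \<le> M)" for s'
    unfolding last_def using that uv by (intro runs_in_run) (auto simp: kept_def)
  have scan: "runs_in w (Seq (While (Reg 8) down_refresh) last) s' ((real b + 1) * 2002 + 11) ?Q"
    if "kept s s'" "scan_state ?m M s'" "regs s' 8 = b" for s'
  proof (rule runs_in_seq)
    show "runs_in w (While (Reg 8) down_refresh) s' ((real b + 1) * 2002)
      (\<lambda>s'. runs_in w last s' 10 ?Q)"
      using that(1) by (intro runs_in_mono[OF scan_loop_total[OF that(2,3)] order_refl] last)
        (auto simp: kept_def)
  qed simp
  have mid: "runs_in w (Seq decrement (Seq (While (Reg 8) down_refresh) last)) s'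
      ((real b + 1) * 2002 + 42) ?Q"
    if k: "kept s s'" and st: "down_state ?m M s'" and r9: "regs s' 9 = 0" for s'
  proof (rule runs_in_seq)
    define z where "z = regs s' 6"
    from st r9 obtain D deg key q where rep: "rep s' D deg key q" and z: "z < n"
      and M: "\<forall>y<n. deg y \<le> M" and invar: "invar ?m ((\<lambda>_. 0)(z := -1)) D deg key q"
      and none: "\<And>y. y < n \<Longrightarrow> 0 < D y z \<Longrightarrow>
        key y z \<noteq> tol (deg z - 1) + 1 \<and> key y z \<noteq> tol (deg z - 1) + 2"
      unfolding down_state_def z_def by auto
    have run: "run w decrement s' = set_reg 8 b (set_array 2 z (deg z - 1) s')"
      unfolding decrement_def using repD_regs(2,5)[OF rep] z by (simp add: z_def[symmetric])
    have "rep (run w decrement s') D (deg(z := deg z - 1)) key q"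
      unfolding run using rep by (simp add: rep_def repD_def repB_def repQ_def)
    moreover have "down_inv ?m z 0 D (deg(z := deg z - 1)) key q"
      by (rule down_scan_start[OF invar z refl none])
    moreover have r: "regs (run w decrement s') 6 = z" "regs (run w decrement s') 8 = b"
      unfolding run by (simp_all add: z_def)
    moreover have "\<forall>y<n. (deg(z := deg z - 1)) y \<le> M" using M z by (auto intro: le_trans[OF diff_le_self])
    ultimately have "scan_state ?m M (run w decrement s')"
      unfolding scan_state_def r using z
      by (intro exI[of _ D] exI[of _ "deg(z := deg z - 1)"] exI[of _ key] exI[of _ q]) simp
    moreover have "kept s (run w decrement s')" using k unfolding kept_def run by simp
    ultimately show "runs_in w decrement s' 30
      (\<lambda>s'. runs_in w (Seq (While (Reg 8) down_refresh) last) s' ((real b + 1) * 2002 + 11) ?Q)"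
      using r by (intro runs_in_run scan) (auto simp: decrement_def)
  qed simp
  have loop: "runs_in w (Seq (While (Reg 9) down_step) (Seq decrement (Seq (While (Reg 8) down_refresh) last))) s3
      ((phi M + 2) * 2002 + (real b + 1) * 2002 + 43) ?Q"
    by (rule runs_in_seq[OF runs_in_mono[OF down_loop_total[OF st rep3(3)] order_refl mid]])
      (use k3 in \<open>auto simp: kept_def\<close>)
  show ?thesis
    unfolding delete_copy_def last_def[symmetric]
  proof (rule runs_in_seq)
    show "runs_in w delete_start s 1000 (\<lambda>s'. runs_in w
      (Seq (While (Reg 9) down_step) (Seq decrement (Seq (While (Reg 8) down_refresh) last))) s'
      ((phi M + 2) * 2002 + (real b + 1) * 2002 + 43) ?Q)"
    proof (rule runs_in_run)
      show "loop_free delete_start" "real (max_cost delete_start) \<le> 1000"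
        using step_costs(9,10) by (simp_all add: delete_start_def choose_arc_def cell_def)
    qed (unfold run, rule loop)
    have "0 \<le> phi M * b" using phi_nonneg by simp
    then show "1 + 1000 + ((phi M + 2) * 2002 + (real b + 1) * 2002 + 43) \<le> copy_cost M"
      by (simp add: copy_cost_def algebra_simps)
  qed
qed

text \<open>Register 5 is 0 before the first update and is recomputed by \<open>prepare\<close>, so
  the representation is demanded only after setting it.\<close>

definition settled :: "graph \<Rightarrow> state \<Rightarrow> bool" where
  "settled E s \<longleftrightarrow> (\<exists>D deg key q. rep (set_reg 5 keys s) D deg key q \<and>
     invar (duplicate b E) (\<lambda>_. 0) D deg key q)"

lemma copy_cost_mono: "M \<le> M' \<Longrightarrow> copy_cost M \<le> copy_cost M'"
  unfolding copy_cost_def using phi_mono by (intro mult_right_mono add_right_mono) auto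

lemma copy_cost_nonneg: "0 \<le> copy_cost M"
  unfolding copy_cost_def using phi_nonneg by simp

text \<open>Each inserted copy can raise the largest degree by one, so \<open>M + b\<close> bounds
  the degrees throughout.\<close>

lemma insert_loop_total:
  assumes rep: "rep s D deg key q" and invar: "invar m (\<lambda>_. 0) D deg key q"
    and uv: "u < n" "v < n" "u \<noteq> v" "regs s 3 = u" "regs s 4 = v" "regs s 10 = b"
    and m: "m {u, v} = 0" and M: "\<forall>y<n. deg y \<le> M"
  shows "runs_in w (While (Reg 10) insert_copy) s ((real b + 1) * (copy_cost (M + b) + 2))
    (\<lambda>s'. \<exists>D deg key q. rep s' D deg key q \<and> invar (m({u, v} := b)) (\<lambda>_. 0) D deg key q)"
proof -
  let ?I = "\<lambda>s. regs s 3 = u \<and> regs s 4 = v \<and> regs s 10 \<le> b \<and> (\<exists>D deg key q. rep s D deg key q \<and>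
      invar (m({u, v} := b - regs s 10)) (\<lambda>_. 0) D deg key q \<and> (\<forall>y<n. deg y \<le> M + (b - regs s 10)))"
  show ?thesis
  proof (rule runs_in_while[where V = "\<lambda>s. real (regs s 10)" and B = "copy_cost (M + b)" and
      I = ?I])
    have "m({u, v} := 0) = m" using m by auto
    then show "?I s"
      using uv rep invar M by auto
  next
    fix s1
    assume I: "?I s1"
      and e: "eval w s1 (Reg 10) \<noteq> 0"
    let ?m = "m({u, v} := b - regs s1 10)"
    from I obtain D deg key q where *: "rep s1 D deg key q" "invar ?m (\<lambda>_. 0) D deg key q"
      "\<forall>y<n. deg y \<le> M + (b - regs s1 10)" "regs s1 3 = u" "regs s1 4 = v" "regs s1 10 \<le> b" by blast
    have "?m {u, v} < b" using e *(6) by simp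
    note ins = insert_copy_total[OF *(1,2) uv(1-3) *(4,5) this *(3)]
    have c: "b - regs s1 10 + 1 = b - (regs s1 10 - 1)" using e *(6) by simp
    have "?m({u, v} := ?m {u, v} + 1) = m({u, v} := b - (regs s1 10 - 1))"
      "M + (b - regs s1 10) + 1 = M + (b - (regs s1 10 - 1))"
      by (simp_all only: fun_upd_same fun_upd_upd add.assoc c)
    note ins = ins[unfolded this]
    show "runs_in w insert_copy s1 (copy_cost (M + b)) (\<lambda>s. ?I s \<and>
        real (regs s 10) \<le> real (regs s1 10) - 1)"
    proof (rule runs_in_mono[OF ins])
      show "copy_cost (M + (b - regs s1 10)) \<le> copy_cost (M + b)" by (rule copy_cost_mono) simp
      fix s'
      assume "\<exists>D deg key q. rep s' D deg key q \<and>
        invar (m({u, v} := b - (regs s1 10 - 1))) (\<lambda>_. 0) D deg key q \<and>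
        (\<forall>y<n. deg y \<le> M + (b - (regs s1 10 - 1))) \<and>
        regs s' 2 = regs s1 2 \<and> regs s' 3 = u \<and> regs s' 4 = v \<and> regs s' 10 = regs s1 10 - 1"
      then obtain D' deg' key' q' where a: "rep s' D' deg' key' q'"
        "invar (m({u, v} := b - regs s' 10)) (\<lambda>_. 0) D' deg' key' q'"
        "\<forall>y<n. deg' y \<le> M + (b - regs s' 10)" "regs s' 3 = u" "regs s' 4 = v"
        and r: "regs s' 10 = regs s1 10 - 1" by metis
      have "regs s' 10 \<le> b" "real (regs s' 10) \<le> real (regs s1 10) - 1" using e *(6) r by simp_all
      then show "?I s' \<and> real (regs s' 10) \<le> real (regs s1 10) - 1" using a by blast
    qed
  qed (auto simp: copy_cost_nonneg uv)
qed

lemma delete_loop_total: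
  assumes rep: "rep s D deg key q" and invar: "invar m (\<lambda>_. 0) D deg key q"
    and uv: "u < n" "v < n" "u \<noteq> v" "regs s 3 = u" "regs s 4 = v" "regs s 10 = b"
    and m: "m {u, v} = b" and M: "\<forall>y<n. deg y \<le> M"
  shows "runs_in w (While (Reg 10) delete_copy) s ((real b + 1) * (copy_cost M + 2))
    (\<lambda>s'. \<exists>D deg key q. rep s' D deg key q \<and> invar (m({u, v} := 0)) (\<lambda>_. 0) D deg key q)"
proof -
  let ?I = "\<lambda>s. regs s 3 = u \<and> regs s 4 = v \<and> (\<exists>D deg key q. rep s D deg key q \<and>
      invar (m({u, v} := regs s 10)) (\<lambda>_. 0) D deg key q \<and> (\<forall>y<n. deg y \<le> M))"
  show ?thesis
  proof (rule runs_in_while[where V = "\<lambda>s. real (regs s 10)" and B = "copy_cost M" and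
      I = ?I])
    have "m({u, v} := b) = m" using m by auto
    then show "?I s"
      using uv rep invar M by auto
  next
    fix s1
    assume I: "?I s1"
      and e: "eval w s1 (Reg 10) \<noteq> 0"
    let ?m = "m({u, v} := regs s1 10)"
    from I obtain D deg key q where *: "rep s1 D deg key q" "invar ?m (\<lambda>_. 0) D deg key q"
      "\<forall>y<n. deg y \<le> M" "regs s1 3 = u" "regs s1 4 = v" by blast
    have "0 < ?m {u, v}" using e by simp
    note del = delete_copy_total[OF *(1,2) uv(1-3) *(4,5) this *(3)]
    have "?m({u, v} := ?m {u, v} - 1) = m({u, v} := regs s1 10 - 1)" by auto
    note del = del[unfolded this]
    show "runs_in w delete_copy s1 (copy_cost M) (\<lambda>s. ?I s \<and> real (regs s 10) \<le> real (regs s1 10) - 1)"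
      by (rule runs_in_mono[OF del order_refl]) (use e in \<open>elim exE conjE; simp; blast\<close>)
  qed (auto simp: copy_cost_nonneg uv)
qed

lemma program_total:
  assumes settled: "settled E s" and x: "valid_update n E x" and M: "\<forall>y<n. arrays s 2 y \<le> M"
  shows "runs_in w program (load_update x s) ((real b + 1) * (copy_cost (M + b) + 2) + 100)
    (settled (apply_update x E))"
proof -
  from settled obtain D deg key q where rep: "rep (set_reg 5 keys s) D deg key q"
    and invar: "invar (duplicate b E) (\<lambda>_. 0) D deg key q" unfolding settled_def by blast
  have degM: "\<forall>y<n. deg y \<le> M" using repD_regs(5)[OF rep] M by simp
  obtain i u v where i: "x = (if i = (1::nat) then Insert u v else Delete u v)" "i \<le> 1"
  proof (cases x)
    case (Insert u v)
    then show ?thesis using that[of 1 u v] by simp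
  next
    case (Delete u v)
    then show ?thesis using that[of 0 u v] by simp
  qed
  have uv: "u < n" "v < n" "u \<noteq> v" "i = 1 \<longleftrightarrow> {u, v} \<notin> E"
    using x i by (auto split: if_splits)
  have ld: "load_update x s = set_reg 2 i (set_reg 3 u (set_reg 4 v s))"
  proof -
    have "i = 0 \<or> i = 1" using i(2) by linarith
    then show ?thesis using i(1) by (elim disjE) simp_all
  qed
  have r: "regs s 0 = n" "regs s 1 = b" using repD_regs(1,2)[OF rep] by simp_all
  have keys: "keys \<le> n * keys" using n by simp
  have "b * 1 \<le> b * n" using n by (intro mult_le_mono2) auto
  then have "2 * b < keys" "2 * b * n + 16 \<le> keys" "2 * b * n \<le> keys" "16 \<le> keys" unfolding keys_def mult.assoc by linarith+
  then have "2 * b \<le> n * keys" "2 * b * n + 16 \<le> n * keys" "2 * b * n \<le> n * keys" "16 \<le> n * keys"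
    using keys by linarith+
  note W = this[THEN word_less]
  define s1 where "s1 = set_reg 10 b (set_reg 5 keys (load_update x s))"
  have run: "run w prepare (load_update x s) = s1"
    unfolding prepare_def s1_def ld using r W by (simp add: keys_def)
  have rep1: "rep s1 D deg key q" using rep r unfolding s1_def ld by (simp add: rep_def)
  have r1: "regs s1 2 = i" "regs s1 3 = u" "regs s1 4 = v" "regs s1 10 = b" by (simp_all add: s1_def ld)
  have "settled E' s'" if "\<exists>D deg key q. rep s' D deg key q \<and> invar m (\<lambda>_. 0) D deg key q" "m = duplicate b E'"
    for s' m E' using that unfolding settled_def rep_def by auto
  note settledI = this
  have loop: "runs_in w (Cond (Reg 2) (While (Reg 10) insert_copy) (While (Reg 10) delete_copy)) s1
    ((real b + 1) * (copy_cost (M + b) + 2) + 5) (settled (apply_update x E))"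
  proof (rule runs_in_cond)
    assume "eval w s1 (Reg 2) \<noteq> 0"
    then have i1: "i = 1" using r1 i by auto
    have "duplicate b E {u, v} = 0" using i1 uv by (simp add: duplicate_def)
    note ins = insert_loop_total[OF rep1 invar uv(1-3) r1(2-4) this degM]
    have "(duplicate b E)({u, v} := b) = duplicate b (apply_update x E)"
      using i1 i(1) by (auto simp: duplicate_def)
    then show "runs_in w (While (Reg 10) insert_copy) s1 ((real b + 1) * (copy_cost (M + b) + 2))
      (settled (apply_update x E))"
      using settledI by (intro runs_in_mono[OF ins order_refl]) blast
  next
    assume "eval w s1 (Reg 2) = 0"
    then have i0: "i = 0" using r1 by auto
    have "duplicate b E {u, v} = b" using i0 uv by (simp add: duplicate_def)
    note del = delete_loop_total[OF rep1 invar uv(1-3) r1(2-4) this degM]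
    have "(duplicate b E)({u, v} := 0) = duplicate b (apply_update x E)"
      using i0 i(1) by (auto simp: duplicate_def)
    moreover have "(real b + 1) * (copy_cost M + 2) \<le> (real b + 1) * (copy_cost (M + b) + 2)"
      by (intro mult_left_mono add_right_mono copy_cost_mono) auto
    ultimately show "runs_in w (While (Reg 10) delete_copy) s1 ((real b + 1) * (copy_cost (M + b) + 2))
      (settled (apply_update x E))"
      using settledI by (intro runs_in_mono[OF del]) blast+
  qed simp
  show ?thesis
    unfolding program_def
  proof (rule runs_in_seq)
    show "runs_in w prepare (load_update x s) 30 (\<lambda>s'. runs_in w
      (Cond (Reg 2) (While (Reg 10) insert_copy) (While (Reg 10) delete_copy)) s'
      ((real b + 1) * (copy_cost (M + b) + 2) + 5) (settled (apply_update x E)))"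
    proof (rule runs_in_run)
      show "loop_free prepare" "real (max_cost prepare) \<le> 30" by (simp_all add: prepare_def)
    qed (unfold run, rule loop)
  qed simp
qed

lemma settled_init: "settled {} (init_state n b)"
proof -
  have "rep (set_reg 5 keys (init_state n b)) (\<lambda>_ _. 0) (\<lambda>_. 0) (\<lambda>_ _. 0) (\<lambda>_. [])"
    using n unfolding rep_def repD_def repB_def repQ_def queue_rep_def bag_rep_def init_state_def
    by (simp add: majority_def)
  moreover have "invar (duplicate b {}) (\<lambda>_. 0) (\<lambda>_ _. 0) (\<lambda>_. 0) (\<lambda>_ _. 0) (\<lambda>_. [])"
    unfolding invar_def core_def up_def down_def
    by (simp add: duplicate_def is_orientation_def outdeg_def)
  ultimately show ?thesis unfolding settled_def by blast
qed

lemma reachable_settled: "reachable w program n b E s \<Longrightarrow> settled E s"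
proof (induction rule: reachable.induct)
  case (step E s x t s')
  \<comment> \<open>Only the final state matters here, so any bound on the degrees will do.\<close>
  define M where "M = (\<Sum>y<n. arrays s 2 y)"
  have "\<forall>y<n. arrays s 2 y \<le> M" unfolding M_def by (auto intro: member_le_sum)
  from program_total[OF step.IH step.hyps(2) this] obtain t' s'' where
    "exec w program (load_update x s) t' s''" "settled (apply_update x E) s''"
    unfolding runs_in_def by blast
  then show ?case using exec_deterministic[OF step.hyps(3)] by blast
qed (rule settled_init)

end

section \<open>Density\<close>

lemma density_le:
  assumes "S \<subseteq> {..<n}" "S \<noteq> {}"
  shows "real (card (induced_edges E S)) \<le> max_density n E * card S"
proof -
  have "real (card (induced_edges E S)) / card S \<le> max_density n E"
    unfolding max_density_def using assms by (intro Max_ge) auto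
  moreover have "0 < card S" using assms finite_subset by (auto simp: card_gt_0_iff)
  ultimately show ?thesis by (simp add: field_simps)
qed

lemma max_density_nonneg:
  assumes "1 \<le> n"
  shows "0 \<le> max_density n E"
proof -
  have "real (card (induced_edges E {0})) \<le> max_density n E"
    using density_le[of "{0}" n E] assms by simp
  then show ?thesis by (rule order_trans[rotated]) simp
qed

lemma finite_simple_graph: "simple_graph n E \<Longrightarrow> finite E"
  by (rule finite_subset[of _ "Pow {..<n}"]) (auto simp: simple_graph_def)

text \<open>One edge changes the numerator by at most one and the denominator is at least one. This
  converts the degree bound before the update into the density after it.\<close>

lemma max_density_apply_update:
  assumes "1 \<le> n" and E: "simple_graph n E"
  shows "max_density n E \<le> max_density n (apply_update x E) + 1"
proof -
  let ?E = "apply_update x E"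
  have fin: "finite E" using finite_simple_graph[OF E] .
  have "real (card (induced_edges E S)) / card S \<le> max_density n ?E + 1" if S: "S \<subseteq> {..<n}" "S \<noteq> {}" for S
  proof -
    obtain e where "E \<subseteq> insert e ?E" by (cases x) auto
    then have "induced_edges E S \<subseteq> insert e (induced_edges ?E S)" by (auto simp: induced_edges_def)
    moreover have f: "finite (induced_edges ?E S)" using fin by (cases x) (auto simp: induced_edges_def)
    ultimately have "card (induced_edges E S) \<le> card (insert e (induced_edges ?E S))"
      by (intro card_mono) auto
    also have "\<dots> \<le> card (induced_edges ?E S) + 1" using f by (simp add: card_insert_if)
    finally have "real (card (induced_edges E S)) \<le> real (card (induced_edges ?E S)) + 1" by simp
    also have "\<dots> \<le> max_density n ?E * card S + 1" using density_le[OF S] by simp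
    also have "\<dots> \<le> (max_density n ?E + 1) * card S"
    proof -
      have "1 \<le> card S" using S finite_subset by (auto simp: Suc_le_eq card_gt_0_iff)
      then show ?thesis by (simp add: algebra_simps)
    qed
    finally have "real (card (induced_edges E S)) \<le> (max_density n ?E + 1) * card S" .
    moreover have "0 < card S" using S finite_subset by (auto simp: card_gt_0_iff)
    ultimately show ?thesis by (simp add: field_simps)
  qed
  moreover have "Pow {..<n} - {{}} \<noteq> {}" using assms(1) by auto
  ultimately show ?thesis unfolding max_density_def[of n E] by (intro Max.boundedI) auto
qed

text \<open>Merging \<open>(x, y)\<close> with \<open>(y, x)\<close> leaves the pairs with
  \<open>x < y\<close>, one for each edge inside \<open>S\<close>.\<close>

lemma sum_orientation:
  assumes D: "is_orientation n (duplicate b E) D" and E: "simple_graph n E" and S: "S \<subseteq> {..<n}"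
  shows "(\<Sum>x\<in>S. \<Sum>y\<in>S. D x y) = b * card (induced_edges E S)"
proof -
  have fin: "finite S" using S finite_subset by auto
  have "(\<Sum>x\<in>S. \<Sum>y\<in>S. D x y) = (\<Sum>(x, y)\<in>S \<times> S. D x y)" by (simp add: sum.cartesian_product)
  let ?L = "{(x, y) \<in> S \<times> S. x < y}" and ?G = "{(x, y) \<in> S \<times> S. y < x}"
  have "(\<Sum>(x, y)\<in>S \<times> S. D x y) = (\<Sum>(x, y)\<in>?L \<union> ?G. D x y)"
  proof (intro sum.mono_neutral_right ballI)
    fix p assume "p \<in> S \<times> S - (?L \<union> ?G)"
    then obtain x where "p = (x, x)" "x \<in> S" by (cases p) (force simp: neq_iff)
    then show "(case p of (x, y) \<Rightarrow> D x y) = 0" using D S by (auto simp: is_orientation_def)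
  qed (use fin in auto)
  also have "\<dots> = (\<Sum>(x, y)\<in>?L. D x y) + (\<Sum>(x, y)\<in>?G. D x y)"
    using fin by (intro sum.union_disjoint) (auto intro: finite_subset[of _ "S \<times> S"])
  also have "(\<Sum>(x, y)\<in>?G. D x y) = (\<Sum>(x, y)\<in>?L. D y x)"
    by (rule sum.reindex_bij_witness[of _ "\<lambda>(x, y). (y, x)" "\<lambda>(x, y). (y, x)"]) auto
  also have "(\<Sum>(x, y)\<in>?L. D x y) + (\<Sum>(x, y)\<in>?L. D y x) = (\<Sum>(x, y)\<in>?L. duplicate b E {x, y})"
    unfolding sum.distrib[symmetric] using S D
    by (intro sum.cong) (auto simp: is_orientation_def subset_iff)
  also have "\<dots> = (\<Sum>(x, y)\<in>{(x, y) \<in> S \<times> S. x < y \<and> {x, y} \<in> E}. b)"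
    using fin by (intro sum.mono_neutral_cong_right)
      (auto simp: duplicate_def split: if_splits intro: finite_subset[of _ "S \<times> S"])
  also have "\<dots> = b * card {(x, y) \<in> S \<times> S. x < y \<and> {x, y} \<in> E}"
    by (simp add: case_prod_unfold)
  also have "card {(x, y) \<in> S \<times> S. x < y \<and> {x, y} \<in> E} = card (induced_edges E S)"
  proof (rule bij_betw_same_card[of "\<lambda>(x, y). {x, y}"], unfold bij_betw_def, rule conjI)
    show "inj_on (\<lambda>(x, y). {x, y}) {(x, y). (x, y) \<in> S \<times> S \<and> x < y \<and> {x, y} \<in> E}"
      by (auto simp: inj_on_def doubleton_eq_iff)
    show "(\<lambda>(x, y). {x, y}) ` {(x, y). (x, y) \<in> S \<times> S \<and> x < y \<and> {x, y} \<in> E} = induced_edges E S"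
    proof (intro equalityI subsetI)
      fix e assume e: "e \<in> induced_edges E S"
      then have "card e = 2" "e \<subseteq> S" "e \<in> E" using E by (auto simp: simple_graph_def induced_edges_def)
      then obtain x y where "e = {x, y}" "x < y" by (metis card_2_iff insert_commute linorder_neqE_nat)
      then show "e \<in> (\<lambda>(x, y). {x, y}) ` {(x, y). (x, y) \<in> S \<times> S \<and> x < y \<and> {x, y} \<in> E}"
        using \<open>e \<subseteq> S\<close> \<open>e \<in> E\<close> by force
    qed (auto simp: induced_edges_def)
  qed
  finally show ?thesis using \<open>(\<Sum>x\<in>S. \<Sum>y\<in>S. D x y) = (\<Sum>(x, y)\<in>S \<times> S. D x y)\<close> by simp
qed

lemma ln2_ge_half: "1 / 2 \<le> ln (2::real)"
proof -
  have "exp (1 / 2) \<le> 1 + 1 / 2 + (1 / 2 :: real)\<^sup>2" by (intro exp_bound) auto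
  then have "exp (1 / 2) \<le> (2::real)" by (simp add: power2_eq_square)
  then show ?thesis by (subst ln_ge_iff) auto
qed

text \<open>
  The sets \<open>S i\<close> of vertices of out-degree at least \<open>\<Delta> (1 + \<epsilon>)\<^sup>-\<^sup>i\<close> grow from each to the next along
  arcs.  One of the first \<open>log n\<close> of them at most doubles, and the next set then is dense.
\<close>

lemma outdeg_le_density:
  fixes \<epsilon> :: real
  assumes D: "is_orientation n (duplicate b E) D" and E: "simple_graph n E" and n: "1 \<le> n"
    and \<epsilon>: "0 \<le> \<epsilon>" "\<epsilon> * ln (real n) \<le> 1 / 100"
    and fair: "\<And>x y. x < n \<Longrightarrow> y < n \<Longrightarrow> 0 < D x y \<Longrightarrow> real (outdeg n D x) \<le> (1 + \<epsilon>) * outdeg n D y"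
    and u: "u < n"
  shows "real (outdeg n D u) \<le> 4 * (b * max_density n E)"
proof -
  define \<Delta> where "\<Delta> = real (outdeg n D u)"
  define S where "S i = {x. x < n \<and> \<Delta> \<le> outdeg n D x * (1 + \<epsilon>) ^ i}" for i
  have fin: "finite (S i)" "S i \<subseteq> {..<n}" for i by (auto simp: S_def)
  have uS: "u \<in> S 0" using u by (simp add: S_def \<Delta>_def)
  have mono: "S i \<subseteq> S (Suc i)" for i
  proof
    fix x assume "x \<in> S i"
    then have x: "x < n" "\<Delta> \<le> outdeg n D x * (1 + \<epsilon>) ^ i" by (auto simp: S_def)
    have "outdeg n D x * (1 + \<epsilon>) ^ i * 1 \<le> outdeg n D x * (1 + \<epsilon>) ^ i * (1 + \<epsilon>)"
      using \<epsilon>(1) by (intro mult_left_mono) auto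
    then show "x \<in> S (Suc i)" using x by (simp add: S_def mult_ac)
  qed
  have "S 0 \<subseteq> S i" for i using mono by (induction i) auto
  then have uSi: "u \<in> S i" for i using uS by blast
  \<comment> \<open>If every early set more than doubled, induction would give
    \<open>2 ^ i \<le> card (S i)\<close> for all \<open>i\<close>, and
    \<open>card (S n) \<le> n\<close> contradicts this.\<close>
  have "\<exists>i. 2 ^ i \<le> n \<and> card (S (Suc i)) \<le> 2 * card (S i)"
  proof (rule ccontr)
    assume no: "\<not> ?thesis"
    have "2 ^ i \<le> card (S i)" for i
    proof (induction i)
      case 0
      have "0 < card (S 0)" using uS fin by (auto simp: card_gt_0_iff)
      then show ?case by simp
    next
      case (Suc i)
      have "card (S i) \<le> n" using card_mono[OF _ fin(2)] by fastforce
      then have "2 * card (S i) < card (S (Suc i))" using no Suc by (meson le_trans not_le)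
      then show ?case using Suc by simp
    qed
    moreover have "card (S n) \<le> n" using card_mono[OF _ fin(2)] by fastforce
    ultimately have "2 ^ n \<le> n" using le_trans by blast
    then show False using less_exp[of n] by simp
  qed
  then obtain i where i: "2 ^ i \<le> n" "card (S (Suc i)) \<le> 2 * card (S i)" by blast
  let ?\<rho> = "max_density n E"
  \<comment> \<open>Fairness loses a factor \<open>1 + \<epsilon>\<close>, which is exactly the
    difference between two successive sets; hence all arcs out of \<open>S i\<close> end in
    \<open>S (Suc i)\<close>.\<close>
  have succ: "y \<in> S (Suc i)" if "x \<in> S i" "y < n" "0 < D x y" for x y
  proof -
    have x: "x < n" "\<Delta> \<le> outdeg n D x * (1 + \<epsilon>) ^ i" using that(1) by (auto simp: S_def)
    have "outdeg n D x * (1 + \<epsilon>) ^ i \<le> (1 + \<epsilon>) * outdeg n D y * (1 + \<epsilon>) ^ i"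
      using fair[OF x(1) that(2,3)] \<epsilon>(1) by (intro mult_right_mono) auto
    then show ?thesis using x that(2) by (simp add: S_def mult_ac)
  qed
  have out: "outdeg n D x \<le> (\<Sum>y\<in>S (Suc i). D x y)" if "x \<in> S i" for x
  proof -
    have "outdeg n D x = (\<Sum>y\<in>S (Suc i). D x y)"
      unfolding outdeg_def using fin succ[OF that] by (intro sum.mono_neutral_right) auto
    then show ?thesis by simp
  qed
  have "\<Delta> * card (S i) = (\<Sum>x\<in>S i. \<Delta>)" by simp
  also have "\<dots> \<le> (\<Sum>x\<in>S i. real (outdeg n D x) * (1 + \<epsilon>) ^ i)"
    by (intro sum_mono) (auto simp: S_def)
  also have "\<dots> = real (\<Sum>x\<in>S i. outdeg n D x) * (1 + \<epsilon>) ^ i" by (simp add: sum_distrib_right)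
  also have "\<dots> \<le> real (b * card (induced_edges E (S (Suc i)))) * (1 + \<epsilon>) ^ i"
  proof (intro mult_right_mono)
    have "(\<Sum>x\<in>S i. outdeg n D x) \<le> (\<Sum>x\<in>S i. \<Sum>y\<in>S (Suc i). D x y)"
      by (intro sum_mono out)
    also have "\<dots> \<le> (\<Sum>x\<in>S (Suc i). \<Sum>y\<in>S (Suc i). D x y)"
      using mono fin by (intro sum_mono2) auto
    also have "\<dots> = b * card (induced_edges E (S (Suc i)))" by (rule sum_orientation[OF D E fin(2)])
    finally show "real (\<Sum>x\<in>S i. outdeg n D x) \<le> real (b * card (induced_edges E (S (Suc i))))"
      using of_nat_le_iff by blast
  qed (use \<epsilon>(1) in auto)
  \<comment> \<open>The constant 4 arises here: a factor 2 because the set at most doubles, and a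
    factor 2 that bounds \<open>(1 + \<epsilon>) ^ i\<close>.\<close>
  also have "\<dots> \<le> (b * (?\<rho> * (2 * card (S i)))) * 2"
  proof (intro mult_mono)
    have "real (card (induced_edges E (S (Suc i)))) \<le> ?\<rho> * card (S (Suc i))"
      using uSi by (intro density_le fin) auto
    also have "\<dots> \<le> ?\<rho> * (2 * card (S i))"
      using i(2) max_density_nonneg[OF n, of E] by (intro mult_left_mono) (auto simp flip: of_nat_mult)
    finally show "real (b * card (induced_edges E (S (Suc i)))) \<le> b * (?\<rho> * (2 * card (S i)))"
      by (simp add: mult_left_mono)
    have "real i * ln 2 \<le> ln (real n)"
    proof -
      have "2 ^ i \<le> real n" using i(1) by (metis of_nat_le_iff of_nat_numeral of_nat_power)
      then have "ln (2 ^ i) \<le> ln (real n)" by (intro ln_mono) auto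
      then show ?thesis by (simp add: ln_realpow)
    qed
    moreover have "1 / 2 \<le> ln (2::real)" by (rule ln2_ge_half)
    then have "real i * (1 / 2) \<le> real i * ln 2" by (intro mult_left_mono) auto
    \<comment> \<open>\<open>i\<close> is at most \<open>2 * ln n\<close>, so
      \<open>i * \<epsilon>\<close> is small and the power stays below
      \<open>exp (1 / 2)\<close>.\<close>
    ultimately have "\<epsilon> * (real i / 2) \<le> \<epsilon> * ln (real n)" using \<epsilon>(1) by (intro mult_left_mono) auto
    then have "real i * \<epsilon> \<le> 1 / 2" using \<epsilon>(2) by (simp add: mult_ac)
    have "(1 + \<epsilon>) ^ i \<le> exp \<epsilon> ^ i" using \<epsilon>(1) exp_ge_add_one_self by (intro power_mono) auto
    also have "\<dots> = exp (real i * \<epsilon>)" by (simp add: exp_of_nat_mult)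
    also have "\<dots> \<le> exp (1 / 2)" using \<open>real i * \<epsilon> \<le> 1 / 2\<close> by simp
    also have "\<dots> \<le> 1 + 1 / 2 + (1 / 2)\<^sup>2" by (intro exp_bound) auto
    finally show "(1 + \<epsilon>) ^ i \<le> 2" by (simp add: power2_eq_square)
  qed (use \<epsilon>(1) max_density_nonneg[OF n, of E] in auto)
  finally have "\<Delta> * card (S i) \<le> (4 * (b * ?\<rho>)) * card (S i)" by (simp add: mult_ac)
  moreover have "0 < card (S i)" using uSi[of i] fin[of i] by (auto simp: card_gt_0_iff)
  ultimately show ?thesis by (simp add: \<Delta>_def)
qed

text \<open>\<open>11 + 8 * \<rho>\<close> bounds the argument of the logarithm in
  \<open>phi\<close> when out-degrees are at most \<open>4 * b * (\<rho> + 1) + b\<close>. For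
  \<open>\<rho> > 1\<close> it is below \<open>19 * \<rho>\<close>, and
  \<open>19 \<le> exp 4\<close>.\<close>

lemma ln_le_log_factor:
  assumes "0 \<le> \<rho>"
  shows "ln (11 + 8 * \<rho>) \<le> 5 * log_factor \<rho>"
proof -
  have e: "11 \<le> exp (3::real)" "19 \<le> exp (4::real)"
  proof -
    have "(5 / 2) ^ 3 \<le> exp (1::real) ^ 3" "(5 / 2) ^ 4 \<le> exp (1::real) ^ 4"
      using exp_lower_Taylor_quadratic[of "1::real"] by (intro power_mono; simp)+
    moreover have "exp (1::real) ^ 3 = exp 3" "exp (1::real) ^ 4 = exp 4"
      by (simp_all flip: exp_of_nat_mult)
    ultimately show "11 \<le> exp (3::real)" "19 \<le> exp (4::real)" by (simp_all add: power_numeral_reduce)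
  qed
  show ?thesis
  proof (cases "\<rho> \<le> 1")
    case True
    have "ln (11 + 8 * \<rho>) \<le> ln (exp 4)" using True e assms by (intro ln_mono) auto
    then show ?thesis by (simp add: log_factor_def)
  next
    case False
    have "ln (11 + 8 * \<rho>) \<le> ln (exp 4 * \<rho>)"
    proof (intro ln_mono)
      have "19 * \<rho> \<le> exp 4 * \<rho>" using e False by (intro mult_right_mono) auto
      then show "11 + 8 * \<rho> \<le> exp 4 * \<rho>" using False by linarith
    qed (use False in auto)
    also have "\<dots> = 4 + ln \<rho>" using False by (subst ln_mult) auto
    also have "\<dots> \<le> 5 * log_factor \<rho>" unfolding log_factor_def by linarith
    finally show ?thesis .
  qed
qed

text \<open>Here \<open>p\<close> stands for the number of reversals per copy and \<open>L\<close>
  for the logarithmic factor. The leading term is the product of copies, reversals and refreshes;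
  \<open>100 \<le> b\<close> and \<open>1 \<le> L\<close> absorb the rest.\<close>

lemma cost_arith:
  fixes b L :: real
  assumes "100 \<le> b" "1 \<le> L" "p \<le> 5 * b * L"
  shows "(b + 1) * ((p * (b + 1) + b + 6) * 2002 + 2) + 100 \<le> 50000 * (b ^ 3 * L)"
proof -
  have bb: "b \<le> b * b" "1 \<le> b" "100 \<le> b * b" using assms(1) mult_mono[of 10 b 10 b] by auto
  have "b * b * 1 \<le> b * b * L" using assms by (intro mult_left_mono) auto
  then have bbL: "b * b \<le> b * b * L" by simp
  have "b * L \<le> b * b * L" using bb assms by (intro mult_right_mono) auto
  have "p * (b + 1) \<le> 5 * b * L * (b + 1)" using assms by (intro mult_right_mono) auto
  also have "\<dots> = 5 * (b * b * L) + 5 * (b * L)" by (simp add: algebra_simps)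
  finally have *: "p * (b + 1) \<le> 10 * (b * b * L)" "b + 6 \<le> 2 * (b * b * L)"
    using \<open>b * L \<le> b * b * L\<close> bbL bb assms(1) by linarith+
  have "(p * (b + 1) + b + 6) * 2002 + 2 \<le> 24025 * (b * b * L)"
  proof -
    have "(Y + b + 6) * 2002 + 2 \<le> 24025 * X" if "Y \<le> 10 * X" "b + 6 \<le> 2 * X" "100 \<le> X" for X Y :: real
    proof -
      have "(Y + b + 6) * 2002 \<le> (12 * X) * 2002" using that by (intro mult_right_mono) auto
      then show ?thesis using that(3) by simp
    qed
    from this[OF *(1,2)] show ?thesis using bbL bb by linarith
  qed
  then have "(b + 1) * ((p * (b + 1) + b + 6) * 2002 + 2) \<le> (b + 1) * (24025 * (b * b * L))"
    using assms(1) by (intro mult_left_mono) auto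
  also have "\<dots> = 24025 * (b ^ 3 * L) + 24025 * (b * b * L)" by (simp add: power3_eq_cube algebra_simps)
  finally have 1: "(b + 1) * ((p * (b + 1) + b + 6) * 2002 + 2) \<le> 24025 * (b ^ 3 * L) + 24025 * (b * b * L)" .
  have "1 * (b * b * L) \<le> b * (b * b * L)" using bb bbL by (intro mult_right_mono) auto
  then have "b * b * L \<le> b ^ 3 * L" by (simp add: power3_eq_cube mult_ac)
  then show ?thesis using 1 bbL bb by linarith
qed

lemma outdeg_cong: "u < n \<Longrightarrow> (\<And>v. v < n \<Longrightarrow> D u v = D' u v) \<Longrightarrow> outdeg n D u = outdeg n D' u"
  by (simp add: outdeg_def)

lemma is_orientation_cong:
  "is_orientation n m D \<Longrightarrow> (\<And>u v. u < n \<Longrightarrow> v < n \<Longrightarrow> D' u v = D u v) \<Longrightarrow> is_orientation n m D'"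
  by (simp add: is_orientation_def)

lemma majority_orientation:
  assumes "is_orientation n (duplicate b E) D" "0 < b"
  shows "is_orientation n (duplicate 1 E) (majority D)"
  using assms unfolding is_orientation_def
proof (intro conjI allI impI)
  fix u v assume "u < n" "v < n" "u \<noteq> v"
  then have "D u v + D v u = (if {u, v} \<in> E then b else 0)"
    using assms(1) by (simp add: is_orientation_def duplicate_def)
  then show "majority D u v + majority D v u = duplicate 1 E {u, v}"
    using \<open>0 < b\<close> \<open>u \<noteq> v\<close> by (auto simp: majority_def duplicate_def split: if_splits)
qed (auto simp: majority_def is_orientation_def)

text \<open>A majority arc carries at least half of the \<open>b\<close> copies of its edge.\<close>

lemma majority_outdeg:
  assumes D: "is_orientation n (duplicate b E) D" and u: "u < n"
  shows "b * outdeg n (majority D) u \<le> 2 * outdeg n D u"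
  unfolding outdeg_def sum_distrib_left
proof (rule sum_mono)
  fix v assume v: "v \<in> {..<n}"
  show "b * majority D u v \<le> 2 * D u v"
  proof (cases "u = v")
    case False
    then have "D u v + D v u = (if {u, v} \<in> E then b else 0)"
      using D u v by (simp add: is_orientation_def duplicate_def)
    then show ?thesis by (auto simp: majority_def split: if_splits)
  qed (simp add: majority_def)
qed

section \<open>The maintained orientations meet the specification\<close>

context ram
begin

text \<open>Threshold and accuracy of keys give fairness up to an additive constant. Between updates
  every edge has all its \<open>b\<close> copies, which forces \<open>deg y\<close> to be of order
  \<open>b\<close>, so that the constant fits into a multiple of \<open>deg y / b\<close>.\<close>

lemma fair_settled:
  assumes invar: "invar (duplicate b E) (\<lambda>_. 0) D deg key q" and xy: "x < n" "y < n" and pos: "0 < D x y"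
  shows "real (deg x) \<le> (1 + 30 / b) * deg y"
proof -
  note c = invarD(1)[OF invar]
  define p where "p = deg y / real b"
  define s where "s = real (key x y)"
  have b0: "0 < real b" "100 \<le> real b" using b by auto
  have p: "0 \<le> p" "p \<le> deg y / 100"
    unfolding p_def using b0 by (simp, intro divide_left_mono) auto
  have sT: "s \<le> tol (deg y)" using coreD(5)[OF c xy pos] by (simp add: s_def)
  have "b * (4 * deg y div b) \<le> 4 * deg y" by simp
  then have "real b * real (4 * deg y div b) \<le> 4 * real (deg y)"
    by (metis of_nat_le_iff of_nat_mult of_nat_numeral)
  then have "real (4 * deg y div b) \<le> 4 * p" using b0 by (simp add: p_def field_simps)
  then have s: "s \<le> deg y + 8 + 4 * p" using sT by (simp add: tol_def)
  have "real (b * deg x) \<le> real (b * key x y + key x y + b)"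
    using key_near(1)[OF invar xy pos] of_nat_le_iff by blast
  then have "real (deg x) \<le> s + s / b + 1" using b0 by (simp add: s_def field_simps)
  moreover have "s / b \<le> (deg y + 8 + 4 * p) / b" using s b0 by (intro divide_right_mono) auto
  moreover have "(deg y + 8 + 4 * p) / b = p + 8 / b + 4 * (p / b)" by (simp add: p_def add_divide_distrib)
  moreover have "8 / real b \<le> 8 / 100" "p / b \<le> p / 100"
    by (rule divide_left_mono; use b0 p in simp)+
  \<comment> \<open>The exact sum is \<open>5.04 * p + 9.08\<close>, rounded up.\<close>
  ultimately have d: "real (deg x) \<le> deg y + 6 * p + 10" using s p by linarith
  have ne: "x \<noteq> y" using core_arc(4)[OF c xy pos] .
  have "D x y + D y x = duplicate b E {x, y}" using core_arc(2)[OF c xy ne] .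
  then have "D x y + D y x = b" using pos by (auto simp: duplicate_def split: if_splits)
  moreover have "D x y \<le> outdeg n D x" "D y x \<le> outdeg n D y"
    unfolding outdeg_def using xy by (auto intro: member_le_sum)
  moreover have "outdeg n D x = deg x" "outdeg n D y = deg y" using coreD(4)[OF c] xy by auto
  \<comment> \<open>Each of the \<open>b\<close> copies leaves one of the two endpoints.\<close>
  ultimately have "b \<le> deg x + deg y" by linarith
  then have "real b \<le> deg x + real (deg y)" by (metis of_nat_le_iff of_nat_add)
  then have "real b \<le> (103 / 50) * deg y + 10" using d p by linarith
  \<comment> \<open>From \<open>b - 10 \<ge> 0.9 * b\<close> and
    \<open>0.9 / 2.06 > 0.43\<close>.\<close>
  then have "(43 / 100) * real b \<le> deg y" using b0 by linarith
  then have "43 / 100 \<le> p" using b0 by (simp add: p_def field_simps)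
  \<comment> \<open>The constant 10 is at most \<open>24 * p\<close>, since
    \<open>p \<ge> 0.43\<close>; together with \<open>6 * p\<close> this gives the 30.\<close>
  then have "real (deg x) \<le> deg y + 30 * p" using d by linarith
  then show ?thesis by (simp add: p_def algebra_simps)
qed

lemma reachable_maintains:
  assumes "reachable w program n b E s"
  shows "maintains_orientations n b E s"
    "u < n \<Longrightarrow> v < n \<Longrightarrow> 0 < multi_orientation n s u v \<Longrightarrow>
      real (outdeg n (multi_orientation n s) u) \<le> (1 + 30 / b) * outdeg n (multi_orientation n s) v"
    "u < n \<Longrightarrow> b * outdeg n (simple_orientation n s) u \<le> 2 * outdeg n (multi_orientation n s) u"
    "u < n \<Longrightarrow> arrays s 2 u = outdeg n (multi_orientation n s) u"
proof -
  let ?D = "multi_orientation n s" and ?S = "simple_orientation n s"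
  from reachable_settled[OF assms] obtain D deg key q where
    rep: "rep (set_reg 5 keys s) D deg key q" and invar: "invar (duplicate b E) (\<lambda>_. 0) D deg key q"
    unfolding settled_def by blast
  note c = invarD(1)[OF invar]
  note o = coreD(1)[OF c]
  have m: "?D u v = D u v" "?S u v = majority D u v"
    if "u < n" "v < n" for u v
    using rep that by (auto simp: rep_def repD_def multi_orientation_def simple_orientation_def)
  have out: "outdeg n ?D u = outdeg n D u"
    "outdeg n ?S u = outdeg n (majority D) u" if "u < n" for u
    using m that by (auto intro: outdeg_cong)
  have deg: "outdeg n D u = deg u" if "u < n" for u using coreD(4)[OF c that] by simp
  show "maintains_orientations n b E s"
    unfolding maintains_orientations_def
    using is_orientation_cong[OF o m(1)] b
      is_orientation_cong[OF majority_orientation[OF o] m(2)] by (simp add: m majority_def)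
  show "real (outdeg n ?D u) \<le> (1 + 30 / b) * outdeg n ?D v"
    if "u < n" "v < n" "0 < ?D u v"
    using fair_settled[OF invar that(1,2)] that by (simp add: m out deg)
  show "b * outdeg n ?S u \<le> 2 * outdeg n ?D u" if "u < n"
    using majority_outdeg[OF o that] that by (simp add: out)
  show "arrays s 2 u = outdeg n ?D u" if "u < n"
    using repD_regs(5)[OF rep that] that by (simp add: out deg)
qed

text \<open>\<open>out\<close> is a hypothesis because it depends on \<open>1 / b\<close> being
  small against \<open>1 / ln n\<close>, which the locale does not provide.\<close>

lemma program_time:
  assumes r: "reachable w program n b E s" and x: "valid_update n E x"
    and out: "\<forall>u<n. real (outdeg n (multi_orientation n s) u) \<le> 4 * (b * max_density n E)"
  shows "\<exists>t s'. exec w program (load_update x s) t s' \<and>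
    real t \<le> 50000 * (real b ^ 3 * log_factor (max_density n (apply_update x E)))"
proof -
  let ?\<rho> = "max_density n E" and ?\<rho>' = "max_density n (apply_update x E)"
  define M where "M = nat \<lfloor>4 * (b * ?\<rho>)\<rfloor>"
  have n1: "1 \<le> n" using n by simp
  have \<rho>: "0 \<le> ?\<rho>" "0 \<le> ?\<rho>'" "?\<rho> \<le> ?\<rho>' + 1"
    using max_density_nonneg[OF n1] max_density_apply_update[OF n1 reachable_simple_graph[OF r]] by auto
  have M: "real M \<le> 4 * (b * ?\<rho>)" unfolding M_def using \<rho>(1) by (simp add: of_nat_floor)
  have "\<forall>u<n. arrays s 2 u \<le> M"
    using out reachable_maintains(4)[OF r] unfolding M_def by (simp add: le_nat_floor)
  from program_total[OF reachable_settled[OF r] x this] obtain t s' where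
    t: "exec w program (load_update x s) t s'" "real t \<le> (real b + 1) * (copy_cost (M + b) + 2) + 100"
    unfolding runs_in_def by blast
  have b0: "0 < real b" "100 \<le> real b" using b by auto
  have "2 * real (M + b) / b \<le> 8 * ?\<rho> + 2" using M b0 by (simp add: field_simps)
  \<comment> \<open>With \<open>M \<le> 4 * b * ?\<rho>\<close> the left side is at most
    \<open>3 + 8 * ?\<rho>\<close>; passing to the density after the update adds 8.\<close>
  then have "1 + 2 * real (M + b) / b \<le> 11 + 8 * ?\<rho>'" using \<rho> by linarith
  then have "ln (1 + 2 * real (M + b) / b) \<le> ln (11 + 8 * ?\<rho>')"
    using b0 by (intro ln_mono) (auto intro: add_pos_nonneg)
  also have "\<dots> \<le> 5 * log_factor ?\<rho>'" using ln_le_log_factor[OF \<rho>(2)] .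
  finally have "b * ln (1 + 2 * real (M + b) / b) \<le> b * (5 * log_factor ?\<rho>')"
    using b0 by (intro mult_left_mono) auto
  then have p: "phi (M + b) \<le> 5 * real b * log_factor ?\<rho>'" unfolding phi_def by (simp add: mult_ac)
  have "1 \<le> log_factor ?\<rho>'" by (simp add: log_factor_def)
  from cost_arith[OF b0(2) this p] show ?thesis
    using t unfolding copy_cost_def by (intro exI[of _ t] exI[of _ s']) (auto simp: add_ac)
qed

end

text \<open>For one vertex the hypothesis on \<open>\<eta> / b\<close> is void because
  \<open>ln 1 = 0\<close>, so \<open>b\<close> may be small. But no update is valid, and only the
  initial state has to be examined.\<close>

lemma reachable_single_vertex:
  assumes "reachable w P (Suc 0) b E s"
  shows "E = {} \<and> s = init_state (Suc 0) b"
  using assms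
proof (induction rule: reachable.induct)
  case (step E s x t s')
  then show ?case by (cases x) auto
qed simp

theorem theorem5:
  fixes \<gamma> :: real
  assumes "\<gamma> > 0"
  shows "\<exists>(C\<^sub>1::real) (C\<^sub>2::real) (C\<^sub>3::real) (C\<^sub>4::real \<Rightarrow> real) (k::nat).
    C\<^sub>1 > 0 \<and> C\<^sub>2 > 0 \<and> C\<^sub>3 > 0 \<and> (\<forall>\<beta>>0. C\<^sub>4 \<beta> > 0) \<and>
    (\<forall>\<eta>::real. \<eta> > 1280 \<longrightarrow> (\<exists>P::com. \<forall>(n::nat) (b::nat) (w::nat).
      n \<ge> 1 \<longrightarrow> b \<ge> 1 \<longrightarrow>
      (\<eta> / real b) * (100 * ln (real n) * max (1 / \<gamma>) 1) \<le> 1 \<longrightarrow>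
      (n + b) ^ k \<le> 2 ^ w \<longrightarrow>
      (\<forall>E s. reachable w P n b E s \<longrightarrow>
         maintains_orientations n b E s \<and>
         (\<forall>u<n. \<forall>v<n. multi_orientation n s u v > 0 \<longrightarrow>
            real (outdeg n (multi_orientation n s) u)
              \<le> (1 + \<eta> / real b) * real (outdeg n (multi_orientation n s) v)) \<and>
         (\<forall>u<n. real (outdeg n (multi_orientation n s) u) \<le> C\<^sub>1 * (real b * max_density n E)) \<and>
         (\<forall>u<n. real (outdeg n (simple_orientation n s) u) \<le> C\<^sub>2 * max_density n E) \<and>
         (\<forall>x. valid_update n E x \<longrightarrow> (\<exists>t s'. exec w P (load_update x s) t s' \<and>
            real t \<le> C\<^sub>3 * (real b ^ 3 * log_factor (max_density n (apply_update x E))) \<and>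
            (\<forall>\<beta>>0. real b \<le> \<beta> * ln (real n) \<longrightarrow>
               real t \<le> C\<^sub>4 \<beta> * (ln (real n) ^ 3 *
                 log_factor (max_density n (apply_update x E)))))))))"
proof (rule exI[of _ "4::real"], rule exI[of _ "8::real"], rule exI[of _ "50000::real"],
    rule exI[of _ "\<lambda>\<beta>::real. 50000 * \<beta> ^ 3"], rule exI[of _ "8::nat"], intro conjI allI impI,
    simp, simp, simp, simp, rule exI[of _ program], intro conjI allI impI)
  \<comment> \<open>The constant 8 is 4 from the density bound times 2 from the majority, and the
    exponent 8 is that of the word length in the locale. One program serves all
    \<open>\<eta>\<close>, \<open>n\<close> and \<open>b\<close>.\<close>
  fix \<eta> :: real and n b w :: nat and E s
  assume \<eta>: "1280 < \<eta>" and n1: "1 \<le> n" and b: "1 \<le> b"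
    and \<epsilon>: "\<eta> / real b * (100 * ln (real n) * max (1 / \<gamma>) 1) \<le> 1"
    and w: "(n + b) ^ 8 \<le> 2 ^ w" and r: "reachable w program n b E s"
  let ?D = "multi_orientation n s" and ?S = "simple_orientation n s"
  have *: "maintains_orientations n b E s \<and>
    (\<forall>u<n. \<forall>v<n. ?D u v > 0 \<longrightarrow>
      real (outdeg n ?D u)
        \<le> (1 + \<eta> / real b) * real (outdeg n ?D v)) \<and>
    (\<forall>u<n. real (outdeg n ?D u) \<le> 4 * (real b * max_density n E)) \<and>
    (\<forall>u<n. real (outdeg n ?S u) \<le> 8 * max_density n E) \<and>
    (\<forall>x. valid_update n E x \<longrightarrow> (\<exists>t s'. exec w program (load_update x s) t s' \<and>
      real t \<le> 50000 * (real b ^ 3 * log_factor (max_density n (apply_update x E)))))"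
  proof (cases "n = 1")
    case True
    then have Es: "E = {}" "s = init_state n b" using reachable_single_vertex r by auto
    have "\<not> valid_update n E x" for x using True by (cases x) auto
    moreover have "0 \<le> max_density n E" using max_density_nonneg[OF n1] .
    ultimately show ?thesis
      by (simp add: Es maintains_orientations_def is_orientation_def duplicate_def outdeg_def
          multi_orientation_def simple_orientation_def init_state_def)
  next
    case False
    then have n2: "2 \<le> n" using n1 by simp
    have b0: "0 < real b" using b by simp
    have "ln 2 \<le> ln (real n)" using n2 by (intro ln_mono) auto
    then have ln: "1 / 2 \<le> ln (real n)" using ln2_ge_half by simp
    then have "ln (real n) * 1 \<le> ln (real n) * max (1 / \<gamma>) 1" by (intro mult_left_mono) auto
    then have "\<eta> / b * (100 * ln (real n)) \<le> \<eta> / b * (100 * ln (real n) * max (1 / \<gamma>) 1)"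
      using \<eta> b0 by (intro mult_left_mono) auto
    then have 1: "\<eta> * (100 * ln (real n)) \<le> b" using \<epsilon> b0 by (simp add: field_simps)
    \<comment> \<open>Together with \<open>ln n \<ge> 1 / 2\<close> this makes \<open>b\<close> at
      least 64000, of which only 100 is kept.\<close>
    have "1280 * (100 * (1 / 2)) \<le> \<eta> * (100 * ln (real n))" using \<eta> ln by (intro mult_mono) auto
    then have b100: "100 \<le> b" using 1 by linarith
    \<comment> \<open>The algorithm is fair up to \<open>30 / b\<close>, so this is the value of
      \<open>\<epsilon>\<close> in the density bound; \<open>\<eta> / b\<close> is larger.\<close>
    have "30 * (100 * ln (real n)) \<le> \<eta> * (100 * ln (real n))" using \<eta> ln by (intro mult_right_mono) auto
    then have 2: "30 / real b * ln (real n) \<le> 1 / 100" using 1 b0 by (simp add: field_simps)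
    interpret ram n b w using n2 b100 w by unfold_locales
    note R = reachable_maintains[OF r]
    have out: "real (outdeg n ?D u) \<le> 4 * (b * max_density n E)" if "u < n" for u
    proof (rule outdeg_le_density[OF _ reachable_simple_graph[OF r] n1 _ 2 R(2) that])
      show "is_orientation n (duplicate b E) ?D"
        using R(1) by (simp add: maintains_orientations_def)
    qed auto
    have "real (outdeg n ?D u) \<le> (1 + \<eta> / b) * outdeg n ?D v"
      if "u < n" "v < n" "?D u v > 0" for u v
    proof -
      have "(1 + 30 / real b) * outdeg n ?D v
        \<le> (1 + \<eta> / b) * outdeg n ?D v"
        using \<eta> b0 by (intro mult_right_mono) (auto simp: divide_right_mono)
      then show ?thesis using R(2)[OF that] by linarith
    qed
    moreover have "real (outdeg n ?S u) \<le> 8 * max_density n E" if "u < n" for u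
    proof -
      have "real (b * outdeg n ?S u) \<le> real (2 * outdeg n ?D u)"
        using R(3)[OF that] of_nat_le_iff by blast
      then have "real b * outdeg n ?S u \<le> b * (8 * max_density n E)"
        using out[OF that] by simp
      then show ?thesis using b0 by simp
    qed
    ultimately show ?thesis using R(1) out program_time[OF r] by blast
  qed
  then show "maintains_orientations n b E s" by blast
  show "real (outdeg n ?D u) \<le> (1 + \<eta> / real b) * real (outdeg n ?D v)"
    if "u < n" "v < n" "?D u v > 0" for u v using * that by blast
  show "real (outdeg n ?D u) \<le> 4 * (real b * max_density n E)" if "u < n" for u
    using * that by blast
  show "real (outdeg n ?S u) \<le> 8 * max_density n E" if "u < n" for u
    using * that by blast
  fix x assume "valid_update n E x"
  then obtain t s' where t: "exec w program (load_update x s) t s'"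
    "real t \<le> 50000 * (real b ^ 3 * log_factor (max_density n (apply_update x E)))" using * by blast
  let ?L = "log_factor (max_density n (apply_update x E))"
  have "real t \<le> 50000 * \<beta> ^ 3 * (ln (real n) ^ 3 * ?L)" if "real b \<le> \<beta> * ln (real n)" for \<beta>
  proof -
    have "real b ^ 3 \<le> (\<beta> * ln (real n)) ^ 3" using that by (intro power_mono) auto
    then have "50000 * (real b ^ 3 * ?L) \<le> 50000 * ((\<beta> * ln (real n)) ^ 3 * ?L)"
      by (intro mult_left_mono mult_right_mono) (auto simp: log_factor_def)
    then show ?thesis using t(2) by (simp add: power_mult_distrib mult_ac)
  qed
  with t show "\<exists>t s'. exec w program (load_update x s) t s' \<and>
    real t \<le> 50000 * (real b ^ 3 * ?L) \<and>
    (\<forall>\<beta>>0. real b \<le> \<beta> * ln (real n) \<longrightarrow> real t \<le> 50000 * \<beta> ^ 3 * (ln (real n) ^ 3 * ?L))" by blast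
qed

end
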